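(* Let $a,b>0$ and $u>0$. Suppose that both $a/b$ and $b/a$ have infinitely many best lower approximations of the third kind. Then the number of gaps in the spectrum of the periodic rectangular lattice quantum graph with edge lengths $a$ and $b$ and repulsive $\delta$ potentials of strength $u$ in the vertices is either infinite or zero.
   Context: For $\theta\in\mathbb{R}$, $p\in\mathbb{Z}$, $q\in\mathbb{N}$, the fraction $\frac{p}{q}$ is a best lower approximation of the third kind to $\theta$ if $0\le q^{2}(\theta-\frac{p}{q})<(q')^{2}(\theta-\frac{p'}{q'})$ for all $p'\in\mathbb{Z}$, $q'\in\mathbb{N}$ with $\frac{p'}{q'}\le\theta$, $\frac{p'}{q'}\ne\frac{p}{q}$ and $q'\le q$. The periodic rectangular lattice graph has vertices $(ja,kb)$, $j,k\in\mathbb{Z}$, and edges the horizontal segments of length $a$ and vertical segments of length $b$ joining neighbouring vertices. The quantum graph Hamiltonian $H$ acts on $L^2$ of this graph as $f\mapsto -f''$ on each edge, with domain consisting of functions that are $H^2$ on each edge, continuous at each vertex $v$, and satisfy $\sum_{e\ni v}f_e'(v)=u f(v)$ at each vertex, where $f_e'(v)$ are the derivatives along the edges $e$ incident to $v$ taken in the outward direction from $v$ ($\delta$ coupling of strength $u$; repulsive means $u>0$). A gap in the spectrum is a bounded connected component of $\mathbb{R}\setminus\sigma(H)$. *)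

theory Defs
  imports "HOL-Analysis.Analysis"
begin

definition best_lower_third :: "real \<Rightarrow> int \<Rightarrow> nat \<Rightarrow> bool" where
  "best_lower_third \<theta> p q \<longleftrightarrow> 0 < q \<and>
     0 \<le> (real q)\<^sup>2 * (\<theta> - real_of_int p / real q) \<and>
     (\<forall>(p'::int) (q'::nat). 0 < q' \<and> q' \<le> q \<and>
        real_of_int p' / real q' \<le> \<theta> \<and> real_of_int p' / real q' \<noteq> real_of_int p / real q
        \<longrightarrow> (real q)\<^sup>2 * (\<theta> - real_of_int p / real q)
            < (real q')\<^sup>2 * (\<theta> - real_of_int p' / real q'))"

(* Fractions are collected as numbers, so that p/q and (2p)/(2q) count once. This matters for
   rational \<theta> = p/q, which is represented by every pair (np, nq). *)
definition best_lower_thirds :: "real \<Rightarrow> real set" where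
  "best_lower_thirds \<theta> = {real_of_int p / real q | p q. best_lower_third \<theta> p q}"


(* Elements of L2 are representatives; equality in the Hilbert space is equality almost
   everywhere. *)
definition L2 :: "'x measure \<Rightarrow> ('x \<Rightarrow> complex) set" where
  "L2 M = {f \<in> borel_measurable M. integrable M (\<lambda>x. (cmod (f x))\<^sup>2)}"

definition L2_norm :: "'x measure \<Rightarrow> ('x \<Rightarrow> complex) \<Rightarrow> real" where
  "L2_norm M f = sqrt (\<integral>x. (cmod (f x))\<^sup>2 \<partial>M)"

(* A linear operator T in L2 is given by its graph: the pairs (f, h) of representatives with
   f in the domain and h = T f. The three conditions on z say that T - z maps its domain
   injectively and onto L2, with bounded inverse. *)
definition resolvent_set ::
    "'x measure \<Rightarrow> (('x \<Rightarrow> complex) \<times> ('x \<Rightarrow> complex)) set \<Rightarrow> complex set" where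
  "resolvent_set M T = {z.
     (\<forall>(f, h)\<in>T. (AE x in M. h x - z * f x = 0) \<longrightarrow> (AE x in M. f x = 0)) \<and>
     (\<forall>g\<in>L2 M. \<exists>(f, h)\<in>T. AE x in M. h x - z * f x = g x) \<and>
     (\<exists>C. \<forall>(f, h)\<in>T. L2_norm M f \<le> C * L2_norm M (\<lambda>x. h x - z * f x))}"

definition spectrum ::
    "'x measure \<Rightarrow> (('x \<Rightarrow> complex) \<times> ('x \<Rightarrow> complex)) set \<Rightarrow> complex set" where
  "spectrum M T = - resolvent_set M T"

definition spectral_gaps ::
    "'x measure \<Rightarrow> (('x \<Rightarrow> complex) \<times> ('x \<Rightarrow> complex)) set \<Rightarrow> real set set" where
  "spectral_gaps M T =
     {G \<in> components {x::real. complex_of_real x \<notin> spectrum M T}. bounded G}"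


(* The vertex (j, k) is the point (j a, k b) of the plane. *)
type_synonym vertex = "int \<times> int"

(* Each edge is named after its left, respectively lower, endpoint. *)
datatype edge = Hor vertex | Ver vertex

instance edge :: countable
  by countable_datatype

fun edge_source :: "edge \<Rightarrow> vertex" where
  "edge_source (Hor v) = v"
| "edge_source (Ver v) = v"

fun edge_target :: "edge \<Rightarrow> vertex" where
  "edge_target (Hor (j, k)) = (j + 1, k)"
| "edge_target (Ver (j, k)) = (j, k + 1)"

fun edge_length :: "real \<Rightarrow> real \<Rightarrow> edge \<Rightarrow> real" where
  "edge_length a b (Hor v) = a"
| "edge_length a b (Ver v) = b"

(* The point (e, t) of the metric graph lies on e at distance t from the source of e. *)
definition lattice_graph :: "real \<Rightarrow> real \<Rightarrow> (edge \<times> real) measure" where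
  "lattice_graph a b = restrict_space (count_space UNIV \<Otimes>\<^sub>M lborel)
     (SIGMA e:UNIV. {0..edge_length a b e})"

(* \<phi> belongs to the Sobolev space of order 2 on (0, l), with first and second weak derivatives
   \<phi>1 and \<phi>2. As usual \<phi> and \<phi>1 are the continuous representatives on [0, l]: \<phi> is
   continuously differentiable with absolutely continuous derivative \<phi>1, and \<phi>2 is the almost
   everywhere derivative of \<phi>1. *)
definition sobolev_H2 ::
    "real \<Rightarrow> (real \<Rightarrow> complex) \<Rightarrow> (real \<Rightarrow> complex) \<Rightarrow> (real \<Rightarrow> complex) \<Rightarrow> bool" where
  "sobolev_H2 l \<phi> \<phi>1 \<phi>2 \<longleftrightarrow>
     (\<forall>x\<in>{0..l}. (\<phi> has_vector_derivative \<phi>1 x) (at x within {0..l})) \<and>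
     \<phi>2 \<in> L2 (restrict_space lborel {0..l}) \<and>
     (\<forall>x\<in>{0..l}. \<phi>1 x = \<phi>1 0 + (LBINT t:{0..x}. \<phi>2 t))"

(* In the vertex condition, the outward derivative at the target end of an edge is minus the
   derivative with respect to t. F v is the common value at v. *)
definition delta_hamiltonian ::
    "real \<Rightarrow> real \<Rightarrow> real \<Rightarrow> ((edge \<times> real \<Rightarrow> complex) \<times> (edge \<times> real \<Rightarrow> complex)) set" where
  "delta_hamiltonian a b u = {(f, h).
     f \<in> L2 (lattice_graph a b) \<and> h \<in> L2 (lattice_graph a b) \<and>
     (\<exists>(f' :: edge \<Rightarrow> real \<Rightarrow> complex) (F :: vertex \<Rightarrow> complex).
        (\<forall>e. sobolev_H2 (edge_length a b e) (\<lambda>t. f (e, t)) (f' e) (\<lambda>t. - h (e, t))) \<and>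
        (\<forall>e. f (e, 0) = F (edge_source e) \<and> f (e, edge_length a b e) = F (edge_target e)) \<and>
        (\<forall>v. (\<Sum>e | edge_source e = v. f' e 0) +
             (\<Sum>e | edge_target e = v. - f' e (edge_length a b e)) = complex_of_real u * F v))}"

end

(* For real mu let s, c solve s' = c, c' = - mu s, s(0) = 0, c(0) = 1. Eliminating the edges turns
   (H - mu) f = g into a difference equation for the vertex values: D F(v) is the sum of F(w) / s(edge)
   over the four neighbours w of v plus a source term, where D = u + 2 c(a)/s(a) + 2 c(b)/s(b). If
   D > 2/|s(a)| + 2/|s(b)| the equation is diagonally dominant and mu is in the resolvent set; otherwise
   there is a bounded Bloch wave, and cutting it off on boxes of side n gives Weyl sequences, so mu is in
   the spectrum.

   For mu = k^2 the gap condition reads u > 2k (tan(x/2) + tan(y/2)), where x and y are the residues of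
   ka and kb modulo pi. Such a k beyond the first band, with n = floor(ka/pi), m = floor(kb/pi) and say
   n/a >= m/b, forces n^2 (b/a - m/n) < u a / pi^2, because y >= kb - m pi is bounded below by its value at
   n pi/a. The best lower approximations p/q of the third kind to b/a with q >= n satisfy the same bound
   with a uniform margin, and conversely this bound makes the gap condition hold just above k = q pi/a
   once q is large. Hence one gap produces gaps at arbitrarily high energies. *)

theory Submission
  imports Defs "HOL-Real_Asymp.Real_Asymp"
begin

section \<open>Square integrability on the metric graph\<close>

text \<open>Nonpositive energies always satisfy the gap condition, so the component containing them
  is unbounded and is not a gap. A bounded component therefore lies above some point of the
  spectrum. This excludes the range where ka and kb are both below pi, since there the condition is
  inherited by all smaller energies. The uniform margin comes from the strict inequality in the
  definition of a best approximation: every approximation with large denominator, other than m/n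
  itself, stays below the one fixed value n^2 (b/a - m/n). Both ratios are needed because the given
  gap decides which of n/a and m/b is larger. On the operator side the delicate point is the bounded
  inverse. Diagonal dominance bounds the vertex values only once their squares are known to have a
  finite sum, and membership of f in the domain does not say so directly. A trace estimate,
  controlling f at an endpoint by f and H f on the edge, supplies it.\<close>

definition edge_sq :: "real \<Rightarrow> (real \<Rightarrow> complex) \<Rightarrow> ennreal" where
  "edge_sq l \<phi> = (\<integral>\<^sup>+ t\<in>{0..l}. ennreal ((cmod (\<phi> t))\<^sup>2) \<partial>lborel)"

definition edge_L2 :: "real \<Rightarrow> (real \<Rightarrow> complex) \<Rightarrow> bool" where
  "edge_L2 l \<phi> \<longleftrightarrow> set_borel_measurable lborel {0..l} \<phi> \<and> edge_sq l \<phi> < \<infinity>"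

definition graph_sq :: "real \<Rightarrow> real \<Rightarrow> (edge \<times> real \<Rightarrow> complex) \<Rightarrow> ennreal" where
  "graph_sq a b f = (\<integral>\<^sup>+ e. edge_sq (edge_length a b e) (\<lambda>t. f (e, t)) \<partial>count_space UNIV)"

lemma sets_lattice: "(SIGMA e:UNIV. {0..edge_length a b e}) \<in> sets (count_space UNIV \<Otimes>\<^sub>M lborel)"
proof -
  have "(SIGMA e:UNIV. {0..edge_length a b e}) = (\<Union>e. {e} \<times> {0..edge_length a b e})" by auto
  also have "\<dots> \<in> sets (count_space UNIV \<Otimes>\<^sub>M lborel)"
    by (intro sets.countable_UN) (auto intro!: pair_measureI)
  finally show ?thesis .
qed

text \<open>The edges are countable and carry the counting measure, so a function on the product is
  measurable as soon as each of its edge sections is.\<close>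

lemma measurable_lattice_iff:
  fixes f :: "edge \<times> real \<Rightarrow> complex"
  shows "f \<in> borel_measurable (lattice_graph a b) \<longleftrightarrow>
     (\<forall>e. set_borel_measurable lborel {0..edge_length a b e} (\<lambda>t. f (e, t)))"
proof -
  let ?S = "SIGMA e:UNIV. {0..edge_length a b e}"
  have ind: "indicator ?S (e, t) = (indicator {0..edge_length a b e} t :: real)" for e t
    by (auto simp: indicator_def)
  have "f \<in> borel_measurable (lattice_graph a b) \<longleftrightarrow>
     (\<lambda>x. indicator ?S x *\<^sub>R f x) \<in> borel_measurable (count_space UNIV \<Otimes>\<^sub>M lborel)"
    unfolding lattice_graph_def
    by (rule borel_measurable_restrict_space_iff) (use sets_lattice[of a b] in \<open>simp add: space_pair_measure\<close>)
  also have "\<dots> \<longleftrightarrow> (\<forall>e. (\<lambda>t. indicator ?S (e, t) *\<^sub>R f (e, t)) \<in> borel_measurable lborel)"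
  proof
    assume *: "(\<lambda>x. indicator ?S x *\<^sub>R f x) \<in> borel_measurable (count_space UNIV \<Otimes>\<^sub>M lborel)"
    show "\<forall>e. (\<lambda>t. indicator ?S (e, t) *\<^sub>R f (e, t)) \<in> borel_measurable lborel"
    proof
      fix e :: edge
      have "(\<lambda>t::real. (e, t)) \<in> lborel \<rightarrow>\<^sub>M count_space UNIV \<Otimes>\<^sub>M lborel"
        by measurable
      from measurable_compose[OF this *]
      show "(\<lambda>t. indicator ?S (e, t) *\<^sub>R f (e, t)) \<in> borel_measurable lborel" by simp
    qed
  next
    assume "\<forall>e. (\<lambda>t. indicator ?S (e, t) *\<^sub>R f (e, t)) \<in> borel_measurable lborel"
    then show "(\<lambda>x. indicator ?S x *\<^sub>R f x) \<in> borel_measurable (count_space UNIV \<Otimes>\<^sub>M lborel)"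
      by (intro measurable_pair_measure_countable1) auto
  qed
  finally show ?thesis by (simp add: set_borel_measurable_def ind)
qed

lemma nn_integral_lattice:
  assumes "f \<in> borel_measurable (lattice_graph a b)"
  shows "(\<integral>\<^sup>+ x. ennreal ((cmod (f x))\<^sup>2) \<partial>lattice_graph a b) = graph_sq a b f"
proof -
  let ?S = "SIGMA e:UNIV. {0..edge_length a b e}"
  have ind: "indicator ?S (e, t) = (indicator {0..edge_length a b e} t :: ennreal)" for e t
    by (auto simp: indicator_def)
  have m: "(\<lambda>x. ennreal ((cmod (f x))\<^sup>2) * indicator ?S x) \<in> borel_measurable (count_space UNIV \<Otimes>\<^sub>M lborel)"
  proof -
    have "(\<lambda>x. indicator ?S x *\<^sub>R f x) \<in> borel_measurable (count_space UNIV \<Otimes>\<^sub>M lborel)"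
      using assms unfolding lattice_graph_def using sets_lattice[of a b]
      by (subst (asm) borel_measurable_restrict_space_iff) (auto simp: space_pair_measure)
    then have "(\<lambda>x. ennreal ((cmod (indicator ?S x *\<^sub>R f x))\<^sup>2)) \<in> borel_measurable (count_space UNIV \<Otimes>\<^sub>M lborel)"
      by measurable
    also have "(\<lambda>x. ennreal ((cmod (indicator ?S x *\<^sub>R f x))\<^sup>2)) = (\<lambda>x. ennreal ((cmod (f x))\<^sup>2) * indicator ?S x)"
      by (rule ext) (simp add: indicator_def)
    finally show ?thesis .
  qed
  have "(\<integral>\<^sup>+ x. ennreal ((cmod (f x))\<^sup>2) \<partial>lattice_graph a b) =
     (\<integral>\<^sup>+ x. ennreal ((cmod (f x))\<^sup>2) * indicator ?S x \<partial>(count_space UNIV \<Otimes>\<^sub>M lborel))"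
    unfolding lattice_graph_def using sets_lattice[of a b]
    by (subst nn_integral_restrict_space) (auto simp: space_pair_measure)
  also have "\<dots> = graph_sq a b f"
    unfolding graph_sq_def edge_sq_def
    by (subst lborel.nn_integral_fst[OF m, symmetric]) (simp add: ind)
  finally show ?thesis .
qed

lemma integrable_cmod_sq_iff:
  assumes "f \<in> borel_measurable M"
  shows "integrable M (\<lambda>x. (cmod (f x))\<^sup>2) \<longleftrightarrow> (\<integral>\<^sup>+ x. ennreal ((cmod (f x))\<^sup>2) \<partial>M) < \<infinity>"
  using assms by (subst integrable_iff_bounded) auto

lemma graph_L2_iff:
  "f \<in> L2 (lattice_graph a b) \<longleftrightarrow>
     (\<forall>e. set_borel_measurable lborel {0..edge_length a b e} (\<lambda>t. f (e, t))) \<and> graph_sq a b f < \<infinity>"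
  using nn_integral_lattice[of f a b] integrable_cmod_sq_iff[of f "lattice_graph a b"]
  by (auto simp: L2_def measurable_lattice_iff)

lemma edge_sq_le_graph_sq: "edge_sq (edge_length a b e) (\<lambda>t. f (e, t)) \<le> graph_sq a b f"
  unfolding graph_sq_def by (rule nn_integral_ge_point) simp

lemma graph_L2_edge: "f \<in> L2 (lattice_graph a b) \<Longrightarrow> edge_L2 (edge_length a b e) (\<lambda>t. f (e, t))"
  using edge_sq_le_graph_sq[of a b e f] by (auto simp: graph_L2_iff edge_L2_def)

lemma L2_norm_graph:
  assumes "f \<in> borel_measurable (lattice_graph a b)"
  shows "L2_norm (lattice_graph a b) f = sqrt (enn2real (graph_sq a b f))"
  unfolding L2_norm_def using assms
  by (subst integral_eq_nn_integral) (auto simp: nn_integral_lattice)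

lemma AE_zero_graph:
  assumes "f \<in> borel_measurable (lattice_graph a b)"
  shows "(AE x in lattice_graph a b. f x = 0) \<longleftrightarrow> graph_sq a b f = 0"
proof -
  have "graph_sq a b f = 0 \<longleftrightarrow> (AE x in lattice_graph a b. ennreal ((cmod (f x))\<^sup>2) = 0)"
    using assms by (subst nn_integral_lattice[OF assms, symmetric], subst nn_integral_0_iff_AE) auto
  then show ?thesis by simp
qed

section \<open>Square integrability on a single edge\<close>

lemma edge_L2_iff: "\<phi> \<in> L2 (restrict_space lborel {0..l}) \<longleftrightarrow> edge_L2 l \<phi>"
proof -
  have 1: "\<phi> \<in> borel_measurable (restrict_space lborel {0..l}) \<longleftrightarrow> set_borel_measurable lborel {0..l} \<phi>"
    by (subst borel_measurable_restrict_space_iff) (auto simp: set_borel_measurable_def)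
  have 2: "(\<integral>\<^sup>+ t. ennreal ((cmod (\<phi> t))\<^sup>2) \<partial>restrict_space lborel {0..l}) = edge_sq l \<phi>"
    unfolding edge_sq_def by (subst nn_integral_restrict_space) auto
  show ?thesis
    using 1 2 integrable_cmod_sq_iff[of \<phi> "restrict_space lborel {0..l}"]
    by (auto simp: L2_def edge_L2_def)
qed

lemma edge_L2_lincomb:
  assumes "edge_L2 l \<phi>" "edge_L2 l \<psi>"
  shows "edge_L2 l (\<lambda>t. z * \<phi> t + w * \<psi> t)"
    and "edge_sq l (\<lambda>t. z * \<phi> t + w * \<psi> t) \<le> ennreal (2 * (cmod z)\<^sup>2) * edge_sq l \<phi> + ennreal (2 * (cmod w)\<^sup>2) * edge_sq l \<psi>"
proof -
  have m [measurable]: "(\<lambda>t. indicator {0..l} t *\<^sub>R \<phi> t) \<in> borel_measurable lborel"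
    "(\<lambda>t. indicator {0..l} t *\<^sub>R \<psi> t) \<in> borel_measurable lborel"
    using assms by (auto simp: edge_L2_def set_borel_measurable_def)
  have "(\<lambda>t. z * (indicator {0..l} t *\<^sub>R \<phi> t) + w * (indicator {0..l} t *\<^sub>R \<psi> t)) \<in> borel_measurable lborel"
    by measurable
  then have 1: "set_borel_measurable lborel {0..l} (\<lambda>t. z * \<phi> t + w * \<psi> t)"
    by (simp add: set_borel_measurable_def scaleR_add_right)
  have sq: "(\<lambda>t. ennreal ((cmod (\<phi> t))\<^sup>2) * indicator {0..l} t) = (\<lambda>t. ennreal ((cmod (indicator {0..l} t *\<^sub>R \<phi> t))\<^sup>2))" for \<phi> :: "real \<Rightarrow> complex"
    by (auto simp: indicator_def)
  have sm: "(\<lambda>t. ennreal ((cmod (\<phi> t))\<^sup>2) * indicator {0..l} t) \<in> borel_measurable lborel"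
    "(\<lambda>t. ennreal ((cmod (\<psi> t))\<^sup>2) * indicator {0..l} t) \<in> borel_measurable lborel"
    unfolding sq by measurable
  have pw: "(cmod (z * x + w * y))\<^sup>2 \<le> 2 * (cmod z)\<^sup>2 * (cmod x)\<^sup>2 + 2 * (cmod w)\<^sup>2 * (cmod y)\<^sup>2" for x y
  proof -
    have "(cmod (z * x + w * y))\<^sup>2 \<le> (cmod z * cmod x + cmod w * cmod y)\<^sup>2"
      by (intro power_mono) (use norm_triangle_ineq[of "z*x" "w*y"] in \<open>auto simp: norm_mult\<close>)
    also have "\<dots> \<le> 2 * (cmod z * cmod x)\<^sup>2 + 2 * (cmod w * cmod y)\<^sup>2"
      using sum_squares_bound[of "cmod z * cmod x" "cmod w * cmod y"] by (simp add: power2_sum)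
    finally show ?thesis by (simp add: power_mult_distrib mult.assoc)
  qed
  have "edge_sq l (\<lambda>t. z * \<phi> t + w * \<psi> t) \<le>
     (\<integral>\<^sup>+ t. ennreal (2 * (cmod z)\<^sup>2) * (ennreal ((cmod (\<phi> t))\<^sup>2) * indicator {0..l} t) + ennreal (2 * (cmod w)\<^sup>2) * (ennreal ((cmod (\<psi> t))\<^sup>2) * indicator {0..l} t) \<partial>lborel)"
    unfolding edge_sq_def
    by (intro nn_integral_mono) (auto simp: indicator_def ennreal_mult[symmetric] ennreal_plus[symmetric] pw simp del: ennreal_plus intro!: ennreal_leI)
  also have "\<dots> = ennreal (2 * (cmod z)\<^sup>2) * edge_sq l \<phi> + ennreal (2 * (cmod w)\<^sup>2) * edge_sq l \<psi>"
    unfolding edge_sq_def using sm by (simp add: nn_integral_add nn_integral_cmult)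
  finally show 2: "edge_sq l (\<lambda>t. z * \<phi> t + w * \<psi> t) \<le> \<dots>" .
  have "\<dots> < \<infinity>" using assms by (auto simp: edge_L2_def ennreal_mult_less_top)
  with 1 2 show "edge_L2 l (\<lambda>t. z * \<phi> t + w * \<psi> t)"
    unfolding edge_L2_def using order.strict_trans1 by blast
qed

lemma edge_sq_le_const:
  assumes "\<And>t. t \<in> {0..l} \<Longrightarrow> (cmod (\<phi> t))\<^sup>2 \<le> K" "0 \<le> l"
  shows "edge_sq l \<phi> \<le> ennreal (K * l)"
proof -
  have "0 \<le> K" using assms(1)[of 0] assms(2) by (metis atLeastAtMost_iff order.refl order_trans zero_le_power2)
  have "edge_sq l \<phi> \<le> (\<integral>\<^sup>+ t. ennreal K * indicator {0..l} t \<partial>lborel)"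
    unfolding edge_sq_def using assms(1) by (intro nn_integral_mono) (auto simp: indicator_def ennreal_leI)
  also have "\<dots> = ennreal (K * l)"
    using \<open>0 \<le> K\<close> assms(2) by (simp add: nn_integral_cmult ennreal_mult)
  finally show ?thesis .
qed

lemma continuous_edge_L2:
  assumes "continuous_on {0..l} \<phi>"
  shows "edge_L2 l \<phi>"
proof -
  have "\<exists>K. \<forall>t\<in>{0..l}. cmod (\<phi> t) \<le> K"
    using compact_imp_bounded[OF compact_continuous_image[OF assms compact_Icc]]
    by (auto simp: bounded_iff)
  then obtain K where K: "\<And>t. t \<in> {0..l} \<Longrightarrow> cmod (\<phi> t) \<le> K" by blast
  have fin: "edge_sq l \<phi> < \<infinity>"
  proof (cases "0 \<le> l")
    case True
    have "edge_sq l \<phi> \<le> ennreal (K\<^sup>2 * l)"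
      using K True by (intro edge_sq_le_const power_mono) auto
    then show ?thesis using order.strict_trans1 by fastforce
  next
    case False
    then show ?thesis by (simp add: edge_sq_def)
  qed
  have "set_borel_measurable lborel {0..l} \<phi>"
    unfolding set_borel_measurable_def
    using borel_measurable_continuous_on_indicator[OF _ assms] by simp
  with fin show ?thesis by (simp add: edge_L2_def)
qed

text \<open>The edge has finite length, so x <= x^2 + 1 turns square integrability into
  integrability. The third claim is Cauchy-Schwarz. The last one links the Lebesgue integral in
  \<open>sobolev_H2\<close> with the gauge integral used for calculus.\<close>

lemma edge_L2_integral:
  assumes L: "edge_L2 l \<phi>" and "0 < l"
  shows "set_integrable lborel {0..l} \<phi>" 
    and "\<phi> integrable_on {0..l}"
    and "x \<in> {0..l} \<Longrightarrow> ennreal ((cmod (integral {0..x} \<phi>))\<^sup>2) \<le> ennreal l * edge_sq l \<phi>"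
    and "x \<in> {0..l} \<Longrightarrow> (LBINT t:{0..x}. \<phi> t) = integral {0..x} \<phi>"
proof -
  define \<psi> where "\<psi> t = indicator {0..l} t *\<^sub>R \<phi> t" for t
  have [measurable]: "\<psi> \<in> borel_measurable lborel"
    using L by (simp add: edge_L2_def set_borel_measurable_def \<psi>_def[abs_def])
  have sq: "edge_sq l \<phi> = (\<integral>\<^sup>+ t. ennreal ((cmod (\<psi> t))\<^sup>2) \<partial>lborel)"
    unfolding edge_sq_def \<psi>_def by (intro nn_integral_cong) (auto simp: indicator_def)
  have i2: "integrable lborel (\<lambda>t. (cmod (\<psi> t))\<^sup>2)"
    using L integrable_cmod_sq_iff[of \<psi> lborel] sq by (auto simp: edge_L2_def)
  have i1: "integrable lborel (\<lambda>t. indicator {0..l} t :: real)"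
    using \<open>0 < l\<close> by (intro integrable_real_indicator) auto
  have i3: "integrable lborel \<psi>"
  proof (rule Bochner_Integration.integrable_bound[of _ "\<lambda>t. (cmod (\<psi> t))\<^sup>2 + indicator {0..l} t"])
    show "AE t in lborel. norm (\<psi> t) \<le> norm ((cmod (\<psi> t))\<^sup>2 + indicator {0..l} t)"
    proof (rule AE_I2)
      fix t
      have "2 * cmod (\<psi> t) * 1 \<le> (cmod (\<psi> t))\<^sup>2 + 1\<^sup>2" by (rule sum_squares_bound)
      then show "norm (\<psi> t) \<le> norm ((cmod (\<psi> t))\<^sup>2 + indicator {0..l} t)"
        by (auto simp: \<psi>_def indicator_def) (use norm_ge_zero in \<open>smt (verit)\<close>)
    qed
  qed (use i1 i2 in auto)
  then show si: "set_integrable lborel {0..l} \<phi>"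
    by (simp add: set_integrable_def \<psi>_def[abs_def])
  then show hk: "\<phi> integrable_on {0..l}" by (rule set_borel_integral_eq_integral)
  show eq: "(LBINT t:{0..x}. \<phi> t) = integral {0..x} \<phi>" if "x \<in> {0..l}" for x
    by (rule set_borel_integral_eq_integral, rule set_integrable_subset[OF si]) (use that in auto)
  define N I where "N = (\<integral>t. (cmod (\<psi> t))\<^sup>2 \<partial>lborel)" and "I = (\<integral>t. cmod (\<psi> t) \<partial>lborel)"
  \<comment> \<open>\<open>I / l\<close> is the mean of the modulus of \<open>\<psi>\<close> over
    the edge; expanding the squared deviation from it gives Cauchy-Schwarz.\<close>
  have "0 \<le> (\<integral>t. (cmod (\<psi> t) - I / l * indicator {0..l} t)\<^sup>2 \<partial>lborel)" by simp
  also have "\<dots> = (\<integral>t. (cmod (\<psi> t))\<^sup>2 - 2 * (I / l) * cmod (\<psi> t) + (I / l)\<^sup>2 * indicator {0..l} t \<partial>lborel)"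
    by (intro Bochner_Integration.integral_cong) (auto simp: \<psi>_def indicator_def power2_diff power_divide)
  also have "\<dots> = N - 2 * (I / l) * I + (I / l)\<^sup>2 * l"
    using i1 i2 i3 \<open>0 < l\<close> unfolding N_def I_def by simp
  also have "\<dots> = N - I\<^sup>2 / l" using \<open>0 < l\<close> by (simp add: power2_eq_square field_simps)
  finally have NI: "I\<^sup>2 \<le> l * N" using \<open>0 < l\<close> by (simp add: field_simps)
  have N: "edge_sq l \<phi> = ennreal N" unfolding sq N_def using i2 by (simp add: nn_integral_eq_integral)
  show "ennreal ((cmod (integral {0..x} \<phi>))\<^sup>2) \<le> ennreal l * edge_sq l \<phi>" if x: "x \<in> {0..l}"
  proof -
    have "cmod (integral {0..x} \<phi>) = cmod (\<integral>t. indicator {0..x} t *\<^sub>R \<phi> t \<partial>lborel)"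
      using eq[OF x] by (simp add: set_lebesgue_integral_def)
    also have "\<dots> \<le> (\<integral>t. cmod (indicator {0..x} t *\<^sub>R \<phi> t) \<partial>lborel)"
      by (rule integral_norm_bound)
    also have "\<dots> \<le> I" unfolding I_def
    proof (rule integral_mono)
      have "set_integrable lborel {0..x} \<phi>" by (rule set_integrable_subset[OF si]) (use x in auto)
      then show "integrable lborel (\<lambda>t. cmod (indicator {0..x} t *\<^sub>R \<phi> t))"
        unfolding set_integrable_def by (rule integrable_norm)
      show "integrable lborel (\<lambda>t. cmod (\<psi> t))" by (rule integrable_norm[OF i3])
    qed (use x in \<open>auto simp: \<psi>_def indicator_def\<close>)
    finally have "(cmod (integral {0..x} \<phi>))\<^sup>2 \<le> I\<^sup>2" by (intro power_mono) auto
    with NI have "(cmod (integral {0..x} \<phi>))\<^sup>2 \<le> l * N" by simp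
    then show ?thesis unfolding N using \<open>0 < l\<close> by (metis ennreal_leI ennreal_mult' less_eq_real_def)
  qed
qed

section \<open>The equation on an edge\<close>

definition sn :: "real \<Rightarrow> real \<Rightarrow> real" where
  "sn \<mu> x = (if \<mu> > 0 then sin (sqrt \<mu> * x) / sqrt \<mu> else if \<mu> = 0 then x
            else sinh (sqrt (- \<mu>) * x) / sqrt (- \<mu>))"

definition cs :: "real \<Rightarrow> real \<Rightarrow> real" where
  "cs \<mu> x = (if \<mu> > 0 then cos (sqrt \<mu> * x) else if \<mu> = 0 then 1 else cosh (sqrt (- \<mu>) * x))"

lemma sn_0 [simp]: "sn \<mu> 0 = 0" and cs_0 [simp]: "cs \<mu> 0 = 1"
  by (auto simp: sn_def cs_def)

lemma cs_sn_sq: "(cs \<mu> x)\<^sup>2 + \<mu> * (sn \<mu> x)\<^sup>2 = 1"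
proof -
  consider "\<mu> > 0" | "\<mu> = 0" | "\<mu> < 0" by linarith
  then show ?thesis
  proof cases
    case 3
    then show ?thesis
      using cosh_square_eq[of "sqrt (- \<mu>) * x"] by (simp add: sn_def cs_def power_divide)
  qed (simp_all add: sn_def cs_def power_divide)
qed

lemma DERIV_sn: "(sn \<mu> has_real_derivative cs \<mu> x) (at x within S)"
proof -
  consider "\<mu> > 0" | "\<mu> = 0" | "\<mu> < 0" by linarith
  then show ?thesis
  proof cases
    case 3
    then have r: "sqrt (- \<mu>) * sqrt (- \<mu>) = - \<mu>" by simp
    from 3 show ?thesis
      unfolding sn_def[abs_def] cs_def
      by (auto intro!: derivative_eq_intros simp: mult.assoc r)
  qed (auto simp: sn_def[abs_def] cs_def mult.assoc intro!: derivative_eq_intros)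
qed

lemma DERIV_cs: "(cs \<mu> has_real_derivative - \<mu> * sn \<mu> x) (at x within S)"
proof -
  consider "\<mu> > 0" | "\<mu> = 0" | "\<mu> < 0" by linarith
  then show ?thesis
  proof cases
    case 1
    then show ?thesis
      unfolding sn_def cs_def[abs_def] by (auto intro!: derivative_eq_intros simp: field_simps)
  next
    case 3
    then have "y * sqrt (-\<mu>) = - (\<mu> * y / sqrt (-\<mu>))" for y
      by (simp add: field_simps)
    with 3 show ?thesis
      unfolding sn_def cs_def[abs_def] by (auto intro!: derivative_eq_intros)
  qed (auto simp: sn_def cs_def[abs_def])
qed

lemma continuous_on_sn: "continuous_on S (sn \<mu>)" and continuous_on_cs: "continuous_on S (cs \<mu>)"
  by (rule DERIV_continuous_on, rule DERIV_sn, rule DERIV_continuous_on, rule DERIV_cs)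

definition int_sn :: "real \<Rightarrow> (real \<Rightarrow> complex) \<Rightarrow> real \<Rightarrow> complex" where
  "int_sn \<mu> G x = integral {0..x} (\<lambda>t. sn \<mu> t *\<^sub>R G t)"

definition int_cs :: "real \<Rightarrow> (real \<Rightarrow> complex) \<Rightarrow> real \<Rightarrow> complex" where
  "int_cs \<mu> G x = integral {0..x} (\<lambda>t. cs \<mu> t *\<^sub>R G t)"

text \<open>With \<open>p = f' + G\<close>, where \<open>G\<close> is the primitive of the inhomogeneity, the equation
  \<open>- f'' - \<mu> f = G'\<close> becomes the first order system \<open>f' = p - G\<close>, \<open>p' = - \<mu> f\<close>, in which \<open>G\<close> is merely
  continuous, so that classical calculus suffices although \<open>f''\<close> exists only almost everywhere.\<close>

definition duhamel :: "real \<Rightarrow> (real \<Rightarrow> complex) \<Rightarrow> real \<Rightarrow> complex" where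
  "duhamel \<mu> G x = (\<mu> * sn \<mu> x) *\<^sub>R int_sn \<mu> G x + cs \<mu> x *\<^sub>R int_cs \<mu> G x"

definition duhamel_mom :: "real \<Rightarrow> (real \<Rightarrow> complex) \<Rightarrow> real \<Rightarrow> complex" where
  "duhamel_mom \<mu> G x = cs \<mu> x *\<^sub>R int_sn \<mu> G x - sn \<mu> x *\<^sub>R int_cs \<mu> G x"

definition sol :: "real \<Rightarrow> complex \<Rightarrow> complex \<Rightarrow> (real \<Rightarrow> complex) \<Rightarrow> real \<Rightarrow> complex" where
  "sol \<mu> z w G x = cs \<mu> x *\<^sub>R z + sn \<mu> x *\<^sub>R w - duhamel \<mu> G x"

definition mom :: "real \<Rightarrow> complex \<Rightarrow> complex \<Rightarrow> (real \<Rightarrow> complex) \<Rightarrow> real \<Rightarrow> complex" where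
  "mom \<mu> z w G x = cs \<mu> x *\<^sub>R w - (\<mu> * sn \<mu> x) *\<^sub>R z - \<mu> *\<^sub>R duhamel_mom \<mu> G x"

lemma duhamel_0 [simp]: "duhamel \<mu> G 0 = 0" and duhamel_mom_0 [simp]: "duhamel_mom \<mu> G 0 = 0"
  by (auto simp: duhamel_def duhamel_mom_def int_sn_def int_cs_def)

lemma sol_0 [simp]: "sol \<mu> z w G 0 = z" and mom_0 [simp]: "mom \<mu> z w G 0 = w"
  by (auto simp: sol_def mom_def)

lemma scaleR_cs_sn_sq: "(cs \<mu> x * cs \<mu> x) *\<^sub>R (z::complex) + (\<mu> * (sn \<mu> x * sn \<mu> x)) *\<^sub>R z = z"
  using cs_sn_sq[of \<mu> x] by (simp add: scaleR_left_distrib[symmetric] power2_eq_square)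

text \<open>Variation of constants: undoing the free evolution leaves two quantities whose
  derivatives involve \<open>G\<close> alone, so they are integrals of \<open>G\<close>. The free
  evolution then recovers \<open>f\<close> and \<open>p\<close>.\<close>

lemma linear_system_unique:
  assumes G: "continuous_on {0..l} G"
    and f: "\<And>x. x \<in> {0..l} \<Longrightarrow> (f has_vector_derivative p x - G x) (at x within {0..l})"
    and p: "\<And>x. x \<in> {0..l} \<Longrightarrow> (p has_vector_derivative - (\<mu> *\<^sub>R f x)) (at x within {0..l})"
    and x: "x \<in> {0..l}"
  shows "f x = sol \<mu> (f 0) (p 0) G x" "p x = mom \<mu> (f 0) (p 0) G x"
proof -
  have sub: "{0..x} \<subseteq> {0..l}" and x0: "0 \<le> x" using x by auto
  \<comment> \<open>\<open>A\<close> and \<open>B\<close> are the result of applying to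
    \<open>(f, p)\<close> the inverse of the fundamental matrix, whose determinant is 1 by
    \<open>cs_sn_sq\<close>.\<close>
  define A where "A t = cs \<mu> t *\<^sub>R f t - sn \<mu> t *\<^sub>R p t" for t
  define B where "B t = (\<mu> * sn \<mu> t) *\<^sub>R f t + cs \<mu> t *\<^sub>R p t" for t
  have dA: "(A has_vector_derivative - (cs \<mu> t *\<^sub>R G t)) (at t within {0..x})" if "t \<in> {0..x}" for t
  proof -
    from that sub have t: "t \<in> {0..l}" by auto
    show ?thesis unfolding A_def[abs_def]
      apply (rule has_vector_derivative_within_subset[OF _ sub])
      apply (rule has_vector_derivative_eq_rhs)
       apply (rule has_vector_derivative_diff has_vector_derivative_scaleR DERIV_sn DERIV_cs f[OF t] p[OF t])+
      apply (simp add: algebra_simps)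
      done
  qed
  have dB: "(B has_vector_derivative - (\<mu> *\<^sub>R sn \<mu> t *\<^sub>R G t)) (at t within {0..x})" if "t \<in> {0..x}" for t
  proof -
    from that sub have t: "t \<in> {0..l}" by auto
    show ?thesis unfolding B_def[abs_def]
      apply (rule has_vector_derivative_within_subset[OF _ sub])
      apply (rule has_vector_derivative_eq_rhs)
       apply (rule has_vector_derivative_add has_vector_derivative_scaleR DERIV_cmult DERIV_sn DERIV_cs f[OF t] p[OF t])+
      apply (simp add: algebra_simps)
      done
  qed
  have "integral {0..x} (\<lambda>t. - (cs \<mu> t *\<^sub>R G t)) = A x - A 0"
    by (intro integral_unique fundamental_theorem_of_calculus x0 dA)
  then have A: "A x = f 0 - int_cs \<mu> G x" by (simp add: A_def int_cs_def algebra_simps)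
  have "integral {0..x} (\<lambda>t. - (\<mu> *\<^sub>R sn \<mu> t *\<^sub>R G t)) = B x - B 0"
    by (intro integral_unique fundamental_theorem_of_calculus x0 dB)
  then have B: "B x = p 0 - \<mu> *\<^sub>R int_sn \<mu> G x" 
    by (simp only: B_def int_sn_def integral_neg integral_cmul) (simp add: algebra_simps)
  have "f x = cs \<mu> x *\<^sub>R A x + sn \<mu> x *\<^sub>R B x"
    using scaleR_cs_sn_sq[of \<mu> x "f x"] by (simp add: A_def B_def algebra_simps)
  then show "f x = sol \<mu> (f 0) (p 0) G x"
    unfolding A B sol_def duhamel_def by (simp add: algebra_simps)
  have "p x = cs \<mu> x *\<^sub>R B x - (\<mu> * sn \<mu> x) *\<^sub>R A x"
    using scaleR_cs_sn_sq[of \<mu> x "p x"] by (simp add: A_def B_def algebra_simps)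
  then show "p x = mom \<mu> (f 0) (p 0) G x"
    unfolding A B mom_def duhamel_mom_def by (simp add: algebra_simps)
qed

lemma linear_system_exists:
  assumes G: "continuous_on {0..l} G" and x: "x \<in> {0..l}"
  shows "(sol \<mu> z w G has_vector_derivative mom \<mu> z w G x - G x) (at x within {0..l})"
    and "(mom \<mu> z w G has_vector_derivative - (\<mu> *\<^sub>R sol \<mu> z w G x)) (at x within {0..l})"
proof -
  have c: "continuous_on {0..l} (\<lambda>t. cs \<mu> t *\<^sub>R G t)" "continuous_on {0..l} (\<lambda>t. sn \<mu> t *\<^sub>R G t)"
    by (intro continuous_intros continuous_on_sn continuous_on_cs G)+
  have dc: "(int_cs \<mu> G has_vector_derivative cs \<mu> x *\<^sub>R G x) (at x within {0..l})"
    unfolding int_cs_def[abs_def] by (rule integral_has_vector_derivative[OF c(1) x])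
  have ds: "(int_sn \<mu> G has_vector_derivative sn \<mu> x *\<^sub>R G x) (at x within {0..l})"
    unfolding int_sn_def[abs_def] by (rule integral_has_vector_derivative[OF c(2) x])
  note rules = has_vector_derivative_add has_vector_derivative_diff has_vector_derivative_scaleR DERIV_cmult
    has_vector_derivative_const DERIV_const DERIV_sn DERIV_cs dc ds
  show "(sol \<mu> z w G has_vector_derivative mom \<mu> z w G x - G x) (at x within {0..l})"
    unfolding sol_def[abs_def] duhamel_def
    apply (rule has_vector_derivative_eq_rhs)
     apply (rule rules)+
    using scaleR_cs_sn_sq[of \<mu> x "G x"] apply (simp add: mom_def duhamel_mom_def algebra_simps)
    done
  show "(mom \<mu> z w G has_vector_derivative - (\<mu> *\<^sub>R sol \<mu> z w G x)) (at x within {0..l})"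
    unfolding mom_def[abs_def] duhamel_mom_def
    apply (rule has_vector_derivative_eq_rhs)
     apply (rule rules)+
    apply (simp add: sol_def duhamel_def algebra_simps)
    done
qed

text \<open>The constant is fixed before \<open>G\<close> and depends only on \<open>\<mu>\<close>
  and \<open>l\<close>, so that one estimate serves all edges of a given length and all
  sources.\<close>

lemma duhamel_sup_bound:
  assumes "0 < l"
  obtains K where "0 \<le> K"
    "\<And>G B x. continuous_on {0..l} G \<Longrightarrow> (\<And>x. x \<in> {0..l} \<Longrightarrow> cmod (G x) \<le> B) \<Longrightarrow> x \<in> {0..l} \<Longrightarrow>
       cmod (duhamel \<mu> G x) \<le> K * B \<and> cmod (duhamel_mom \<mu> G x) \<le> K * B \<and> \<bar>sn \<mu> x\<bar> \<le> K \<and> \<bar>cs \<mu> x\<bar> \<le> K"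
proof -
  obtain C1 where C1: "\<And>x. x \<in> {0..l} \<Longrightarrow> norm (sn \<mu> x) \<le> C1"
    using compact_imp_bounded[OF compact_continuous_image[OF continuous_on_sn[of "{0..l}" \<mu>] compact_Icc]]
    unfolding bounded_iff by blast
  obtain C2 where C2: "\<And>x. x \<in> {0..l} \<Longrightarrow> norm (cs \<mu> x) \<le> C2"
    using compact_imp_bounded[OF compact_continuous_image[OF continuous_on_cs[of "{0..l}" \<mu>] compact_Icc]]
    unfolding bounded_iff by blast
  define C where "C = max C1 (max C2 0)"
  have C: "0 \<le> C" "\<And>x. x \<in> {0..l} \<Longrightarrow> \<bar>sn \<mu> x\<bar> \<le> C" "\<And>x. x \<in> {0..l} \<Longrightarrow> \<bar>cs \<mu> x\<bar> \<le> C"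
    using C1 C2 by (fastforce simp: C_def)+
  \<comment> \<open>The 1 beside the modulus of \<open>\<mu>\<close> serves
    \<open>duhamel_mom\<close>, where the factor \<open>\<mu>\<close> is absent; the final summand
    makes \<open>K\<close> dominate \<open>C\<close> as well.\<close>
  define K where "K = (\<bar>\<mu>\<bar> + 1) * C * (C * l) + C * (C * l) + C"
  show thesis
  proof (rule that)
    show "0 \<le> K" unfolding K_def using C(1) assms by simp
    fix G :: "real \<Rightarrow> complex" and B x
    assume G: "continuous_on {0..l} G" and B: "\<And>x. x \<in> {0..l} \<Longrightarrow> cmod (G x) \<le> B" and x: "x \<in> {0..l}"
    have B0: "0 \<le> B" using B[OF x] norm_ge_zero order_trans by blast
    have int: "cmod (integral {0..x} (\<lambda>t. f t *\<^sub>R G t)) \<le> C * l * B"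
      if "continuous_on {0..l} f" "\<And>x. x \<in> {0..l} \<Longrightarrow> \<bar>f x\<bar> \<le> C" for f
    proof -
      have "cmod (integral {0..x} (\<lambda>t. f t *\<^sub>R G t)) \<le> (C * B) * (x - 0)"
      proof (rule integral_bound)
        show "continuous_on {0..x} (\<lambda>t. f t *\<^sub>R G t)"
          using x by (intro continuous_intros continuous_on_subset[OF that(1)] continuous_on_subset[OF G]) auto
      qed (use x B C(1) that(2) B0 in \<open>auto intro!: mult_mono\<close>)
      also have "\<dots> \<le> (C * B) * l" using x C(1) B0 by (intro mult_left_mono) auto
      finally show ?thesis by (simp add: ac_simps)
    qed
    have s: "cmod (int_sn \<mu> G x) \<le> C * l * B" and c: "cmod (int_cs \<mu> G x) \<le> C * l * B"
      unfolding int_sn_def int_cs_def by (intro int continuous_on_sn continuous_on_cs C; assumption)+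
    have "cmod (duhamel \<mu> G x) \<le> \<bar>\<mu>\<bar> * C * (C * l * B) + C * (C * l * B)"
      unfolding duhamel_def using s c C assms B0 x
      by (intro order_trans[OF norm_triangle_ineq] add_mono) (auto simp: abs_mult intro!: mult_mono)
    also have "\<dots> \<le> K * B" unfolding K_def using B0 C(1) assms by (simp add: algebra_simps)
    finally have 1: "cmod (duhamel \<mu> G x) \<le> K * B" .
    have "cmod (duhamel_mom \<mu> G x) \<le> C * (C * l * B) + C * (C * l * B)"
      unfolding duhamel_mom_def using s c C assms B0 x
      by (intro order_trans[OF norm_triangle_ineq4] add_mono) (auto simp: abs_mult intro!: mult_mono)
    also have "\<dots> \<le> K * B" unfolding K_def using B0 C(1) assms by (simp add: algebra_simps)
    finally have 2: "cmod (duhamel_mom \<mu> G x) \<le> K * B" .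
    have "C \<le> K" using C(1) assms by (simp add: K_def)
    with 1 2 C(2,3)[OF x] show "cmod (duhamel \<mu> G x) \<le> K * B \<and> cmod (duhamel_mom \<mu> G x) \<le> K * B \<and> \<bar>sn \<mu> x\<bar> \<le> K \<and> \<bar>cs \<mu> x\<bar> \<le> K"
      by linarith
  qed
qed

definition prim :: "(real \<Rightarrow> complex) \<Rightarrow> real \<Rightarrow> complex" where
  "prim g x = integral {0..x} g"

lemma prim_0 [simp]: "prim g 0 = 0" by (simp add: prim_def)

lemma continuous_on_prim: "edge_L2 l g \<Longrightarrow> 0 < l \<Longrightarrow> continuous_on {0..l} (prim g)"
  unfolding prim_def[abs_def] by (intro indefinite_integral_continuous_1 edge_L2_integral)

lemma sobolev_H2_continuous: "sobolev_H2 l \<phi> \<phi>1 \<phi>2 \<Longrightarrow> continuous_on {0..l} \<phi>"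
  by (auto simp: sobolev_H2_def intro: continuous_on_vector_derivative)

lemma edge_L2_diff: "edge_L2 l \<phi> \<Longrightarrow> edge_L2 l \<psi> \<Longrightarrow> edge_L2 l (\<lambda>t. \<phi> t - z * \<psi> t)"
  using edge_L2_lincomb(1)[of l \<phi> \<psi> 1 "-z"] by simp

lemma edge_L2_add: "edge_L2 l \<phi> \<Longrightarrow> edge_L2 l \<psi> \<Longrightarrow> edge_L2 l (\<lambda>t. \<phi> t + z * \<psi> t)"
  using edge_L2_lincomb(1)[of l \<phi> \<psi> 1 "z"] by simp

lemma edge_L2_uminus: "edge_L2 l (\<lambda>t. - \<phi> t) \<longleftrightarrow> edge_L2 l \<phi>"
proof -
  have *: "edge_L2 l (\<lambda>t. - \<psi> t)" if "edge_L2 l \<psi>" for \<psi>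
    using edge_L2_lincomb(1)[OF that that, of "-1" 0] by simp
  show ?thesis using *[of \<phi>] *[of "\<lambda>t. - \<phi> t"] by auto
qed

text \<open>A Sobolev function solves the first order system with \<open>prim g\<close> in the role
  of \<open>G\<close>; hence it is determined by its value and slope at 0 together with
  \<open>g\<close>.\<close>

lemma sobolev_representation:
  fixes \<mu> :: real and \<phi> \<phi>1 h :: "real \<Rightarrow> complex"
  assumes l: "0 < l" and H: "sobolev_H2 l \<phi> \<phi>1 (\<lambda>t. - h t)"
  defines "g \<equiv> \<lambda>t. h t - \<mu> * \<phi> t"
  shows "edge_L2 l g" 
    and "x \<in> {0..l} \<Longrightarrow> \<phi> x = sol \<mu> (\<phi> 0) (\<phi>1 0) (prim g) x"
    and "x \<in> {0..l} \<Longrightarrow> \<phi>1 x = mom \<mu> (\<phi> 0) (\<phi>1 0) (prim g) x - prim g x"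
proof -
  note c = sobolev_H2_continuous[OF H]
  have h: "edge_L2 l h" using H by (simp add: sobolev_H2_def edge_L2_iff edge_L2_uminus)
  show g: "edge_L2 l g" unfolding g_def by (intro edge_L2_diff h continuous_edge_L2 c)
  \<comment> \<open>The primitive of \<open>h\<close> cancels in \<open>p\<close>, so
    \<open>p\<close> is continuously differentiable although \<open>\<phi>1\<close> is only
    absolutely continuous.\<close>
  define p where "p x = \<phi>1 x + prim g x" for x
  have p: "p x = \<phi>1 0 - \<mu> *\<^sub>R integral {0..x} \<phi>" if x: "x \<in> {0..l}" for x
  proof -
    have ih: "h integrable_on {0..x}" "\<phi> integrable_on {0..x}"
      using x by (auto intro: integrable_on_subinterval[OF edge_L2_integral(2)[OF h l]]
        integrable_on_subinterval[OF integrable_continuous_real[OF c]])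
    have "\<phi>1 x = \<phi>1 0 + integral {0..x} (\<lambda>t. - h t)"
    proof -
      have "\<phi>1 x = \<phi>1 0 + (LBINT t:{0..x}. - h t)" using H x unfolding sobolev_H2_def by blast
      then show ?thesis using edge_L2_integral(4)[of l "\<lambda>t. - h t" x] h l x by (simp only: edge_L2_uminus)
    qed
    moreover have "prim g x = integral {0..x} h - \<mu> * integral {0..x} \<phi>"
      unfolding prim_def g_def using ih
      by (subst Henstock_Kurzweil_Integration.integral_diff) (auto simp: integrable_on_mult_right)
    ultimately show ?thesis using ih by (simp add: p_def scaleR_conv_of_real)
  qed
  have dp: "(p has_vector_derivative - (\<mu> *\<^sub>R \<phi> x)) (at x within {0..l})" if x: "x \<in> {0..l}" for x
  proof -
    have "((\<lambda>x. \<phi>1 0 - \<mu> *\<^sub>R integral {0..x} \<phi>) has_vector_derivative 0 - \<mu> *\<^sub>R \<phi> x) (at x within {0..l})"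
      using has_vector_derivative_diff[OF has_vector_derivative_const
        has_vector_derivative_scaleR[OF DERIV_const integral_has_vector_derivative[OF c x], of \<mu>], of "\<phi>1 0"]
      by simp
    then show ?thesis using p x by (auto intro: has_vector_derivative_transform)
  qed
  have d\<phi>: "(\<phi> has_vector_derivative p x - prim g x) (at x within {0..l})" if x: "x \<in> {0..l}" for x
  proof -
    have "(\<phi> has_vector_derivative \<phi>1 x) (at x within {0..l})" using H x unfolding sobolev_H2_def by blast
    then show ?thesis by (simp add: p_def)
  qed
  note u = linear_system_unique[OF continuous_on_prim[OF g l] d\<phi> dp]
  have p0: "p 0 = \<phi>1 0" by (simp add: p_def)
  show "x \<in> {0..l} \<Longrightarrow> \<phi> x = sol \<mu> (\<phi> 0) (\<phi>1 0) (prim g) x" using u(1) p0 by metis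
  show "x \<in> {0..l} \<Longrightarrow> \<phi>1 x = mom \<mu> (\<phi> 0) (\<phi>1 0) (prim g) x - prim g x" 
    using u(2)[of x] p0 by (simp add: p_def algebra_simps)
qed

text \<open>Converse of \<open>sobolev_representation\<close>: arbitrary initial data and an
  arbitrary square integrable source are realised by a Sobolev function.\<close>

lemma sobolev_existence:
  fixes \<mu> :: real and g \<phi> :: "real \<Rightarrow> complex" and z w :: complex
  assumes l: "0 < l" and g: "edge_L2 l g"
  defines "\<phi> \<equiv> sol \<mu> z w (prim g)"
  shows "continuous_on {0..l} \<phi>"
    and "edge_L2 l (\<lambda>t. g t + \<mu> * \<phi> t)"
    and "sobolev_H2 l \<phi> (\<lambda>x. mom \<mu> z w (prim g) x - prim g x) (\<lambda>t. - (g t + \<mu> * \<phi> t))"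
proof -
  let ?p = "mom \<mu> z w (prim g)"
  note d = linear_system_exists[OF continuous_on_prim[OF g l]]
  show c: "continuous_on {0..l} \<phi>" unfolding \<phi>_def using d(1) by (rule continuous_on_vector_derivative)
  show h: "edge_L2 l (\<lambda>t. g t + \<mu> * \<phi> t)" by (intro edge_L2_add g continuous_edge_L2 c)
  have "?p x - prim g x = ?p 0 - prim g 0 + (LBINT t:{0..x}. - (g t + \<mu> * \<phi> t))" if x: "x \<in> {0..l}" for x
  proof -
    have ih: "g integrable_on {0..x}" "\<phi> integrable_on {0..x}"
      using x by (auto intro: integrable_on_subinterval[OF edge_L2_integral(2)[OF g l]]
        integrable_on_subinterval[OF integrable_continuous_real[OF c]])
    have "(LBINT t:{0..x}. - (g t + \<mu> * \<phi> t)) = integral {0..x} (\<lambda>t. - (g t + \<mu> * \<phi> t))"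
      by (intro edge_L2_integral(4)[OF _ l x]) (use h in \<open>simp only: edge_L2_uminus\<close>)
    also have "\<dots> = - (integral {0..x} g + \<mu> * integral {0..x} \<phi>)"
      using ih by (simp only: integral_neg)
        (subst Henstock_Kurzweil_Integration.integral_add, auto simp: integrable_on_mult_right)
    finally have 1: "(LBINT t:{0..x}. - (g t + \<mu> * \<phi> t)) = - (integral {0..x} g + \<mu> * integral {0..x} \<phi>)" .
    have "((\<lambda>t. - (\<mu> *\<^sub>R \<phi> t)) has_integral ?p x - ?p 0) {0..x}"
      unfolding \<phi>_def using x
      by (intro fundamental_theorem_of_calculus has_vector_derivative_within_subset[OF d(2)]) auto
    from integral_unique[OF this] have "?p x - ?p 0 = - (\<mu> * integral {0..x} \<phi>)"
      by (simp only: integral_neg integral_cmul) (simp only: scaleR_conv_of_real)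
    then show ?thesis unfolding 1 by (simp add: prim_def algebra_simps)
  qed
  then show "sobolev_H2 l \<phi> (\<lambda>x. ?p x - prim g x) (\<lambda>t. - (g t + \<mu> * \<phi> t))"
    unfolding sobolev_H2_def edge_L2_iff edge_L2_uminus
    using d(1)[of _ \<mu> z w, folded \<phi>_def] h by blast
qed

lemma prim_bound:
  assumes "edge_L2 l g" "0 < l" "x \<in> {0..l}"
  shows "cmod (prim g x) \<le> sqrt (l * enn2real (edge_sq l g))"
proof -
  have "ennreal ((cmod (prim g x))\<^sup>2) \<le> ennreal l * ennreal (enn2real (edge_sq l g))"
    using edge_L2_integral(3)[OF assms] assms(1) by (simp add: prim_def edge_L2_def)
  then have "(cmod (prim g x))\<^sup>2 \<le> l * enn2real (edge_sq l g)"
    using assms(2) by (simp add: ennreal_mult[symmetric])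
  then show ?thesis by (rule real_le_rsqrt)
qed

section \<open>The difference equation for the vertex values\<close>

definition vsq :: "(vertex \<Rightarrow> complex) \<Rightarrow> ennreal" where
  "vsq F = (\<integral>\<^sup>+ v. ennreal ((cmod (F v))\<^sup>2) \<partial>count_space UNIV)"

lemma nn_integral_count_space_shift:
  fixes \<phi> :: "int \<times> int \<Rightarrow> ennreal"
  shows "(\<integral>\<^sup>+ v. \<phi> (v + d) \<partial>count_space UNIV) = (\<integral>\<^sup>+ v. \<phi> v \<partial>count_space UNIV)"
proof (rule nn_integral_bij_count_space)
  show "bij (\<lambda>v. v + d)" by (rule bij_betw_byWitness[where f' = "\<lambda>v. v - d"]) auto
qed

lemma nn_integral_edges:
  "(\<integral>\<^sup>+ e. \<phi> e \<partial>count_space UNIV) =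
     (\<integral>\<^sup>+ v. \<phi> (Hor v) \<partial>count_space UNIV) + (\<integral>\<^sup>+ v. \<phi> (Ver v) \<partial>count_space UNIV)"
proof -
  have H: "(\<integral>\<^sup>+ e. \<phi> e * indicator (range Hor) e \<partial>count_space UNIV) = (\<integral>\<^sup>+ v. \<phi> (Hor v) \<partial>count_space UNIV)"
    by (subst nn_integral_count_space_indicator[symmetric])
      (auto intro!: nn_integral_bij_count_space[symmetric] simp: bij_betw_def inj_on_def)
  have V: "(\<integral>\<^sup>+ e. \<phi> e * indicator (range Ver) e \<partial>count_space UNIV) = (\<integral>\<^sup>+ v. \<phi> (Ver v) \<partial>count_space UNIV)"
    by (subst nn_integral_count_space_indicator[symmetric])
      (auto intro!: nn_integral_bij_count_space[symmetric] simp: bij_betw_def inj_on_def)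
  have "(\<integral>\<^sup>+ e. \<phi> e \<partial>count_space UNIV) =
    (\<integral>\<^sup>+ e. \<phi> e * indicator (range Hor) e + \<phi> e * indicator (range Ver) e \<partial>count_space UNIV)"
  proof (rule nn_integral_cong)
    fix e show "\<phi> e = \<phi> e * indicator (range Hor) e + \<phi> e * indicator (range Ver) e"
      by (cases e) (auto simp: indicator_def)
  qed
  then show ?thesis by (simp add: nn_integral_add H V)
qed

lemma nn_integral_edge_source:
  "(\<integral>\<^sup>+ e. ennreal ((cmod (F (edge_source e)))\<^sup>2) \<partial>count_space UNIV) = vsq F + vsq F"
  by (subst nn_integral_edges) (simp add: vsq_def)

lemma edge_target_plus: "edge_target (Hor v) = v + (1, 0)" "edge_target (Ver v) = v + (0, 1)"
  by (cases v; simp)+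

lemma nn_integral_edge_target:
  "(\<integral>\<^sup>+ e. ennreal ((cmod (F (edge_target e)))\<^sup>2) \<partial>count_space UNIV) = vsq F + vsq F"
  by (subst nn_integral_edges) (simp add: vsq_def edge_target_plus nn_integral_count_space_shift[of "\<lambda>v. ennreal ((cmod (F v))\<^sup>2)"])

text \<open>The neighbour sum in the vertex equation after division by \<open>D\<close>; horizontal
  and vertical neighbours have different weights because \<open>a\<close> and \<open>b\<close>
  differ.\<close>

definition nbr :: "real \<Rightarrow> real \<Rightarrow> (vertex \<Rightarrow> complex) \<Rightarrow> vertex \<Rightarrow> complex" where
  "nbr r s F v = r * (F (v + (1, 0)) + F (v - (1, 0))) + s * (F (v + (0, 1)) + F (v - (0, 1)))"

text \<open>Convexity of the square for the weights r, r, s, s, 1 - \<theta> at the points x1, x2,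
  x3, x4, y / (1 - \<theta>). The total weight is at most 1, so the sum of the weighted squared
  deviations from the weighted sum \<open>m\<close> gives the claim.\<close>

lemma weighted_square:
  fixes x y :: real
  assumes "0 \<le> r" "0 \<le> s" "2 * r + 2 * s \<le> \<theta>" "\<theta> < 1"
  shows "(r * (x1 + x2) + s * (x3 + x4) + y)\<^sup>2 \<le>
    r * (x1\<^sup>2 + x2\<^sup>2) + s * (x3\<^sup>2 + x4\<^sup>2) + y\<^sup>2 / (1 - \<theta>)"
proof -
  define z where "z = y / (1 - \<theta>)"
  have y: "y = (1 - \<theta>) * z" and yz: "y\<^sup>2 / (1 - \<theta>) = (1 - \<theta>) * z\<^sup>2"
    using assms by (auto simp: z_def power2_eq_square)
  define m where "m = r * (x1 + x2) + s * (x3 + x4) + y"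
  have "0 \<le> r * ((x1 - m)\<^sup>2 + (x2 - m)\<^sup>2) + s * ((x3 - m)\<^sup>2 + (x4 - m)\<^sup>2) + (1 - \<theta>) * (z - m)\<^sup>2"
    using assms by simp
  also have "\<dots> = r * (x1\<^sup>2 + x2\<^sup>2) + s * (x3\<^sup>2 + x4\<^sup>2) + (1 - \<theta>) * z\<^sup>2 - 2 * m * m
      + m\<^sup>2 * (2 * r + 2 * s + (1 - \<theta>))"
    unfolding m_def y by (simp add: power2_eq_square algebra_simps)
  also have "\<dots> \<le> r * (x1\<^sup>2 + x2\<^sup>2) + s * (x3\<^sup>2 + x4\<^sup>2) + (1 - \<theta>) * z\<^sup>2 - 2 * m * m + m\<^sup>2 * 1"
    using assms by (intro add_left_mono mult_left_mono) auto
  finally show ?thesis unfolding yz m_def[symmetric] by (simp add: power2_eq_square)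
qed

text \<open>Using convexity instead of the triangle inequality keeps the estimate linear in the
  squared norms, so it can be summed over all vertices in \<open>ennreal\<close>; each neighbour
  term is a translate and contributes \<open>vsq F\<close> again.\<close>

lemma vsq_step:
  assumes F': "\<And>v. F' v = nbr r s F v + R v" and \<theta>: "2 * \<bar>r\<bar> + 2 * \<bar>s\<bar> = \<theta>" "\<theta> < 1"
  shows "vsq F' \<le> ennreal \<theta> * vsq F + ennreal (1 / (1 - \<theta>)) * vsq R"
proof -
  let ?q = "\<lambda>F v. ennreal ((cmod (F v))\<^sup>2)"
  have pw: "?q F' v \<le> ennreal \<bar>r\<bar> * (?q F (v + (1,0)) + ?q F (v + (-1,0)))
      + ennreal \<bar>s\<bar> * (?q F (v + (0,1)) + ?q F (v + (0,-1))) + ennreal (1 / (1 - \<theta>)) * ?q R v" for v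
  proof -
    have m: "v - (1,0) = v + (-1,0)" "v - (0,1) = v + (0,-1)" by (cases v; simp)+
    have "cmod (F' v) \<le> \<bar>r\<bar> * (cmod (F (v + (1,0))) + cmod (F (v + (-1,0))))
      + \<bar>s\<bar> * (cmod (F (v + (0,1))) + cmod (F (v + (0,-1)))) + cmod (R v)"
      unfolding F' nbr_def m
      by (intro order_trans[OF norm_triangle_ineq] add_mono order.refl)
        (auto simp: norm_mult intro!: mult_left_mono norm_triangle_ineq)
    then have "(cmod (F' v))\<^sup>2 \<le> (\<bar>r\<bar> * (cmod (F (v + (1,0))) + cmod (F (v + (-1,0))))
      + \<bar>s\<bar> * (cmod (F (v + (0,1))) + cmod (F (v + (0,-1)))) + cmod (R v))\<^sup>2"
      by (intro power_mono) auto
    also have "\<dots> \<le> \<bar>r\<bar> * ((cmod (F (v + (1,0))))\<^sup>2 + (cmod (F (v + (-1,0))))\<^sup>2)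
      + \<bar>s\<bar> * ((cmod (F (v + (0,1))))\<^sup>2 + (cmod (F (v + (0,-1))))\<^sup>2) + (cmod (R v))\<^sup>2 / (1 - \<theta>)"
      using \<theta> by (intro weighted_square) auto
    finally have "?q F' v \<le> ennreal \<dots>" by (rule ennreal_leI)
    also have "\<dots> = ennreal \<bar>r\<bar> * (?q F (v + (1,0)) + ?q F (v + (-1,0)))
      + ennreal \<bar>s\<bar> * (?q F (v + (0,1)) + ?q F (v + (0,-1))) + ennreal (1 / (1 - \<theta>)) * ?q R v"
      using \<theta> by (simp add: ennreal_mult[symmetric] ennreal_plus[symmetric] del: ennreal_plus)
    finally show ?thesis .
  qed
  have "vsq F' \<le> (\<integral>\<^sup>+ v. ennreal \<bar>r\<bar> * (?q F (v + (1,0)) + ?q F (v + (-1,0)))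
      + ennreal \<bar>s\<bar> * (?q F (v + (0,1)) + ?q F (v + (0,-1))) + ennreal (1 / (1 - \<theta>)) * ?q R v \<partial>count_space UNIV)"
    unfolding vsq_def by (intro nn_integral_mono pw)
  also have "\<dots> = ennreal \<bar>r\<bar> * (vsq F + vsq F) + ennreal \<bar>s\<bar> * (vsq F + vsq F) + ennreal (1 / (1 - \<theta>)) * vsq R"
    by (simp add: nn_integral_add nn_integral_cmult nn_integral_count_space_shift[of "?q F"] vsq_def[symmetric])
  also have "ennreal \<bar>r\<bar> * (vsq F + vsq F) + ennreal \<bar>s\<bar> * (vsq F + vsq F) = ennreal \<theta> * vsq F"
  proof -
    have "ennreal \<theta> = ennreal \<bar>r\<bar> + ennreal \<bar>r\<bar> + ennreal \<bar>s\<bar> + ennreal \<bar>s\<bar>"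
      unfolding \<theta>(1)[symmetric] by (simp add: ennreal_plus[symmetric] del: ennreal_plus)
    then show ?thesis by (simp add: algebra_simps)
  qed
  finally show ?thesis .
qed

text \<open>Absorbing \<open>ennreal \<theta> * S\<close> into the left side is a subtraction; this
  is where finiteness of \<open>S\<close> enters.\<close>

lemma ennreal_contraction:
  assumes "S \<le> ennreal \<theta> * S + X" "S < \<infinity>" "0 \<le> \<theta>" "\<theta> < 1"
  shows "S \<le> ennreal (1 / (1 - \<theta>)) * X"
proof (cases X)
  case (real x)
  obtain s where s: "S = ennreal s" "0 \<le> s" using assms(2) by (cases S) auto
  have "ennreal s \<le> ennreal (\<theta> * s + x)"
    using assms(1,3) s real by (simp add: ennreal_mult ennreal_plus)
  then have "s \<le> \<theta> * s + x" using assms(3) s real by (subst (asm) ennreal_le_iff) auto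
  then have "s \<le> 1 / (1 - \<theta>) * x" using assms(4) by (simp add: field_simps)
  then show ?thesis using s real assms(4) by (simp add: ennreal_mult[symmetric])
next
  case top
  then show ?thesis using assms(4) by (simp add: ennreal_mult_top)
qed

lemma vsq_bound:
  assumes "\<And>v. F v = nbr r s F v + R v" "2 * \<bar>r\<bar> + 2 * \<bar>s\<bar> = \<theta>" "\<theta> < 1" "vsq F < \<infinity>"
  shows "vsq F \<le> ennreal (1 / (1 - \<theta>)) * (ennreal (1 / (1 - \<theta>)) * vsq R)"
  using vsq_step[OF assms(1-3)] assms(2-4) by (intro ennreal_contraction) auto

lemma cmod_le_vsq: "ennreal ((cmod (F v))\<^sup>2) \<le> vsq F"
  unfolding vsq_def by (rule nn_integral_ge_point) simp

text \<open>Neumann series. A geometric bound gives convergence at every vertex; square summability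
  of the limit comes from a uniform bound on the partial sums and Fatou's lemma.\<close>

lemma vsq_exists:
  assumes R: "vsq R < \<infinity>" and \<theta>: "2 * \<bar>r\<bar> + 2 * \<bar>s\<bar> = \<theta>" "\<theta> < 1"
  obtains F where "\<And>v. F v = nbr r s F v + R v" "vsq F < \<infinity>"
proof -
  have \<theta>0: "0 \<le> \<theta>" using \<theta> by auto
  define D where "D i = ((nbr r s) ^^ i) R" for i
  define M where "M = sqrt (enn2real (vsq R))"
  have RM: "cmod (R v) \<le> M" for v
  proof -
    have "ennreal ((cmod (R v))\<^sup>2) \<le> ennreal (enn2real (vsq R))" using cmod_le_vsq[of R v] R by simp
    then show ?thesis unfolding M_def by (intro real_le_rsqrt) simp
  qed
  have D: "cmod (D i v) \<le> \<theta> ^ i * M" for i v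
  proof (induction i arbitrary: v)
    case 0
    then show ?case using RM by (simp add: D_def)
  next
    case (Suc i)
    have "D (Suc i) v = nbr r s (D i) v" by (simp add: D_def)
    also have "cmod \<dots> \<le> \<bar>r\<bar> * (\<theta>^i * M + \<theta>^i * M) + \<bar>s\<bar> * (\<theta>^i * M + \<theta>^i * M)"
      unfolding nbr_def
      by (intro order_trans[OF norm_triangle_ineq] add_mono;
        simp only: norm_mult norm_of_real; intro mult_left_mono order_trans[OF norm_triangle_ineq] add_mono Suc abs_ge_zero)
    also have "\<dots> = \<theta> ^ Suc i * M" unfolding \<theta>(1)[symmetric] by (simp add: algebra_simps)
    finally show ?case .
  qed
  have sm: "summable (\<lambda>i. D i v)" for v
  proof (rule summable_comparison_test')
    show "summable (\<lambda>i. \<theta> ^ i * M)" using \<theta>0 \<theta>(2) by (intro summable_mult2 summable_geometric) auto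
  qed (rule D)
  define F where "F v = (\<Sum>i. D i v)" for v
  have sums: "(\<lambda>i. D i v) sums F v" for v unfolding F_def by (rule summable_sums[OF sm])
  have fix1: "F v = nbr r s F v + R v" for v
  proof -
    have "(\<lambda>i. nbr r s (D i) v) sums nbr r s F v"
      unfolding nbr_def by (intro sums_add sums_mult sums)
    then have "(\<lambda>i. D (Suc i) v) sums nbr r s F v" by (simp add: D_def)
    then have "(\<lambda>i. D i v) sums (nbr r s F v + D 0 v)" by (rule sums_Suc)
    with sums[of v] show ?thesis using sums_unique2 by (fastforce simp: D_def)
  qed
  define Fn where "Fn n v = (\<Sum>i<n. D i v)" for n v
  have Fn_Suc: "Fn (Suc n) v = nbr r s (Fn n) v + R v" for n v
  proof -
    have "Fn (Suc n) v = D 0 v + (\<Sum>i<n. D (Suc i) v)" unfolding Fn_def by (rule sum.lessThan_Suc_shift)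
    also have "(\<Sum>i<n. D (Suc i) v) = nbr r s (Fn n) v"
      by (simp add: D_def Fn_def nbr_def sum_distrib_left sum.distrib distrib_left)
    finally show ?thesis by (simp add: D_def)
  qed
  obtain x where x: "vsq R = ennreal x" "0 \<le> x" using R by (cases "vsq R") auto
  \<comment> \<open>\<open>B\<close> is the fixed point of the recursion that
    \<open>vsq_step\<close> yields for the partial sums, so the bound reproduces itself in the
    induction.\<close>
  define B where "B = x / (1 - \<theta>)\<^sup>2"
  have B0: "0 \<le> B" using x by (simp add: B_def)
  have bound: "vsq (Fn n) \<le> ennreal B" for n
  proof (induction n)
    case 0
    then show ?case by (simp add: Fn_def vsq_def)
  next
    case (Suc n)
    have "vsq (Fn (Suc n)) \<le> ennreal \<theta> * vsq (Fn n) + ennreal (1 / (1 - \<theta>)) * vsq R"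
      by (rule vsq_step[OF Fn_Suc \<theta>])
    also have "\<dots> \<le> ennreal \<theta> * ennreal B + ennreal (1 / (1 - \<theta>)) * ennreal x"
      unfolding x by (intro add_right_mono mult_left_mono Suc) simp
    also have "\<dots> = ennreal (\<theta> * B + x / (1 - \<theta>))"
      using \<theta>0 \<theta>(2) B0 x by (simp add: ennreal_mult[symmetric] ennreal_plus[symmetric] del: ennreal_plus)
    also have "\<theta> * B + x / (1 - \<theta>) = B"
    proof -
      have "x / (1 - \<theta>) = B * (1 - \<theta>)" using \<theta>(2) by (simp add: B_def power2_eq_square)
      then show ?thesis by (simp add: algebra_simps)
    qed
    finally show ?case .
  qed
  have "vsq F = (\<integral>\<^sup>+ v. liminf (\<lambda>n. ennreal ((cmod (Fn n v))\<^sup>2)) \<partial>count_space UNIV)"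
    unfolding vsq_def
  proof (rule nn_integral_cong)
    fix v
    have "(\<lambda>n. Fn n v) \<longlonglongrightarrow> F v" using sums[of v] by (simp add: sums_def Fn_def)
    then have "(\<lambda>n. ennreal ((cmod (Fn n v))\<^sup>2)) \<longlonglongrightarrow> ennreal ((cmod (F v))\<^sup>2)"
      by (intro tendsto_ennrealI tendsto_power tendsto_norm)
    then show "ennreal ((cmod (F v))\<^sup>2) = liminf (\<lambda>n. ennreal ((cmod (Fn n v))\<^sup>2))"
      by (intro lim_imp_Liminf[symmetric]) auto
  qed
  also have "\<dots> \<le> liminf (\<lambda>n. vsq (Fn n))"
    unfolding vsq_def by (intro nn_integral_liminf) auto
  also have "\<dots> \<le> limsup (\<lambda>n. vsq (Fn n))" by (intro Liminf_le_Limsup) auto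
  also have "\<dots> \<le> ennreal B" by (intro Limsup_bounded always_eventually allI bound)
  finally have "vsq F < \<infinity>" using order.strict_trans1 by fastforce
  with fix1 show thesis by (rule that)
qed

section \<open>Bounds for solutions and traces on one edge\<close>

lemma duhamel_edge_bound:
  assumes l: "0 < l"
  obtains K where "0 \<le> K"
    "\<And>g x. edge_L2 l g \<Longrightarrow> x \<in> {0..l} \<Longrightarrow>
       (cmod (duhamel \<mu> (prim g) x))\<^sup>2 \<le> K * enn2real (edge_sq l g) \<and>
       (cmod (duhamel_mom \<mu> (prim g) x))\<^sup>2 \<le> K * enn2real (edge_sq l g) \<and>
       (cmod (prim g x))\<^sup>2 \<le> K * enn2real (edge_sq l g)"
    "\<And>x. x \<in> {0..l} \<Longrightarrow> (sn \<mu> x)\<^sup>2 \<le> K \<and> (cs \<mu> x)\<^sup>2 \<le> K"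
proof -
  obtain C where C: "0 \<le> C" "\<And>G B x. continuous_on {0..l} G \<Longrightarrow> (\<And>x. x \<in> {0..l} \<Longrightarrow> cmod (G x) \<le> B) \<Longrightarrow> x \<in> {0..l} \<Longrightarrow>
       cmod (duhamel \<mu> G x) \<le> C * B \<and> cmod (duhamel_mom \<mu> G x) \<le> C * B \<and> \<bar>sn \<mu> x\<bar> \<le> C \<and> \<bar>cs \<mu> x\<bar> \<le> C"
    using duhamel_sup_bound[OF l, of \<mu>] by blast
  define K where "K = C\<^sup>2 * l + l + C\<^sup>2"
  show thesis
  proof (rule that)
    show "0 \<le> K" using l by (simp add: K_def)
    show "(sn \<mu> x)\<^sup>2 \<le> K \<and> (cs \<mu> x)\<^sup>2 \<le> K" if "x \<in> {0..l}" for x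
    proof -
      have "\<bar>sn \<mu> x\<bar> \<le> C" "\<bar>cs \<mu> x\<bar> \<le> C" using C(2)[of "\<lambda>_. 0" 0 x] that by auto
      then have "(sn \<mu> x)\<^sup>2 \<le> C\<^sup>2" "(cs \<mu> x)\<^sup>2 \<le> C\<^sup>2" by (metis power_mono abs_ge_zero power2_abs)+
      moreover have "0 \<le> C\<^sup>2 * l" using l by simp
      ultimately show ?thesis using l unfolding K_def by linarith
    qed
    fix g x assume g: "edge_L2 l g" and x: "x \<in> {0..l}"
    define n where "n = enn2real (edge_sq l g)"
    have n: "0 \<le> n" by (simp add: n_def)
    have b: "cmod (prim g y) \<le> sqrt (l * n)" if "y \<in> {0..l}" for y
      unfolding n_def by (rule prim_bound[OF g l that])
    have sq: "z\<^sup>2 \<le> C\<^sup>2 * l * n" if "0 \<le> z" "z \<le> C * sqrt (l * n)" for z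
    proof -
      have "z\<^sup>2 \<le> (C * sqrt (l * n))\<^sup>2" using that by (intro power_mono) auto
      also have "\<dots> = C\<^sup>2 * l * n" using l n by (simp add: power_mult_distrib)
      finally show ?thesis .
    qed
    have "(cmod (prim g x))\<^sup>2 \<le> (sqrt (l * n))\<^sup>2" by (intro power_mono b x) simp
    then have "(cmod (prim g x))\<^sup>2 \<le> l * n" using l n by simp
    moreover have "0 \<le> C\<^sup>2 * l * n" "0 \<le> C\<^sup>2 * n" "0 \<le> l * n" using l n by auto
    ultimately show "(cmod (duhamel \<mu> (prim g) x))\<^sup>2 \<le> K * enn2real (edge_sq l g) \<and>
       (cmod (duhamel_mom \<mu> (prim g) x))\<^sup>2 \<le> K * enn2real (edge_sq l g) \<and>
       (cmod (prim g x))\<^sup>2 \<le> K * enn2real (edge_sq l g)"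
      using sq[of "cmod (duhamel \<mu> (prim g) x)"] sq[of "cmod (duhamel_mom \<mu> (prim g) x)"]
        C(2)[OF continuous_on_prim[OF g l] b x]
      unfolding n_def[symmetric] K_def by (simp add: distrib_right)
  qed
qed

lemma square_sum3: "(x + y + z)\<^sup>2 \<le> 3 * (x\<^sup>2 + y\<^sup>2 + z\<^sup>2)" for x y z :: real
proof -
  have "0 \<le> (x - y)\<^sup>2 + (y - z)\<^sup>2 + (x - z)\<^sup>2" by simp
  then show ?thesis by (simp add: power2_eq_square algebra_simps)
qed

lemma sol_edge_bound:
  assumes l: "0 < l"
  obtains K where "0 \<le> K"
    "\<And>z w g. edge_L2 l g \<Longrightarrow> edge_sq l (sol \<mu> z w (prim g)) \<le>
       ennreal (K * ((cmod z)\<^sup>2 + (cmod w)\<^sup>2 + enn2real (edge_sq l g)))"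
proof -
  obtain K where K: "0 \<le> K" "\<And>g x. edge_L2 l g \<Longrightarrow> x \<in> {0..l} \<Longrightarrow>
       (cmod (duhamel \<mu> (prim g) x))\<^sup>2 \<le> K * enn2real (edge_sq l g)"
    "\<And>x. x \<in> {0..l} \<Longrightarrow> (sn \<mu> x)\<^sup>2 \<le> K \<and> (cs \<mu> x)\<^sup>2 \<le> K"
    using duhamel_edge_bound[OF l, of \<mu>] by metis
  show thesis
  proof (rule that)
    show "0 \<le> 3 * K * l" using K l by simp
    fix z w g assume g: "edge_L2 l g"
    have "(cmod (sol \<mu> z w (prim g) t))\<^sup>2 \<le> 3 * K * ((cmod z)\<^sup>2 + (cmod w)\<^sup>2 + enn2real (edge_sq l g))"
      if t: "t \<in> {0..l}" for t
    proof -
      have "cmod (sol \<mu> z w (prim g) t) \<le> \<bar>cs \<mu> t\<bar> * cmod z + \<bar>sn \<mu> t\<bar> * cmod w + cmod (duhamel \<mu> (prim g) t)"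
        unfolding sol_def
        by (rule order_trans[OF norm_triangle_ineq4] add_mono order_trans[OF norm_triangle_ineq] | simp)+
      then have "(cmod (sol \<mu> z w (prim g) t))\<^sup>2 \<le> (\<bar>cs \<mu> t\<bar> * cmod z + \<bar>sn \<mu> t\<bar> * cmod w + cmod (duhamel \<mu> (prim g) t))\<^sup>2"
        by (intro power_mono) auto
      also have "\<dots> \<le> 3 * ((\<bar>cs \<mu> t\<bar> * cmod z)\<^sup>2 + (\<bar>sn \<mu> t\<bar> * cmod w)\<^sup>2 + (cmod (duhamel \<mu> (prim g) t))\<^sup>2)"
        by (rule square_sum3)
      also have "\<dots> \<le> 3 * (K * (cmod z)\<^sup>2 + K * (cmod w)\<^sup>2 + K * enn2real (edge_sq l g))"
        using K(2)[OF g t] K(3)[OF t]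
        by (intro mult_left_mono add_mono) (auto simp: power_mult_distrib intro!: mult_right_mono)
      finally show ?thesis by (simp add: algebra_simps)
    qed
    then have "edge_sq l (sol \<mu> z w (prim g)) \<le> ennreal ((3 * K * ((cmod z)\<^sup>2 + (cmod w)\<^sup>2 + enn2real (edge_sq l g))) * l)"
      by (rule edge_sq_le_const) (use l in auto)
    then show "edge_sq l (sol \<mu> z w (prim g)) \<le> ennreal (3 * K * l * ((cmod z)\<^sup>2 + (cmod w)\<^sup>2 + enn2real (edge_sq l g)))"
      by (simp add: ac_simps)
  qed
qed

text \<open>At \<open>\<mu> = 0\<close>, \<open>f\<close> plus the Duhamel term is the affine function \<open>\<psi> t = f 0 + t f' 0\<close>, and
  \<open>l f 0\<close> is four times the integral of \<open>\<psi>\<close> over \<open>[0, l/2]\<close> minus the integral over \<open>[0, l]\<close>.\<close>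

lemma sobolev_H2_trace_bound:
  assumes l: "0 < l"
  obtains K where "0 \<le> K"
    "\<And>\<phi> \<phi>1 h. sobolev_H2 l \<phi> \<phi>1 (\<lambda>t. - h t) \<Longrightarrow>
       ennreal ((cmod (\<phi> 0))\<^sup>2) \<le> ennreal K * (edge_sq l \<phi> + edge_sq l h)"
proof -
  obtain K where K: "0 \<le> K" "\<And>g x. edge_L2 l g \<Longrightarrow> x \<in> {0..l} \<Longrightarrow>
       (cmod (duhamel 0 (prim g) x))\<^sup>2 \<le> K * enn2real (edge_sq l g)"
    using duhamel_edge_bound[OF l, of 0] by metis
  show thesis
  proof (rule that)
    \<comment> \<open>34 = 2 * 16 + 2 arises from squaring \<open>4 * x + y\<close>; the factor
      \<open>2 + 2 * (K * l)\<close> dominates both coefficients in the bound of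
      \<open>edge_sq l \<psi>\<close>.\<close>
    show "0 \<le> 34 / l * (2 + 2 * (K * l))" using K l by simp
    fix \<phi> \<phi>1 h :: "real \<Rightarrow> complex" assume H: "sobolev_H2 l \<phi> \<phi>1 (\<lambda>t. - h t)"
    have h0: "(\<lambda>t. h t - complex_of_real 0 * \<phi> t) = h" by simp
    note rep = sobolev_representation[OF l H, where \<mu> = 0, unfolded h0]
    have h: "edge_L2 l h" by (rule rep(1))
    have c\<phi>: "continuous_on {0..l} \<phi>" by (rule sobolev_H2_continuous[OF H])
    have \<phi>: "edge_L2 l \<phi>" by (rule continuous_edge_L2[OF c\<phi>])
    define \<psi> where "\<psi> t = \<phi> 0 + t *\<^sub>R \<phi>1 0" for t :: real
    have \<psi>: "\<psi> t = \<phi> t + duhamel 0 (prim h) t" if "t \<in> {0..l}" for t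
    proof -
      have "\<phi> t = sol 0 (\<phi> 0) (\<phi>1 0) (prim h) t" by (rule rep(2)) (use that in auto)
      then show ?thesis by (simp add: \<psi>_def sol_def sn_def cs_def)
    qed
    have \<psi>L: "edge_L2 l \<psi>" by (rule continuous_edge_L2) (auto simp: \<psi>_def[abs_def] intro!: continuous_intros)
    have int: "integral {0..y} \<psi> = y *\<^sub>R \<phi> 0 + (y\<^sup>2 / 2) *\<^sub>R \<phi>1 0" if "0 \<le> y" for y
    proof -
      have d: "((\<lambda>y. y *\<^sub>R \<phi> 0 + (y\<^sup>2 / 2) *\<^sub>R \<phi>1 0) has_vector_derivative \<psi> t) (at t within {0..y})" for t
      proof -
        have "((\<lambda>y::real. y\<^sup>2 / 2) has_real_derivative t) (at t within {0..y})"
          by (auto intro!: derivative_eq_intros)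
        from has_vector_derivative_add[OF has_vector_derivative_scaleR[OF DERIV_ident has_vector_derivative_const, of "\<phi> 0"]
          has_vector_derivative_scaleR[OF this has_vector_derivative_const, of "\<phi>1 0"]]
        show ?thesis by (simp add: \<psi>_def)
      qed
      from integral_unique[OF fundamental_theorem_of_calculus[OF that d]] show ?thesis by simp
    qed
    define x y where "x = cmod (integral {0..l/2} \<psi>)" and "y = cmod (integral {0..l} \<psi>)"
    have "l *\<^sub>R \<phi> 0 = 4 *\<^sub>R integral {0..l/2} \<psi> - integral {0..l} \<psi>"
      using l by (simp add: int power2_eq_square scaleR_conv_of_real algebra_simps)
    then have "cmod (l *\<^sub>R \<phi> 0) \<le> 4 * x + y"
      unfolding x_def y_def by (metis norm_triangle_ineq4 norm_scaleR abs_numeral)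
    then have 1: "l * cmod (\<phi> 0) \<le> 4 * x + y" using l by simp
    define E where "E = enn2real (edge_sq l \<psi>)"
    have E: "edge_sq l \<psi> = ennreal E" "0 \<le> E" using \<psi>L by (auto simp: E_def edge_L2_def)
    have xy: "x\<^sup>2 \<le> l * E" "y\<^sup>2 \<le> l * E"
      using edge_L2_integral(3)[OF \<psi>L l, of "l/2"] edge_L2_integral(3)[OF \<psi>L l, of l] l E
      unfolding x_def y_def by (auto simp: ennreal_mult[symmetric])
    have "(l * cmod (\<phi> 0))\<^sup>2 \<le> (4 * x + y)\<^sup>2" using 1 l by (intro power_mono) auto
    also have "\<dots> \<le> 2 * (4 * x)\<^sup>2 + 2 * y\<^sup>2"
      using sum_squares_bound[of "4 * x" y] by (simp add: power2_sum)
    also have "\<dots> \<le> 34 * (l * E)" using xy by (simp add: power_mult_distrib)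
    finally have 2: "(cmod (\<phi> 0))\<^sup>2 \<le> 34 / l * E" using l by (simp add: power2_eq_square field_simps)
    have cP: "continuous_on {0..l} (duhamel 0 (prim h))"
    proof -
      have "continuous_on {0..l} (\<lambda>t. \<psi> t - \<phi> t)"
        unfolding \<psi>_def[abs_def] by (intro continuous_intros c\<phi>)
      then show ?thesis by (rule continuous_on_eq) (simp add: \<psi>)
    qed
    have "edge_sq l \<psi> = edge_sq l (\<lambda>t. 1 * \<phi> t + 1 * duhamel 0 (prim h) t)"
      unfolding edge_sq_def by (intro nn_integral_cong) (auto simp: indicator_def \<psi>)
    also have "\<dots> \<le> ennreal 2 * edge_sq l \<phi> + ennreal 2 * edge_sq l (duhamel 0 (prim h))"
      using edge_L2_lincomb(2)[OF \<phi> continuous_edge_L2[OF cP], of 1 1] by simp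
    also have "\<dots> \<le> ennreal 2 * edge_sq l \<phi> + ennreal 2 * (ennreal (K * l) * edge_sq l h)"
    proof -
      have "edge_sq l (duhamel 0 (prim h)) \<le> ennreal (K * enn2real (edge_sq l h) * l)"
        by (rule edge_sq_le_const) (use K(2)[OF h] l in auto)
      also have "\<dots> = ennreal (K * l) * ennreal (enn2real (edge_sq l h))"
        using K(1) l by (simp add: ennreal_mult[symmetric] ac_simps)
      also have "\<dots> = ennreal (K * l) * edge_sq l h" using h by (simp add: edge_L2_def)
      finally show ?thesis by (intro add_left_mono mult_left_mono) auto
    qed
    finally have 3: "edge_sq l \<psi> \<le> ennreal 2 * edge_sq l \<phi> + ennreal 2 * (ennreal (K * l) * edge_sq l h)" .
    have "ennreal ((cmod (\<phi> 0))\<^sup>2) \<le> ennreal (34 / l) * edge_sq l \<psi>"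
      unfolding E using 2 l E(2) by (subst ennreal_mult[symmetric]) (auto intro!: ennreal_leI)
    also have "\<dots> \<le> ennreal (34 / l) * (ennreal 2 * edge_sq l \<phi> + ennreal 2 * (ennreal (K * l) * edge_sq l h))"
      by (intro mult_left_mono 3) simp
    also have "\<dots> \<le> ennreal (34 / l) * (ennreal (2 + 2 * (K * l)) * edge_sq l \<phi> + ennreal (2 + 2 * (K * l)) * edge_sq l h)"
    proof -
      have "ennreal 2 \<le> ennreal (2 + 2 * (K * l))" using K(1) l by (intro ennreal_leI) simp
      moreover have "ennreal 2 * ennreal (K * l) \<le> ennreal (2 + 2 * (K * l))"
        using K(1) l by (subst ennreal_mult[symmetric]) (auto intro!: ennreal_leI simp del: ennreal_plus)
      ultimately show ?thesis
        unfolding mult.assoc[symmetric, of "ennreal 2"] by (intro mult_left_mono add_mono mult_right_mono) auto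
    qed
    also have "\<dots> = ennreal (34 / l * (2 + 2 * (K * l))) * (edge_sq l \<phi> + edge_sq l h)"
      using K(1) l by (subst ennreal_mult) (auto simp: algebra_simps)
    finally show "ennreal ((cmod (\<phi> 0))\<^sup>2) \<le> ennreal (34 / l * (2 + 2 * (K * l))) * (edge_sq l \<phi> + edge_sq l h)" .
  qed
qed

section \<open>The resolvent set\<close>

definition gapcond :: "real \<Rightarrow> real \<Rightarrow> real \<Rightarrow> real \<Rightarrow> bool" where
  "gapcond a b u \<mu> \<longleftrightarrow> sn \<mu> a \<noteq> 0 \<and> sn \<mu> b \<noteq> 0 \<and>
     2 / \<bar>sn \<mu> a\<bar> + 2 / \<bar>sn \<mu> b\<bar> < u + 2 * cs \<mu> a / sn \<mu> a + 2 * cs \<mu> b / sn \<mu> b"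

text \<open>Dirichlet-to-Neumann map of an edge: the slope at 0 that steers the solution from
  \<open>z\<close> at 0 to \<open>y\<close> at \<open>l\<close>. It makes sense when
  \<open>\<mu>\<close> is not a Dirichlet eigenvalue of the edge, that is,
  \<open>sn \<mu> l \<noteq> 0\<close>.\<close>

definition edge_slope :: "real \<Rightarrow> real \<Rightarrow> complex \<Rightarrow> complex \<Rightarrow> (real \<Rightarrow> complex) \<Rightarrow> complex" where
  "edge_slope \<mu> l z y g = (y - of_real (cs \<mu> l) * z) / of_real (sn \<mu> l) + duhamel \<mu> (prim g) l / of_real (sn \<mu> l)"

text \<open>The part of the outward derivative at the far end that is due to the source
  \<open>g\<close>; \<open>mom_edge_slope\<close> splits it off.\<close>

definition end_defect :: "real \<Rightarrow> real \<Rightarrow> (real \<Rightarrow> complex) \<Rightarrow> complex" where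
  "end_defect \<mu> l g = of_real \<mu> * duhamel_mom \<mu> (prim g) l + prim g l - of_real (cs \<mu> l) * duhamel \<mu> (prim g) l / of_real (sn \<mu> l)"

lemma sol_edge_slope:
  assumes "sn \<mu> l \<noteq> 0"
  shows "sol \<mu> z (edge_slope \<mu> l z y g) (prim g) l = y"
    and "sol \<mu> z w (prim g) l = y \<Longrightarrow> w = edge_slope \<mu> l z y g"
  using assms by (auto simp: sol_def edge_slope_def scaleR_conv_of_real field_simps)

text \<open>By \<open>cs_sn_sq\<close> the outward derivative at the far end has the form of the one
  at the near end with \<open>z\<close> and \<open>y\<close> exchanged; only the source terms break
  this symmetry.\<close>

lemma mom_edge_slope:
  assumes "sn \<mu> l \<noteq> 0"
  shows "- (mom \<mu> z (edge_slope \<mu> l z y g) (prim g) l - prim g l) = (z - of_real (cs \<mu> l) * y) / of_real (sn \<mu> l) + end_defect \<mu> l g"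
proof -
  have "complex_of_real ((cs \<mu> l)\<^sup>2 + \<mu> * (sn \<mu> l)\<^sup>2) = 1" by (simp only: cs_sn_sq of_real_1)
  then have *: "complex_of_real (cs \<mu> l) * of_real (cs \<mu> l) + \<mu> * (sn \<mu> l * sn \<mu> l) = 1"
    by (simp add: power2_eq_square)
  have "z = (complex_of_real (cs \<mu> l) * of_real (cs \<mu> l) + \<mu> * (sn \<mu> l * sn \<mu> l)) * z" unfolding * by simp
  then show ?thesis
    using assms unfolding mom_def edge_slope_def end_defect_def scaleR_conv_of_real
    by (simp add: field_simps)
qed

lemma edge_source_eq: "{e. edge_source e = v} = {Hor v, Ver v}"
proof -
  have "edge_source e = v \<longleftrightarrow> e = Hor v \<or> e = Ver v" for e by (cases e) auto
  then show ?thesis by auto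
qed

lemma edge_target_eq: "{e. edge_target e = v} = {Hor (v - (1, 0)), Ver (v - (0, 1))}"
proof -
  have "edge_target e = v \<longleftrightarrow> e = Hor (v - (1, 0)) \<or> e = Ver (v - (0, 1))" for e
    by (cases e) (auto simp: edge_target_plus)
  then show ?thesis by auto
qed

lemma square_sum4:
  "(cmod (w + x + y + z))\<^sup>2 \<le> 4 * ((cmod w)\<^sup>2 + (cmod x)\<^sup>2 + (cmod y)\<^sup>2 + (cmod z)\<^sup>2)"
proof -
  have "cmod (w + x + y + z) \<le> cmod w + cmod x + cmod y + cmod z"
    by (rule order_trans[OF norm_triangle_ineq] add_right_mono order.refl)+
  then have "(cmod (w + x + y + z))\<^sup>2 \<le> (cmod w + cmod x + cmod y + cmod z)\<^sup>2"
    by (intro power_mono) auto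
  also have "\<dots> \<le> 4 * ((cmod w)\<^sup>2 + (cmod x)\<^sup>2 + (cmod y)\<^sup>2 + (cmod z)\<^sup>2)"
    using sum_squares_bound[of "cmod w" "cmod x"] sum_squares_bound[of "cmod w" "cmod y"]
      sum_squares_bound[of "cmod w" "cmod z"] sum_squares_bound[of "cmod x" "cmod y"]
      sum_squares_bound[of "cmod x" "cmod z"] sum_squares_bound[of "cmod y" "cmod z"]
    by (simp add: power2_eq_square algebra_simps)
  finally show ?thesis .
qed

text \<open>After the slope has been eliminated, the two end values and the source control
  everything; dividing by the fixed nonzero number \<open>sn \<mu> l\<close> costs only a
  constant.\<close>

lemma defect_bounds:
  assumes l: "0 < l" and s: "sn \<mu> l \<noteq> 0"
  obtains K where "0 \<le> K"
    "\<And>g. edge_L2 l g \<Longrightarrow> (cmod (duhamel \<mu> (prim g) l / sn \<mu> l))\<^sup>2 \<le> K * enn2real (edge_sq l g)"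
    "\<And>g. edge_L2 l g \<Longrightarrow> (cmod (end_defect \<mu> l g))\<^sup>2 \<le> K * enn2real (edge_sq l g)"
    "\<And>z y g. edge_L2 l g \<Longrightarrow> edge_sq l (sol \<mu> z (edge_slope \<mu> l z y g) (prim g)) \<le>
       ennreal (K * ((cmod z)\<^sup>2 + (cmod y)\<^sup>2 + enn2real (edge_sq l g)))"
proof -
  obtain C where C: "0 \<le> C" "\<And>g x. edge_L2 l g \<Longrightarrow> x \<in> {0..l} \<Longrightarrow>
       (cmod (duhamel \<mu> (prim g) x))\<^sup>2 \<le> C * enn2real (edge_sq l g) \<and>
       (cmod (duhamel_mom \<mu> (prim g) x))\<^sup>2 \<le> C * enn2real (edge_sq l g) \<and>
       (cmod (prim g x))\<^sup>2 \<le> C * enn2real (edge_sq l g)"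
    using duhamel_edge_bound[OF l, of \<mu>] by metis
  obtain B where B: "0 \<le> B" "\<And>z w g. edge_L2 l g \<Longrightarrow> edge_sq l (sol \<mu> z w (prim g)) \<le>
       ennreal (B * ((cmod z)\<^sup>2 + (cmod w)\<^sup>2 + enn2real (edge_sq l g)))"
    using sol_edge_bound[OF l, of \<mu>] by metis
  define S where "S = (sn \<mu> l)\<^sup>2"
  have S: "S > 0" using s by (simp add: S_def)
  define K1 where "K1 = C / S"
  define K2 where "K2 = 4 * (\<mu>\<^sup>2 * C + C + (cs \<mu> l)\<^sup>2 * K1)"
  define K3 where "K3 = 4 * (1 / S + (cs \<mu> l)\<^sup>2 / S + K1)"
  define K4 where "K4 = B * (K3 + 1)"
  have K0: "0 \<le> K1" "0 \<le> K2" "0 \<le> K3" "0 \<le> K4" using B C S by (auto simp: K1_def K2_def K3_def K4_def)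
  have ll: "l \<in> {0..l}" using l by auto
  have duhamel_bd: "(cmod (duhamel \<mu> (prim g) l / sn \<mu> l))\<^sup>2 \<le> K1 * enn2real (edge_sq l g)" if g: "edge_L2 l g" for g
  proof -
    have "(cmod (duhamel \<mu> (prim g) l / sn \<mu> l))\<^sup>2 = (cmod (duhamel \<mu> (prim g) l))\<^sup>2 / S"
      by (simp add: norm_divide power_divide S_def)
    also have "\<dots> \<le> C * enn2real (edge_sq l g) / S"
      using C(2)[OF g ll] S by (intro divide_right_mono) auto
    finally show ?thesis by (simp add: K1_def)
  qed
  have eD: "(cmod (end_defect \<mu> l g))\<^sup>2 \<le> K2 * enn2real (edge_sq l g)" if g: "edge_L2 l g" for g
  proof -
    define n where "n = enn2real (edge_sq l g)"
    have "end_defect \<mu> l g = \<mu> * duhamel_mom \<mu> (prim g) l + prim g l + (- cs \<mu> l * (duhamel \<mu> (prim g) l / sn \<mu> l)) + 0"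
      by (simp add: end_defect_def)
    then have "(cmod (end_defect \<mu> l g))\<^sup>2 \<le> 4 * ((cmod (\<mu> * duhamel_mom \<mu> (prim g) l))\<^sup>2 + (cmod (prim g l))\<^sup>2
       + (cmod (- cs \<mu> l * (duhamel \<mu> (prim g) l / sn \<mu> l)))\<^sup>2 + (cmod 0)\<^sup>2)"
      using square_sum4 by metis
    also have "\<dots> \<le> 4 * (\<mu>\<^sup>2 * (C * n) + C * n + (cs \<mu> l)\<^sup>2 * (K1 * n) + 0)"
      unfolding norm_mult power_mult_distrib n_def using C(2)[OF g ll] duhamel_bd[OF g]
      by (intro mult_left_mono add_mono) (auto intro!: mult_left_mono)
    also have "\<dots> = K2 * n" by (simp add: K2_def algebra_simps)
    finally show ?thesis by (simp add: n_def)
  qed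
  have sl: "edge_sq l (sol \<mu> z (edge_slope \<mu> l z y g) (prim g)) \<le>
       ennreal (K4 * ((cmod z)\<^sup>2 + (cmod y)\<^sup>2 + enn2real (edge_sq l g)))" if g: "edge_L2 l g" for z y g
  proof -
    define n where "n = enn2real (edge_sq l g)"
    have n: "0 \<le> n" by (simp add: n_def)
    let ?w = "edge_slope \<mu> l z y g"
    have "?w = y / sn \<mu> l + (- cs \<mu> l * z / sn \<mu> l) + duhamel \<mu> (prim g) l / sn \<mu> l + 0"
      by (simp add: edge_slope_def diff_divide_distrib)
    then have "(cmod ?w)\<^sup>2 \<le> 4 * ((cmod (y / sn \<mu> l))\<^sup>2 + (cmod (- cs \<mu> l * z / sn \<mu> l))\<^sup>2
       + (cmod (duhamel \<mu> (prim g) l / sn \<mu> l))\<^sup>2 + (cmod 0)\<^sup>2)"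
      using square_sum4 by metis
    also have "\<dots> \<le> 4 * ((cmod y)\<^sup>2 / S + (cs \<mu> l)\<^sup>2 * (cmod z)\<^sup>2 / S + K1 * n + 0)"
      using duhamel_bd[OF g] unfolding n_def[symmetric]
      by (intro mult_left_mono add_mono) (auto simp: norm_divide norm_mult power_divide power_mult_distrib S_def)
    also have "\<dots> \<le> K3 * (cmod y)\<^sup>2 + K3 * (cmod z)\<^sup>2 + K3 * n"
    proof -
      have "4 * (1 / S) \<le> K3" "4 * ((cs \<mu> l)\<^sup>2 / S) \<le> K3" "4 * K1 \<le> K3"
        using S K0(1) by (auto simp: K3_def)
      then have "4 * (1 / S) * (cmod y)\<^sup>2 \<le> K3 * (cmod y)\<^sup>2" "4 * ((cs \<mu> l)\<^sup>2 / S) * (cmod z)\<^sup>2 \<le> K3 * (cmod z)\<^sup>2"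
        "4 * K1 * n \<le> K3 * n" using n by (intro mult_right_mono; simp)+
      then show ?thesis by (simp add: algebra_simps)
    qed
    finally have w: "(cmod ?w)\<^sup>2 \<le> K3 * (cmod y)\<^sup>2 + K3 * (cmod z)\<^sup>2 + K3 * n" .
    have "B * ((cmod z)\<^sup>2 + (cmod ?w)\<^sup>2 + n) \<le> B * ((K3 + 1) * ((cmod z)\<^sup>2 + (cmod y)\<^sup>2 + n))"
    proof (rule mult_left_mono[OF _ B(1)])
      show "(cmod z)\<^sup>2 + (cmod ?w)\<^sup>2 + n \<le> (K3 + 1) * ((cmod z)\<^sup>2 + (cmod y)\<^sup>2 + n)"
        using w zero_le_power2[of "cmod y"] unfolding distrib_left distrib_right by linarith
    qed
    then have "ennreal (B * ((cmod z)\<^sup>2 + (cmod ?w)\<^sup>2 + n)) \<le> ennreal (K4 * ((cmod z)\<^sup>2 + (cmod y)\<^sup>2 + n))"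
      by (intro ennreal_leI) (simp add: K4_def mult.assoc)
    with B(2)[OF g, of z ?w] show ?thesis by (simp add: n_def)
  qed
  show thesis
  proof (rule that[of "K1 + K2 + K4"])
    show "0 \<le> K1 + K2 + K4" using K0 by simp
    fix g assume g: "edge_L2 l g"
    have n: "0 \<le> enn2real (edge_sq l g)" by simp
    have "K1 * enn2real (edge_sq l g) \<le> (K1 + K2 + K4) * enn2real (edge_sq l g)"
      "K2 * enn2real (edge_sq l g) \<le> (K1 + K2 + K4) * enn2real (edge_sq l g)"
      using K0 by (intro mult_right_mono; simp)+
    with duhamel_bd[OF g] eD[OF g] 
    show "(cmod (duhamel \<mu> (prim g) l / sn \<mu> l))\<^sup>2 \<le> (K1 + K2 + K4) * enn2real (edge_sq l g)"
      "(cmod (end_defect \<mu> l g))\<^sup>2 \<le> (K1 + K2 + K4) * enn2real (edge_sq l g)"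
      by linarith+
    fix z y
    have "K4 * ((cmod z)\<^sup>2 + (cmod y)\<^sup>2 + enn2real (edge_sq l g)) \<le> (K1 + K2 + K4) * ((cmod z)\<^sup>2 + (cmod y)\<^sup>2 + enn2real (edge_sq l g))"
      using K0 by (intro mult_right_mono) auto
    with sl[OF g, of z y] show "edge_sq l (sol \<mu> z (edge_slope \<mu> l z y g) (prim g)) \<le>
       ennreal ((K1 + K2 + K4) * ((cmod z)\<^sup>2 + (cmod y)\<^sup>2 + enn2real (edge_sq l g)))"
      using ennreal_leI order_trans by blast
  qed
qed

definition family_sq :: "real \<Rightarrow> real \<Rightarrow> (edge \<Rightarrow> real \<Rightarrow> complex) \<Rightarrow> ennreal" where
  "family_sq a b g = (\<integral>\<^sup>+ e. edge_sq (edge_length a b e) (g e) \<partial>count_space UNIV)"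

lemma graph_sq_family: "graph_sq a b f = family_sq a b (\<lambda>e t. f (e, t))"
  by (simp add: graph_sq_def family_sq_def)

section \<open>The resolvent at a point satisfying the gap condition\<close>

locale spectral_gap_point =
  fixes a b u \<mu> :: real
  assumes a: "0 < a" and b: "0 < b" and gap: "gapcond a b u \<mu>"
begin

abbreviation len where "len \<equiv> edge_length a b"

lemma len_pos: "0 < len e" using a b by (cases e) auto

lemma sn_len: "sn \<mu> (len e) \<noteq> 0" using gap by (cases e) (auto simp: gapcond_def)

definition D where "D = u + 2 * cs \<mu> a / sn \<mu> a + 2 * cs \<mu> b / sn \<mu> b"
definition r where "r = 1 / (sn \<mu> a * D)"
definition s where "s = 1 / (sn \<mu> b * D)"
definition \<theta> where "\<theta> = 2 * \<bar>r\<bar> + 2 * \<bar>s\<bar>"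

lemma sab: "sn \<mu> a \<noteq> 0" "sn \<mu> b \<noteq> 0" using gap by (auto simp: gapcond_def)

lemma D_pos: "0 < D"
proof -
  have "0 < 2 / \<bar>sn \<mu> a\<bar> + 2 / \<bar>sn \<mu> b\<bar>" using sab by (intro add_pos_pos) auto
  then show ?thesis using gap by (simp add: gapcond_def D_def)
qed

text \<open>\<open>\<theta>\<close> is the left side of the gap condition divided by its right side
  \<open>D\<close>, so diagonal dominance says that the difference equation is a
  contraction.\<close>

lemma \<theta>_less: "\<theta> < 1"
proof -
  have "\<theta> = (2 / \<bar>sn \<mu> a\<bar> + 2 / \<bar>sn \<mu> b\<bar>) / D"
    using D_pos by (simp add: \<theta>_def r_def s_def abs_mult add_divide_distrib)
  also have "\<dots> < 1" using D_pos gap by (simp add: gapcond_def D_def)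
  finally show ?thesis .
qed

definition slope :: "(vertex \<Rightarrow> complex) \<Rightarrow> (edge \<Rightarrow> real \<Rightarrow> complex) \<Rightarrow> edge \<Rightarrow> complex" where
  "slope F g e = edge_slope \<mu> (len e) (F (edge_source e)) (F (edge_target e)) (g e)"

text \<open>The source terms of the four edges at \<open>v\<close>. Two edges start there and two
  end there, which accounts for the two kinds of summands.\<close>

definition resid :: "(edge \<Rightarrow> real \<Rightarrow> complex) \<Rightarrow> vertex \<Rightarrow> complex" where
  "resid g v = (duhamel \<mu> (prim (g (Hor v))) a / sn \<mu> a + duhamel \<mu> (prim (g (Ver v))) b / sn \<mu> b
     + end_defect \<mu> a (g (Hor (v - (1, 0)))) + end_defect \<mu> b (g (Ver (v - (0, 1))))) / D"

text \<open>The outward derivatives add up to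
  \<open>D * (nbr r s F v + resid g v - F v) + u * F v\<close>, and \<open>D\<close> is nonzero. The
  equivalence is used in both directions: to extract the difference equation from a domain function,
  and to build a domain function from a solution of it.\<close>

lemma vertex_condition_iff:
  "(\<Sum>e | edge_source e = v. slope F g e) +
   (\<Sum>e | edge_target e = v. - (mom \<mu> (F (edge_source e)) (slope F g e) (prim (g e)) (len e) - prim (g e) (len e)))
     = of_real u * F v \<longleftrightarrow> F v = nbr r s F v + resid g v"
proof -
  have Dc: "complex_of_real D \<noteq> 0" and sc: "complex_of_real (sn \<mu> a) \<noteq> 0" "complex_of_real (sn \<mu> b) \<noteq> 0"
    using D_pos sab by auto
  have De: "complex_of_real D = u + 2 * cs \<mu> a / sn \<mu> a + 2 * cs \<mu> b / sn \<mu> b" by (simp add: D_def)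
  have rs: "complex_of_real r = 1 / sn \<mu> a / D" "complex_of_real s = 1 / sn \<mu> b / D"
    by (simp_all add: r_def s_def)
  have DR: "complex_of_real D * resid g v = duhamel \<mu> (prim (g (Hor v))) a / sn \<mu> a + duhamel \<mu> (prim (g (Ver v))) b / sn \<mu> b
     + end_defect \<mu> a (g (Hor (v - (1, 0)))) + end_defect \<mu> b (g (Ver (v - (0, 1))))"
    using Dc by (simp add: resid_def)
  have t: "edge_target (Hor (v - (1,0))) = v" "edge_target (Ver (v - (0,1))) = v"
    by (simp_all add: edge_target_plus)
  have "(\<Sum>e | edge_source e = v. slope F g e) +
   (\<Sum>e | edge_target e = v. - (mom \<mu> (F (edge_source e)) (slope F g e) (prim (g e)) (len e) - prim (g e) (len e)))
    = (F (v + (1,0)) - cs \<mu> a * F v) / sn \<mu> a + (F (v + (0,1)) - cs \<mu> b * F v) / sn \<mu> b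
    + (F (v - (1,0)) - cs \<mu> a * F v) / sn \<mu> a + (F (v - (0,1)) - cs \<mu> b * F v) / sn \<mu> b + D * resid g v"
    unfolding edge_source_eq edge_target_eq slope_def mom_edge_slope[OF sn_len] DR
    by (simp add: t edge_target_plus) (simp add: edge_slope_def algebra_simps)
  also have "\<dots> = D * (nbr r s F v + resid g v - F v) + u * F v"
    unfolding nbr_def rs De[symmetric] using Dc
    by (simp add: distrib_left right_diff_distrib) (simp add: De distrib_left distrib_right add_divide_distrib diff_divide_distrib ac_simps)
  finally show ?thesis using Dc by auto
qed

text \<open>Only two edge lengths occur, so the sum of the two constants serves every edge.\<close>

lemma edge_constants:
  obtains K where "0 \<le> K"
    "\<And>e g. edge_L2 (len e) g \<Longrightarrow> (cmod (duhamel \<mu> (prim g) (len e) / sn \<mu> (len e)))\<^sup>2 \<le> K * enn2real (edge_sq (len e) g)"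
    "\<And>e g. edge_L2 (len e) g \<Longrightarrow> (cmod (end_defect \<mu> (len e) g))\<^sup>2 \<le> K * enn2real (edge_sq (len e) g)"
    "\<And>e z y g. edge_L2 (len e) g \<Longrightarrow> edge_sq (len e) (sol \<mu> z (edge_slope \<mu> (len e) z y g) (prim g)) \<le>
       ennreal (K * ((cmod z)\<^sup>2 + (cmod y)\<^sup>2 + enn2real (edge_sq (len e) g)))"
proof -
  obtain Ka where Ka: "0 \<le> Ka"
    "\<And>g. edge_L2 a g \<Longrightarrow> (cmod (duhamel \<mu> (prim g) a / sn \<mu> a))\<^sup>2 \<le> Ka * enn2real (edge_sq a g)"
    "\<And>g. edge_L2 a g \<Longrightarrow> (cmod (end_defect \<mu> a g))\<^sup>2 \<le> Ka * enn2real (edge_sq a g)"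
    "\<And>z y g. edge_L2 a g \<Longrightarrow> edge_sq a (sol \<mu> z (edge_slope \<mu> a z y g) (prim g)) \<le>
       ennreal (Ka * ((cmod z)\<^sup>2 + (cmod y)\<^sup>2 + enn2real (edge_sq a g)))"
    using defect_bounds[OF a sab(1)] by metis
  obtain Kb where Kb: "0 \<le> Kb"
    "\<And>g. edge_L2 b g \<Longrightarrow> (cmod (duhamel \<mu> (prim g) b / sn \<mu> b))\<^sup>2 \<le> Kb * enn2real (edge_sq b g)"
    "\<And>g. edge_L2 b g \<Longrightarrow> (cmod (end_defect \<mu> b g))\<^sup>2 \<le> Kb * enn2real (edge_sq b g)"
    "\<And>z y g. edge_L2 b g \<Longrightarrow> edge_sq b (sol \<mu> z (edge_slope \<mu> b z y g) (prim g)) \<le>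
       ennreal (Kb * ((cmod z)\<^sup>2 + (cmod y)\<^sup>2 + enn2real (edge_sq b g)))"
    using defect_bounds[OF b sab(2)] by metis
  have up: "x \<le> Ka * y \<Longrightarrow> 0 \<le> y \<Longrightarrow> x \<le> (Ka + Kb) * y" "x \<le> Kb * y \<Longrightarrow> 0 \<le> y \<Longrightarrow> x \<le> (Ka + Kb) * y" for x y
    using Ka(1) Kb(1) by (simp_all add: distrib_right) (smt (verit) mult_nonneg_nonneg)+
  have upe: "x \<le> ennreal (Ka * y) \<Longrightarrow> 0 \<le> y \<Longrightarrow> x \<le> ennreal ((Ka + Kb) * y)"
    "x \<le> ennreal (Kb * y) \<Longrightarrow> 0 \<le> y \<Longrightarrow> x \<le> ennreal ((Ka + Kb) * y)" for x y
    using up[of "Ka * y" y] up[of "Kb * y" y] by (auto elim!: order_trans intro!: ennreal_leI)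
  show thesis
  proof (rule that[of "Ka + Kb"])
    fix e
    show "(cmod (duhamel \<mu> (prim g) (len e) / sn \<mu> (len e)))\<^sup>2 \<le> (Ka + Kb) * enn2real (edge_sq (len e) g)" if "edge_L2 (len e) g" for g
      using that by (cases e) (simp only: edge_length.simps, intro up Ka Kb; simp)+
    show "(cmod (end_defect \<mu> (len e) g))\<^sup>2 \<le> (Ka + Kb) * enn2real (edge_sq (len e) g)" if "edge_L2 (len e) g" for g
      using that by (cases e) (simp only: edge_length.simps, intro up Ka Kb; simp)+
    show "edge_sq (len e) (sol \<mu> z (edge_slope \<mu> (len e) z y g) (prim g)) \<le>
       ennreal ((Ka + Kb) * ((cmod z)\<^sup>2 + (cmod y)\<^sup>2 + enn2real (edge_sq (len e) g)))" if "edge_L2 (len e) g" for z y g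
      using that by (cases e) (simp only: edge_length.simps, intro upe Ka Kb; simp)+
  qed (use Ka Kb in simp)
qed

text \<open>Each edge enters the residual once at its source and once at its target, whence the 2 in
  front of \<open>C\<close>; the 4 inside \<open>C\<close> comes from squaring a sum of four
  terms.\<close>

lemma resid_bound:
  obtains K where "0 \<le> K"
    "\<And>g. (\<And>e. edge_L2 (len e) (g e)) \<Longrightarrow> vsq (resid g) \<le> ennreal K * family_sq a b g"
proof -
  obtain K where K: "0 \<le> K"
    "\<And>e g. edge_L2 (len e) g \<Longrightarrow> (cmod (duhamel \<mu> (prim g) (len e) / sn \<mu> (len e)))\<^sup>2 \<le> K * enn2real (edge_sq (len e) g)"
    "\<And>e g. edge_L2 (len e) g \<Longrightarrow> (cmod (end_defect \<mu> (len e) g))\<^sup>2 \<le> K * enn2real (edge_sq (len e) g)"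
    using edge_constants by metis
  define C where "C = 4 * K / D\<^sup>2"
  have C0: "0 \<le> C" using K by (simp add: C_def)
  show thesis
  proof (rule that)
    show "0 \<le> 2 * C" using C0 by simp
    fix g assume g: "\<And>e. edge_L2 (len e) (g e)"
    define n where "n e = edge_sq (len e) (g e)" for e
    have n: "n e = ennreal (enn2real (n e))" for e using g[of e] by (simp add: n_def edge_L2_def)
    have pw: "ennreal ((cmod (resid g v))\<^sup>2) \<le> ennreal C * (n (Hor v) + n (Ver v) + n (Hor (v + (-1, 0))) + n (Ver (v + (0, -1))))" for v
    proof -
      have m: "v - (1,0) = v + (-1,0)" "v - (0,1) = v + (0,-1)" by (cases v; simp)+
      let ?x = "duhamel \<mu> (prim (g (Hor v))) a / sn \<mu> a" and ?y = "duhamel \<mu> (prim (g (Ver v))) b / sn \<mu> b"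
        and ?z = "end_defect \<mu> a (g (Hor (v + (-1, 0))))" and ?w = "end_defect \<mu> b (g (Ver (v + (0, -1))))"
      have "(cmod (resid g v))\<^sup>2 = (cmod (?x + ?y + ?z + ?w))\<^sup>2 / D\<^sup>2"
        unfolding resid_def m by (simp add: norm_divide power_divide)
      also have "\<dots> \<le> 4 * ((cmod ?x)\<^sup>2 + (cmod ?y)\<^sup>2 + (cmod ?z)\<^sup>2 + (cmod ?w)\<^sup>2) / D\<^sup>2"
        by (intro divide_right_mono square_sum4) simp
      also have "\<dots> \<le> 4 * (K * enn2real (n (Hor v)) + K * enn2real (n (Ver v))
          + K * enn2real (n (Hor (v + (-1, 0)))) + K * enn2real (n (Ver (v + (0, -1))))) / D\<^sup>2"
        using K(2)[OF g[of "Hor v"]] K(2)[OF g[of "Ver v"]] K(3)[OF g[of "Hor (v + (-1, 0))"]] K(3)[OF g[of "Ver (v + (0, -1))"]]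
        by (intro divide_right_mono mult_left_mono add_mono) (simp_all add: n_def)
      also have "\<dots> = C * (enn2real (n (Hor v)) + enn2real (n (Ver v))
          + enn2real (n (Hor (v + (-1, 0)))) + enn2real (n (Ver (v + (0, -1)))))"
        by (simp add: C_def algebra_simps add_divide_distrib)
      finally have "ennreal ((cmod (resid g v))\<^sup>2) \<le> ennreal \<dots>" by (rule ennreal_leI)
      also have "\<dots> = ennreal C * (n (Hor v) + n (Ver v) + n (Hor (v + (-1, 0))) + n (Ver (v + (0, -1))))"
        using C0 by (subst (5 6 7 8) n) (simp add: ennreal_mult ennreal_plus)
      finally show ?thesis .
    qed
    have "vsq (resid g) \<le> (\<integral>\<^sup>+ v. ennreal C * (n (Hor v) + n (Ver v) + n (Hor (v + (-1, 0))) + n (Ver (v + (0, -1)))) \<partial>count_space UNIV)"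
      unfolding vsq_def by (intro nn_integral_mono pw)
    also have "\<dots> = ennreal C * (family_sq a b g + family_sq a b g)"
      unfolding family_sq_def nn_integral_edges n_def[symmetric]
      by (simp add: nn_integral_add nn_integral_cmult nn_integral_count_space_shift[of "\<lambda>v. n (Hor v)"]
         nn_integral_count_space_shift[of "\<lambda>v. n (Ver v)"] ac_simps)
    also have "\<dots> = ennreal (2 * C) * family_sq a b g"
      using C0 by (simp add: ennreal_mult mult_2[symmetric] ac_simps)
    finally show "vsq (resid g) \<le> ennreal (2 * C) * family_sq a b g" .
  qed
qed

text \<open>Every vertex is the source of two edges and the target of two others, whence
  \<open>4 * vsq F\<close>.\<close>

lemma solution_bound:
  obtains K where "0 \<le> K"
    "\<And>F g. (\<And>e. edge_L2 (len e) (g e)) \<Longrightarrow>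
       family_sq a b (\<lambda>e. sol \<mu> (F (edge_source e)) (slope F g e) (prim (g e)))
         \<le> ennreal K * (4 * vsq F + family_sq a b g)"
proof -
  obtain K where K: "0 \<le> K"
    "\<And>e z y g. edge_L2 (len e) g \<Longrightarrow> edge_sq (len e) (sol \<mu> z (edge_slope \<mu> (len e) z y g) (prim g)) \<le>
       ennreal (K * ((cmod z)\<^sup>2 + (cmod y)\<^sup>2 + enn2real (edge_sq (len e) g)))"
    using edge_constants by metis
  show thesis
  proof (rule that[OF K(1)])
    fix F :: "vertex \<Rightarrow> complex" and g assume g: "\<And>e. edge_L2 (len e) (g e)"
    have "family_sq a b (\<lambda>e. sol \<mu> (F (edge_source e)) (slope F g e) (prim (g e))) \<le>
      (\<integral>\<^sup>+ e. ennreal K * (ennreal ((cmod (F (edge_source e)))\<^sup>2) + ennreal ((cmod (F (edge_target e)))\<^sup>2) + edge_sq (len e) (g e)) \<partial>count_space UNIV)"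
      unfolding family_sq_def
    proof (rule nn_integral_mono)
      fix e
      have "edge_sq (len e) (sol \<mu> (F (edge_source e)) (slope F g e) (prim (g e))) \<le>
        ennreal (K * ((cmod (F (edge_source e)))\<^sup>2 + (cmod (F (edge_target e)))\<^sup>2 + enn2real (edge_sq (len e) (g e))))"
        unfolding slope_def by (rule K(2)[OF g])
      also have "\<dots> = ennreal K * (ennreal ((cmod (F (edge_source e)))\<^sup>2) + ennreal ((cmod (F (edge_target e)))\<^sup>2) + ennreal (enn2real (edge_sq (len e) (g e))))"
        using K(1) by (simp add: ennreal_mult ennreal_plus)
      also have "ennreal (enn2real (edge_sq (len e) (g e))) = edge_sq (len e) (g e)"
        using g[of e] by (simp add: edge_L2_def)
      finally show "edge_sq (len e) (sol \<mu> (F (edge_source e)) (slope F g e) (prim (g e))) \<le>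
        ennreal K * (ennreal ((cmod (F (edge_source e)))\<^sup>2) + ennreal ((cmod (F (edge_target e)))\<^sup>2) + edge_sq (len e) (g e))" .
    qed
    also have "\<dots> = ennreal K * ((vsq F + vsq F) + (vsq F + vsq F) + family_sq a b g)"
      by (simp add: nn_integral_add nn_integral_cmult nn_integral_edge_source nn_integral_edge_target family_sq_def)
    also have "(vsq F + vsq F) + (vsq F + vsq F) = 4 * vsq F"
      by (metis (no_types) add.assoc mult_2 numeral_Bit0 distrib_right numeral_One one_add_one)
    finally show "family_sq a b (\<lambda>e. sol \<mu> (F (edge_source e)) (slope F g e) (prim (g e)))
         \<le> ennreal K * (4 * vsq F + family_sq a b g)" .
  qed
qed

text \<open>Both injectivity and boundedness of the inverse follow from this single estimate. The
  trace bound involves \<open>h\<close> and \<open>f\<close> separately and only shows that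
  \<open>vsq F\<close> is finite; the quantitative bound by the source comes from the
  contraction.\<close>

lemma hamiltonian_bound:
  obtains K where "0 \<le> K"
    "\<And>f h. (f, h) \<in> delta_hamiltonian a b u \<Longrightarrow>
       graph_sq a b f \<le> ennreal K * graph_sq a b (\<lambda>x. h x - of_real \<mu> * f x)"
proof -
  obtain Kr where Kr: "0 \<le> Kr"
    "\<And>g. (\<And>e. edge_L2 (len e) (g e)) \<Longrightarrow> vsq (resid g) \<le> ennreal Kr * family_sq a b g"
    using resid_bound by metis
  obtain Ks where Ks: "0 \<le> Ks"
    "\<And>F g. (\<And>e. edge_L2 (len e) (g e)) \<Longrightarrow>
       family_sq a b (\<lambda>e. sol \<mu> (F (edge_source e)) (slope F g e) (prim (g e)))
         \<le> ennreal Ks * (4 * vsq F + family_sq a b g)"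
    using solution_bound by metis
  obtain Kt where Kt: "0 \<le> Kt"
    "\<And>\<phi> \<phi>1 h. sobolev_H2 a \<phi> \<phi>1 (\<lambda>t. - h t) \<Longrightarrow>
       ennreal ((cmod (\<phi> 0))\<^sup>2) \<le> ennreal Kt * (edge_sq a \<phi> + edge_sq a h)"
    using sobolev_H2_trace_bound[OF a] by metis
  define q where "q = 1 / (1 - \<theta>)"
  have q: "0 < q" using \<theta>_less by (simp add: q_def)
  show thesis
  proof (rule that)
    show "0 \<le> Ks * (4 * (q * (q * Kr)) + 1)" using q Ks(1) Kr(1) by simp
    fix f h assume "(f, h) \<in> delta_hamiltonian a b u"
    then obtain f' F where f: "f \<in> L2 (lattice_graph a b)" and h: "h \<in> L2 (lattice_graph a b)"
      and H: "\<And>e. sobolev_H2 (len e) (\<lambda>t. f (e, t)) (f' e) (\<lambda>t. - h (e, t))"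
      and F: "\<And>e. f (e, 0) = F (edge_source e)" "\<And>e. f (e, len e) = F (edge_target e)"
      and V: "\<And>v. (\<Sum>e | edge_source e = v. f' e 0) + (\<Sum>e | edge_target e = v. - f' e (len e)) = complex_of_real u * F v"
      unfolding delta_hamiltonian_def by blast
    define g where "g e t = h (e, t) - of_real \<mu> * f (e, t)" for e t
    note rep = sobolev_representation[OF len_pos H, where \<mu> = \<mu>, folded g_def]
    have g: "edge_L2 (len e) (g e)" for e using rep(1)[of e] by (simp add: g_def[abs_def])
    have fs: "f (e, t) = sol \<mu> (F (edge_source e)) (f' e 0) (prim (g e)) t" if "t \<in> {0..len e}" for e t
      using rep(2)[OF that] by (simp only: F(1))
    have f's: "f' e t = mom \<mu> (F (edge_source e)) (f' e 0) (prim (g e)) t - prim (g e) t"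
      if "t \<in> {0..len e}" for e t
      using rep(3)[OF that] by (simp only: F(1))
    have le: "len e \<in> {0..len e}" for e using len_pos[of e] by simp
    have sl: "f' e 0 = slope F g e" for e
      unfolding slope_def using fs[OF le, of e] F(2)[of e] by (intro sol_edge_slope(2) sn_len) simp
    have Feq: "F v = nbr r s F v + resid g v" for v
      using V[of v] unfolding f's[OF le] unfolding sl vertex_condition_iff .
    \<comment> \<open>Each vertex is the source of exactly one horizontal edge, so traces at the
      starting points of horizontal edges capture all of \<open>F\<close>.\<close>
    have "vsq F \<le> (\<integral>\<^sup>+ v. ennreal Kt * (edge_sq (len (Hor v)) (\<lambda>t. f (Hor v, t)) + edge_sq (len (Hor v)) (\<lambda>t. h (Hor v, t))) \<partial>count_space UNIV)"
      unfolding vsq_def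
    proof (rule nn_integral_mono)
      fix v
      show "ennreal ((cmod (F v))\<^sup>2) \<le> ennreal Kt * (edge_sq (len (Hor v)) (\<lambda>t. f (Hor v, t)) + edge_sq (len (Hor v)) (\<lambda>t. h (Hor v, t)))"
        using Kt(2)[OF H[of "Hor v", unfolded edge_length.simps]] F(1)[of "Hor v"] by simp
    qed
    also have "\<dots> \<le> ennreal Kt * (graph_sq a b f + graph_sq a b h)"
      unfolding graph_sq_def nn_integral_edges
      by (simp add: nn_integral_cmult nn_integral_add del: edge_length.simps) (intro mult_left_mono add_mono; simp)
    also have "\<dots> < \<infinity>" using f h by (auto simp: graph_L2_iff ennreal_mult_less_top)
    finally have fin: "vsq F < \<infinity>" .
    let ?G = "family_sq a b g"
    have "vsq F \<le> ennreal q * (ennreal q * vsq (resid g))"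
      unfolding q_def by (rule vsq_bound[OF Feq \<theta>_def[symmetric] \<theta>_less fin])
    also have "\<dots> \<le> ennreal q * (ennreal q * (ennreal Kr * ?G))"
      by (intro mult_left_mono Kr(2) g) auto
    finally have vF: "vsq F \<le> ennreal (q * (q * Kr)) * ?G"
      using q Kr(1) by (simp add: ennreal_mult mult.assoc)
    have "graph_sq a b f = family_sq a b (\<lambda>e. sol \<mu> (F (edge_source e)) (slope F g e) (prim (g e)))"
      unfolding graph_sq_def family_sq_def edge_sq_def
      by (intro nn_integral_cong) (auto simp: indicator_def fs sl)
    also have "\<dots> \<le> ennreal Ks * (4 * vsq F + ?G)" by (rule Ks(2)[OF g])
    also have "\<dots> \<le> ennreal Ks * (4 * (ennreal (q * (q * Kr)) * ?G) + ?G)"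
      by (intro mult_left_mono add_right_mono vF) auto
    also have "\<dots> = ennreal (Ks * (4 * (q * (q * Kr)) + 1)) * ?G"
      using q Ks(1) Kr(1) by (simp add: ennreal_mult ennreal_plus distrib_left distrib_right ac_simps)
    also have "?G = graph_sq a b (\<lambda>x. h x - of_real \<mu> * f x)"
      by (simp add: graph_sq_family g_def[abs_def])
    finally show "graph_sq a b f \<le> ennreal (Ks * (4 * (q * (q * Kr)) + 1)) * graph_sq a b (\<lambda>x. h x - of_real \<mu> * f x)" .
  qed
qed

text \<open>A solution of the difference equation is extended along each edge by \<open>sol\<close>.
  The choice of \<open>edge_slope\<close> gives continuity at the vertices, and the difference
  equation is the vertex condition. Defining \<open>h\<close> as \<open>g0\<close> plus
  \<open>\<mu>\<close> times \<open>f\<close> makes the equation hold at every point.\<close>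

lemma hamiltonian_surjective:
  assumes g0: "g0 \<in> L2 (lattice_graph a b)"
  shows "\<exists>(f, h)\<in>delta_hamiltonian a b u. \<forall>x. h x - of_real \<mu> * f x = g0 x"
proof -
  define g where "g e t = g0 (e, t)" for e t
  have g: "edge_L2 (len e) (g e)" for e using graph_L2_edge[OF g0, of e] by (simp add: g_def[abs_def])
  have G: "family_sq a b g < \<infinity>" using g0 by (simp add: graph_L2_iff graph_sq_family g_def[abs_def])
  obtain Kr where Kr: "vsq (resid g) \<le> ennreal Kr * family_sq a b g"
    using resid_bound g by metis
  then have "vsq (resid g) < \<infinity>" using G by (auto simp: ennreal_mult_less_top intro: order.strict_trans1)
  from vsq_exists[OF this \<theta>_def[symmetric] \<theta>_less]
  obtain F where F: "\<And>v. F v = nbr r s F v + resid g v" "vsq F < \<infinity>" by metis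
  define f where "f x = (case x of (e, t) \<Rightarrow> sol \<mu> (F (edge_source e)) (slope F g e) (prim (g e)) t)" for x
  define f' where "f' e t = mom \<mu> (F (edge_source e)) (slope F g e) (prim (g e)) t - prim (g e) t" for e t
  define h where "h x = g0 x + of_real \<mu> * f x" for x
  note ex = sobolev_existence[OF len_pos g, where \<mu> = \<mu>]
  have fe: "(\<lambda>t. f (e, t)) = sol \<mu> (F (edge_source e)) (slope F g e) (prim (g e))" for e by (simp add: f_def)
  have eL: "edge_L2 (len e) (\<lambda>t. f (e, t))" for e unfolding fe by (rule continuous_edge_L2[OF ex(1)])
  obtain Ks where "family_sq a b (\<lambda>e. sol \<mu> (F (edge_source e)) (slope F g e) (prim (g e)))
         \<le> ennreal Ks * (4 * vsq F + family_sq a b g)"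
    using solution_bound g by metis
  also have "\<dots> < \<infinity>" using F(2) G by (auto simp: ennreal_mult_less_top)
  finally have ff: "graph_sq a b f < \<infinity>" by (simp add: graph_sq_family fe)
  have fL: "f \<in> L2 (lattice_graph a b)" using eL ff by (auto simp: graph_L2_iff edge_L2_def)
  have he: "edge_L2 (len e) (\<lambda>t. h (e, t))" for e
    using edge_L2_add[OF g eL, of e "of_real \<mu>"] by (simp add: h_def g_def)
  have "graph_sq a b h \<le> (\<integral>\<^sup>+ e. ennreal 2 * edge_sq (len e) (g e) + ennreal (2 * \<mu>\<^sup>2) * edge_sq (len e) (\<lambda>t. f (e, t)) \<partial>count_space UNIV)"
    unfolding graph_sq_def
  proof (rule nn_integral_mono)
    fix e
    show "edge_sq (len e) (\<lambda>t. h (e, t)) \<le> ennreal 2 * edge_sq (len e) (g e) + ennreal (2 * \<mu>\<^sup>2) * edge_sq (len e) (\<lambda>t. f (e, t))"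
      using edge_L2_lincomb(2)[OF g eL, of e 1 "of_real \<mu>"] by (simp add: h_def g_def)
  qed
  also have "\<dots> = ennreal 2 * family_sq a b g + ennreal (2 * \<mu>\<^sup>2) * graph_sq a b f"
    by (simp add: nn_integral_add nn_integral_cmult family_sq_def graph_sq_def)
  also have "\<dots> < \<infinity>" using ff G by (auto simp: ennreal_mult_less_top)
  finally have hL: "h \<in> L2 (lattice_graph a b)" using he by (auto simp: graph_L2_iff edge_L2_def)
  have "(f, h) \<in> delta_hamiltonian a b u"
    unfolding delta_hamiltonian_def
  proof (clarsimp, intro conjI fL hL exI[of _ f'] exI[of _ F] allI)
    fix e
    show "sobolev_H2 (len e) (\<lambda>t. f (e, t)) (f' e) (\<lambda>t. - h (e, t))"
      using ex(3)[of e "F (edge_source e)" "slope F g e"]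
      by (simp add: fe f'_def[abs_def] h_def) (simp add: g_def f_def)
    show "f (e, 0) = F (edge_source e)" by (simp add: f_def)
    show "f (e, len e) = F (edge_target e)"
      unfolding f_def slope_def by (simp add: sol_edge_slope(1)[OF sn_len])
  next
    fix v
    have f'0: "f' e 0 = slope F g e" for e by (simp add: f'_def)
    show "(\<Sum>e | edge_source e = v. f' e 0) + (\<Sum>e | edge_target e = v. - f' e (len e)) = complex_of_real u * F v"
      unfolding f'0 using F(1)[of v] unfolding f'_def vertex_condition_iff .
  qed
  moreover have "h x - of_real \<mu> * f x = g0 x" for x by (simp add: h_def)
  ultimately show ?thesis by blast
qed

lemma in_resolvent_set:
  "complex_of_real \<mu> \<in> resolvent_set (lattice_graph a b) (delta_hamiltonian a b u)"
proof -
  let ?M = "lattice_graph a b" and ?T = "delta_hamiltonian a b u"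
  obtain K where K: "0 \<le> K"
    "\<And>f h. (f, h) \<in> ?T \<Longrightarrow> graph_sq a b f \<le> ennreal K * graph_sq a b (\<lambda>x. h x - of_real \<mu> * f x)"
    using hamiltonian_bound by metis
  have m: "f \<in> borel_measurable ?M" "(\<lambda>x. h x - of_real \<mu> * f x) \<in> borel_measurable ?M"
    "graph_sq a b (\<lambda>x. h x - of_real \<mu> * f x) < \<infinity>" if "(f, h) \<in> ?T" for f h
  proof -
    have f: "f \<in> L2 ?M" "h \<in> L2 ?M" using that by (auto simp: delta_hamiltonian_def)
    then show 1: "f \<in> borel_measurable ?M" "(\<lambda>x. h x - of_real \<mu> * f x) \<in> borel_measurable ?M"
      by (auto simp: L2_def)
    have "graph_sq a b (\<lambda>x. h x - of_real \<mu> * f x) \<le>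
      (\<integral>\<^sup>+ e. ennreal 2 * edge_sq (len e) (\<lambda>t. h (e, t)) + ennreal (2 * \<mu>\<^sup>2) * edge_sq (len e) (\<lambda>t. f (e, t)) \<partial>count_space UNIV)"
      unfolding graph_sq_def
    proof (rule nn_integral_mono)
      fix e
      show "edge_sq (len e) (\<lambda>t. h (e, t) - of_real \<mu> * f (e, t)) \<le>
         ennreal 2 * edge_sq (len e) (\<lambda>t. h (e, t)) + ennreal (2 * \<mu>\<^sup>2) * edge_sq (len e) (\<lambda>t. f (e, t))"
        using edge_L2_lincomb(2)[OF graph_L2_edge[OF f(2)] graph_L2_edge[OF f(1)], of e 1 "- of_real \<mu>"] by simp
    qed
    also have "\<dots> = ennreal 2 * graph_sq a b h + ennreal (2 * \<mu>\<^sup>2) * graph_sq a b f"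
      by (simp add: nn_integral_add nn_integral_cmult graph_sq_def)
    also have "\<dots> < \<infinity>" using f by (auto simp: ennreal_mult_less_top graph_L2_iff)
    finally show "graph_sq a b (\<lambda>x. h x - of_real \<mu> * f x) < \<infinity>" .
  qed
  have inj: "AE x in ?M. f x = 0" if T: "(f, h) \<in> ?T" and z: "AE x in ?M. h x - of_real \<mu> * f x = 0" for f h
  proof -
    have "graph_sq a b (\<lambda>x. h x - of_real \<mu> * f x) = 0" using AE_zero_graph[OF m(2)[OF T]] z by simp
    then have "graph_sq a b f = 0" using K(2)[OF T] by simp
    then show ?thesis using AE_zero_graph[OF m(1)[OF T]] by simp
  qed
  have bd: "L2_norm ?M f \<le> sqrt K * L2_norm ?M (\<lambda>x. h x - of_real \<mu> * f x)" if T: "(f, h) \<in> ?T" for f h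
  proof -
    let ?g = "graph_sq a b (\<lambda>x. h x - of_real \<mu> * f x)"
    have "graph_sq a b f \<le> ennreal (K * enn2real ?g)"
      using K(2)[OF T] m(3)[OF T] K(1) by (simp add: ennreal_mult')
    then have "enn2real (graph_sq a b f) \<le> K * enn2real ?g"
      using K(1) by (intro enn2real_leI) auto
    then have "sqrt (enn2real (graph_sq a b f)) \<le> sqrt K * sqrt (enn2real ?g)"
      by (simp add: real_sqrt_mult[symmetric])
    then show ?thesis by (simp add: L2_norm_graph[OF m(1)[OF T]] L2_norm_graph[OF m(2)[OF T]])
  qed
  have sur: "\<exists>(f, h)\<in>?T. AE x in ?M. h x - of_real \<mu> * f x = g x" if "g \<in> L2 ?M" for g
    using hamiltonian_surjective[OF that] by fastforce
  show ?thesis unfolding resolvent_set_def using inj bd sur by blast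
qed

end

section \<open>The spectrum\<close>

text \<open>By Cauchy-Schwarz the primitive of \<open>\<phi>\<close> vanishes identically, hence so
  does its derivative \<open>\<phi>\<close>.\<close>

lemma edge_sq_eq_0:
  assumes l: "0 < l" and c: "continuous_on {0..l} \<phi>" and z: "edge_sq l \<phi> = 0" and x: "x \<in> {0..l}"
  shows "\<phi> x = 0"
proof -
  have int: "integral {0..y} \<phi> = 0" if "y \<in> {0..l}" for y
    using edge_L2_integral(3)[OF continuous_edge_L2[OF c] l that] z by (simp add: ennreal_eq_0_iff)
  have 1: "((\<lambda>y. integral {0..y} \<phi>) has_vector_derivative \<phi> x) (at x within {0..l})"
    by (rule integral_has_vector_derivative[OF c x])
  have "((\<lambda>y. 0) has_vector_derivative \<phi> x) (at x within {0..l})"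
    by (rule has_vector_derivative_transform[OF x _ 1]) (use int in auto)
  then show ?thesis
    using vector_derivative_unique_within_closed_interval[of 0 l x "\<lambda>_. 0" "\<phi> x" 0] l x by simp
qed

text \<open>The derivative of the cutoff vanishes at both ends of an edge, so truncation preserves the vertex
  conditions.\<close>

definition smoothstep :: "real \<Rightarrow> real" where "smoothstep t = 3 * t\<^sup>2 - 2 * t ^ 3"

lemma DERIV_smoothstep: "(smoothstep has_real_derivative 6 * t - 6 * t\<^sup>2) (at t within S)"
  unfolding smoothstep_def[abs_def] by (auto intro!: derivative_eq_intros simp: power2_eq_square)

text \<open>Floquet data: the wave is multiplied by \<open>w1\<close> or \<open>w2\<close> under a
  unit step to the right or upwards, and has value \<open>A\<close> and slopes \<open>B1\<close>,
  \<open>B2\<close> at the start of the edges leaving the origin. The edges arriving at the origin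
  begin one step back, which explains the divisions in \<open>kirchhoff\<close>.
  \<open>A = 0\<close> is permitted, so that waves vanishing at all vertices are included.\<close>

locale bloch_wave =
  fixes a b u \<mu> :: real and w1 w2 A B1 B2 :: complex
  assumes a: "0 < a" and b: "0 < b"
    and w1: "cmod w1 = 1" and w2: "cmod w2 = 1"
    and val1: "cs \<mu> a *\<^sub>R A + sn \<mu> a *\<^sub>R B1 = w1 * A"
    and val2: "cs \<mu> b *\<^sub>R A + sn \<mu> b *\<^sub>R B2 = w2 * A"
    and kirchhoff: "B1 + B2 - (cs \<mu> a *\<^sub>R B1 - (\<mu> * sn \<mu> a) *\<^sub>R A) / w1
        - (cs \<mu> b *\<^sub>R B2 - (\<mu> * sn \<mu> b) *\<^sub>R A) / w2 = u * A"
    and nonzero: "A \<noteq> 0 \<or> B1 \<noteq> 0 \<or> B2 \<noteq> 0"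
begin

abbreviation len where "len \<equiv> edge_length a b"

lemma len_pos: "0 < len e" using a b by (cases e) auto

fun slope :: "edge \<Rightarrow> complex" where "slope (Hor v) = B1" | "slope (Ver v) = B2"
fun mult :: "edge \<Rightarrow> complex" where "mult (Hor v) = w1" | "mult (Ver v) = w2"

definition wave :: "edge \<Rightarrow> real \<Rightarrow> complex" where
  "wave e t = cs \<mu> t *\<^sub>R A + sn \<mu> t *\<^sub>R slope e"

definition dwave :: "edge \<Rightarrow> real \<Rightarrow> complex" where
  "dwave e t = cs \<mu> t *\<^sub>R slope e - (\<mu> * sn \<mu> t) *\<^sub>R A"

lemma wave_deriv: "(wave e has_vector_derivative dwave e t) (at t within S)"
  and dwave_deriv: "(dwave e has_vector_derivative - (\<mu> *\<^sub>R wave e t)) (at t within S)"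
proof -
  note rules = has_vector_derivative_add has_vector_derivative_diff has_vector_derivative_scaleR DERIV_cmult
    has_vector_derivative_const DERIV_sn DERIV_cs
  show "(wave e has_vector_derivative dwave e t) (at t within S)"
    unfolding wave_def[abs_def] dwave_def
    by (rule has_vector_derivative_eq_rhs, (rule rules)+, simp add: algebra_simps)
  show "(dwave e has_vector_derivative - (\<mu> *\<^sub>R wave e t)) (at t within S)"
    unfolding wave_def dwave_def[abs_def]
    by (rule has_vector_derivative_eq_rhs, (rule rules)+, simp add: algebra_simps)
qed

lemma wave_0 [simp]: "wave e 0 = A" and dwave_0 [simp]: "dwave e 0 = slope e"
  by (auto simp: wave_def dwave_def)

lemma wave_len: "wave e (len e) = mult e * A"
  using val1 val2 by (cases e) (auto simp: wave_def)

lemma continuous_wave: "continuous_on S (wave e)" and continuous_dwave: "continuous_on S (dwave e)"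
  by (rule continuous_on_vector_derivative, rule wave_deriv)
    (rule continuous_on_vector_derivative, rule dwave_deriv)

text \<open>The squared norm over one lattice cell, to be multiplied by the number of cells. If it
  vanished, then \<open>A\<close> and both slopes would be zero.\<close>

lemma wave_positive: "0 < edge_sq a (wave (Hor v)) + edge_sq b (wave (Ver v))"
proof (rule ccontr)
  assume "\<not> ?thesis"
  then have z: "edge_sq (len (Hor v)) (wave (Hor v)) = 0" "edge_sq (len (Ver v)) (wave (Ver v)) = 0" by auto
  have "A = 0 \<and> slope e = 0" if z: "edge_sq (len e) (wave e) = 0" for e
  proof -
    have w: "wave e x = 0" if "x \<in> {0..len e}" for x
      by (rule edge_sq_eq_0[OF len_pos continuous_wave z that])
    have 0: "0 \<in> {0..len e}" using len_pos[of e] by simp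
    have "((\<lambda>_. 0) has_vector_derivative dwave e 0) (at 0 within {0..len e})"
      by (rule has_vector_derivative_transform[OF 0 _ wave_deriv]) (use w in auto)
    then have "dwave e 0 = 0"
      using vector_derivative_unique_within_closed_interval[of 0 "len e" 0 "\<lambda>_. 0" "dwave e 0" 0] len_pos[of e] by simp
    then have "slope e = 0" by (simp only: dwave_0)
    moreover have "A = 0" using w[OF 0] by (simp only: wave_0)
    ultimately show ?thesis by blast
  qed
  from this[OF z(1)] this[OF z(2)] show False using nonzero unfolding slope.simps by blast
qed

definition phase :: "vertex \<Rightarrow> complex" where "phase v = w1 powi fst v * w2 powi snd v"

lemma mult_nz: "mult e \<noteq> 0" using w1 w2 by (cases e) auto

lemma phase_target: "phase (edge_target e) = mult e * phase (edge_source e)"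
proof -
  have "w1 \<noteq> 0" "w2 \<noteq> 0" using w1 w2 by auto
  then show ?thesis
    by (cases e) (auto simp: phase_def edge_target_plus power_int_add_1 ac_simps)
qed

lemma cmod_phase [simp]: "cmod (phase v) = 1"
  using w1 w2 by (simp add: phase_def norm_mult norm_power_int)

section \<open>Truncation of the wave to large boxes\<close>

definition box :: "nat \<Rightarrow> vertex set" where "box n = {0..int n} \<times> {0..int n}"

definition ind :: "nat \<Rightarrow> vertex \<Rightarrow> real" where "ind n v = indicator (box n) v"

definition jump :: "nat \<Rightarrow> edge \<Rightarrow> real" where "jump n e = ind n (edge_target e) - ind n (edge_source e)"

text \<open>Interpolates the indicator of the box along each edge. It is constant on an edge unless
  the edge crosses the boundary of the box, so its derivatives live on boundary edges only.\<close>

definition cut :: "nat \<Rightarrow> edge \<Rightarrow> real \<Rightarrow> real" where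
  "cut n e t = ind n (edge_source e) + jump n e * smoothstep (t / len e)"

definition dcut :: "nat \<Rightarrow> edge \<Rightarrow> real \<Rightarrow> real" where
  "dcut n e t = jump n e * (6 * (t / len e) - 6 * (t / len e)\<^sup>2) / len e"

definition ddcut :: "nat \<Rightarrow> edge \<Rightarrow> real \<Rightarrow> real" where
  "ddcut n e t = jump n e * (6 - 12 * (t / len e)) / (len e)\<^sup>2"

lemma cut_deriv: "(cut n e has_real_derivative dcut n e t) (at t within S)"
proof -
  have "((\<lambda>t. t / len e) has_real_derivative 1 / len e) (at t within S)"
    by (rule DERIV_cdivide[OF DERIV_ident])
  from DERIV_chain2[OF DERIV_smoothstep this]
  have "((\<lambda>t. smoothstep (t / len e)) has_real_derivative (6 * (t / len e) - 6 * (t / len e)\<^sup>2) * (1 / len e)) (at t within S)" .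
  from DERIV_add[OF DERIV_const DERIV_cmult[OF this]] show ?thesis
    unfolding cut_def[abs_def] dcut_def by simp
qed

lemma dcut_deriv: "(dcut n e has_real_derivative ddcut n e t) (at t within S)"
proof -
  have "((\<lambda>t. j * (6 * (t / l) - 6 * (t / l)\<^sup>2) / l) has_real_derivative j * (6 - 12 * (t / l)) / l\<^sup>2) (at t within S)"
    if "l \<noteq> 0" for j l :: real
    using that by (auto intro!: derivative_eq_intros simp: field_simps power2_eq_square)
  then show ?thesis unfolding dcut_def[abs_def] ddcut_def using len_pos[of e] by fastforce
qed

lemma cut_ends: "cut n e 0 = ind n (edge_source e)" "cut n e (len e) = ind n (edge_target e)"
  "dcut n e 0 = 0" "dcut n e (len e) = 0"
  using len_pos[of e] by (auto simp: cut_def dcut_def smoothstep_def jump_def)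

definition trial :: "nat \<Rightarrow> edge \<times> real \<Rightarrow> complex" where
  "trial n x = (case x of (e, t) \<Rightarrow> phase (edge_source e) * (cut n e t *\<^sub>R wave e t))"

definition dtrial :: "nat \<Rightarrow> edge \<Rightarrow> real \<Rightarrow> complex" where
  "dtrial n e t = phase (edge_source e) * (dcut n e t *\<^sub>R wave e t + cut n e t *\<^sub>R dwave e t)"

text \<open>This is H - \<mu> applied to \<open>trial n\<close>: by the product rule the terms
  without derivatives of \<open>cut\<close> drop out because \<open>wave\<close> solves the
  homogeneous equation.\<close>

definition defect :: "nat \<Rightarrow> edge \<times> real \<Rightarrow> complex" where
  "defect n x = (case x of (e, t) \<Rightarrow>
     - (phase (edge_source e) * (ddcut n e t *\<^sub>R wave e t + (2 * dcut n e t) *\<^sub>R dwave e t)))"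

lemma trial_deriv: "((\<lambda>t. trial n (e, t)) has_vector_derivative dtrial n e t) (at t within S)"
  unfolding trial_def dtrial_def split_conv
  by (rule has_vector_derivative_eq_rhs,
      (rule has_vector_derivative_mult_right has_vector_derivative_scaleR cut_deriv wave_deriv)+,
      simp add: algebra_simps)

lemma dtrial_deriv:
  "(dtrial n e has_vector_derivative - (defect n (e, t) + \<mu> * trial n (e, t))) (at t within S)"
  unfolding trial_def dtrial_def[abs_def] defect_def split_conv
  by (rule has_vector_derivative_eq_rhs,
      (rule has_vector_derivative_mult_right has_vector_derivative_add has_vector_derivative_scaleR cut_deriv dcut_deriv wave_deriv dwave_deriv)+,
      simp add: algebra_simps scaleR_conv_of_real)

lemma continuous_cut: "continuous_on S (cut n e)" "continuous_on S (dcut n e)" "continuous_on S (ddcut n e)"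
  using len_pos[of e]
  by (auto intro!: continuous_intros simp: cut_def[abs_def] dcut_def[abs_def] ddcut_def[abs_def] smoothstep_def)

lemma continuous_trial: "continuous_on S (\<lambda>t. trial n (e, t))" "continuous_on S (\<lambda>t. defect n (e, t))"
  unfolding trial_def defect_def split_conv
  by (intro continuous_intros continuous_cut continuous_wave continuous_dwave)+

lemma trial_sobolev:
  "sobolev_H2 (len e) (\<lambda>t. trial n (e, t)) (dtrial n e) (\<lambda>t. - (defect n (e, t) + \<mu> * trial n (e, t)))"
proof -
  let ?h = "\<lambda>t. - (defect n (e, t) + \<mu> * trial n (e, t))"
  have c: "continuous_on S ?h" for S by (intro continuous_intros continuous_trial)
  have L: "edge_L2 (len e) ?h" by (rule continuous_edge_L2[OF c])
  have "dtrial n e x = dtrial n e 0 + (LBINT t:{0..x}. ?h t)" if x: "x \<in> {0..len e}" for x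
  proof -
    have "(LBINT t:{0..x}. ?h t) = integral {0..x} ?h" by (rule edge_L2_integral(4)[OF L len_pos x])
    also have "\<dots> = dtrial n e x - dtrial n e 0"
      by (intro integral_unique fundamental_theorem_of_calculus dtrial_deriv) (use x in auto)
    finally show ?thesis by simp
  qed
  then show ?thesis unfolding sobolev_H2_def edge_L2_iff using L trial_deriv by blast
qed

lemma edge_bounds:
  obtains K where "0 \<le> K"
    "\<And>n e. edge_sq (len e) (\<lambda>t. trial n (e, t)) \<le> ennreal (K * (ind n (edge_source e) + ind n (edge_target e)))"
    "\<And>n e. edge_sq (len e) (\<lambda>t. defect n (e, t)) \<le> ennreal (K * \<bar>jump n e\<bar>)"
proof -
  have "\<exists>C. \<forall>t\<in>{0..len e}. cmod (wave e t) \<le> C \<and> cmod (dwave e t) \<le> C" for e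
  proof -
    have "bounded (wave e ` {0..len e})" "bounded (dwave e ` {0..len e})"
      by (intro compact_imp_bounded compact_continuous_image continuous_wave continuous_dwave compact_Icc)+
    then obtain C1 C2 where "\<And>t. t \<in> {0..len e} \<Longrightarrow> cmod (wave e t) \<le> C1" "\<And>t. t \<in> {0..len e} \<Longrightarrow> cmod (dwave e t) \<le> C2"
      unfolding bounded_iff by blast
    then show ?thesis by (intro exI[of _ "max C1 C2"]) (auto simp: le_max_iff_disj)
  qed
  then obtain C0 where C0: "\<And>e t. t \<in> {0..len e} \<Longrightarrow> cmod (wave e t) \<le> C0 e \<and> cmod (dwave e t) \<le> C0 e" by metis
  \<comment> \<open>\<open>wave e\<close> depends only on the direction of \<open>e\<close>, so the
    two edges starting at the origin bound it on all edges.\<close>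
  define C where "C = \<bar>C0 (Hor 0)\<bar> + \<bar>C0 (Ver 0)\<bar>"
  have C: "cmod (wave e t) \<le> C" "cmod (dwave e t) \<le> C" if "t \<in> {0..len e}" for e t
    using that C0[of t "Hor 0"] C0[of t "Ver 0"] by (cases e; force simp: C_def wave_def dwave_def)+
  have C_nn: "0 \<le> C" by (simp add: C_def)
  define M where "M = 1 / a + 1 / b"
  have ab: "0 \<le> 1 / a" "0 \<le> 1 / b" using a b by auto
  have M: "1 / len e \<le> M" "0 \<le> M" for e using ab by (cases e; simp only: M_def edge_length.simps; linarith)+
  define K1 where "K1 = C * 4"
  define K2 where "K2 = 18 * M\<^sup>2 * C + 24 * M * C"
  have K12: "0 \<le> K1" "0 \<le> K2" using C_nn M by (auto simp: K1_def K2_def)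
  define K where "K = (K1\<^sup>2 + K2\<^sup>2) * (a + b)"
  have ind01: "ind n v = 0 \<or> ind n v = 1" for n v by (simp add: ind_def indicator_def)
  have j: "\<bar>jump n e\<bar> \<le> 1" for n e using ind01[of n "edge_source e"] ind01[of n "edge_target e"] by (auto simp: jump_def)
  have s: "t / len e \<in> {0..1}" if "t \<in> {0..len e}" for e t using that len_pos[of e] by auto
  have trial: "cmod (trial n (e, t)) \<le> K1" if t: "t \<in> {0..len e}" for n e t
  proof -
    define x where "x = t / len e"
    have x: "0 \<le> x" "x \<le> 1" using s[OF t] by (auto simp: x_def)
    have "x\<^sup>2 \<le> 1" "x ^ 3 \<le> 1" "0 \<le> x^3" "0 \<le> x\<^sup>2" using x by (auto simp: power_le_one)
    then have sm: "\<bar>smoothstep x\<bar> \<le> 3" unfolding smoothstep_def by linarith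
    have "\<bar>cut n e t\<bar> \<le> \<bar>ind n (edge_source e)\<bar> + \<bar>jump n e\<bar> * \<bar>smoothstep x\<bar>"
      unfolding cut_def x_def[symmetric] by (metis abs_mult abs_triangle_ineq)
    also have "\<dots> \<le> 1 + 1 * 3"
      using ind01[of n "edge_source e"] by (intro add_mono mult_mono j sm) auto
    finally have "\<bar>cut n e t\<bar> * cmod (wave e t) \<le> 4 * C"
      using C(1)[OF t] by (intro mult_mono) auto
    then show ?thesis by (simp add: trial_def norm_mult K1_def)
  qed
  have defect: "cmod (defect n (e, t)) \<le> K2" if t: "t \<in> {0..len e}" for n e t
  proof -
    define x where "x = t / len e"
    have x: "0 \<le> x" "x \<le> 1" using s[OF t] by (auto simp: x_def)
    have x2: "x\<^sup>2 \<le> 1" "0 \<le> x\<^sup>2" using x by (auto simp: power_le_one)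
    have l: "0 < 1 / len e" using len_pos[of e] by simp
    have "\<bar>ddcut n e t\<bar> = \<bar>jump n e\<bar> * \<bar>6 - 12 * x\<bar> * (1 / len e)\<^sup>2"
      by (simp add: ddcut_def x_def abs_mult power_divide)
    \<comment> \<open>18 = 6 + 12 is a crude bound for x in [0, 1], and \<open>M\<close> bounds both
      1/a and 1/b.\<close>
    also have "\<dots> \<le> 1 * 18 * M\<^sup>2" using x M(1)[of e] M(2) l by (intro mult_mono power_mono j) auto
    finally have 1: "\<bar>ddcut n e t\<bar> \<le> 18 * M\<^sup>2" by simp
    have "\<bar>dcut n e t\<bar> = \<bar>jump n e\<bar> * \<bar>6 * x - 6 * x\<^sup>2\<bar> * (1 / len e)"
      using len_pos[of e] by (simp add: dcut_def x_def abs_mult)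
    also have "\<dots> \<le> 1 * 12 * M"
    proof (intro mult_mono j)
      show "\<bar>6 * x - 6 * x\<^sup>2\<bar> \<le> 12" using x x2 by linarith
    qed (use M(1)[of e] l in auto)
    finally have 2: "2 * \<bar>dcut n e t\<bar> \<le> 24 * M" by simp
    have "cmod (defect n (e, t)) \<le> \<bar>ddcut n e t\<bar> * cmod (wave e t) + 2 * \<bar>dcut n e t\<bar> * cmod (dwave e t)"
      unfolding defect_def by (simp add: norm_mult) (rule order_trans[OF norm_triangle_ineq], simp add: abs_mult)
    also have "\<dots> \<le> 18 * M\<^sup>2 * C + 24 * M * C"
      by (rule add_mono[OF mult_mono[OF 1 C(1)[OF t]] mult_mono[OF 2 C(2)[OF t]]]) (use M(2) in auto)
    finally show ?thesis by (simp add: K2_def)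
  qed
  have l_le: "len e \<le> a + b" for e using a b by (cases e) auto
  show thesis
  proof (rule that)
    show K0: "0 \<le> K" using a b by (simp add: K_def)
    fix n e
    have z: "edge_sq (len e) (\<lambda>t. 0) = 0" by (simp add: edge_sq_def)
    have "edge_sq (len e) (\<lambda>t. trial n (e, t)) \<le> ennreal (K1\<^sup>2 * len e)"
      using trial len_pos[of e] by (intro edge_sq_le_const power_mono) auto
    also have "K1\<^sup>2 * len e \<le> K" unfolding K_def using l_le[of e] len_pos[of e] by (intro mult_mono) auto
    finally have 1: "edge_sq (len e) (\<lambda>t. trial n (e, t)) \<le> ennreal K" by (simp add: ennreal_leI)
    show "edge_sq (len e) (\<lambda>t. trial n (e, t)) \<le> ennreal (K * (ind n (edge_source e) + ind n (edge_target e)))"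
    proof (cases "ind n (edge_source e) = 0 \<and> ind n (edge_target e) = 0")
      case True
      then show ?thesis by (simp add: trial_def cut_def jump_def z)
    next
      case False
      then have "1 \<le> ind n (edge_source e) + ind n (edge_target e)"
        using ind01[of n "edge_source e"] ind01[of n "edge_target e"] by auto
      then have "K * 1 \<le> K * (ind n (edge_source e) + ind n (edge_target e))" by (intro mult_left_mono K0)
      with 1 show ?thesis by (simp add: order_trans[OF _ ennreal_leI])
    qed
    have "edge_sq (len e) (\<lambda>t. defect n (e, t)) \<le> ennreal (K2\<^sup>2 * len e)"
      using defect len_pos[of e] by (intro edge_sq_le_const power_mono) auto
    also have "K2\<^sup>2 * len e \<le> K" unfolding K_def using l_le[of e] len_pos[of e] by (intro mult_mono) auto
    finally have 2: "edge_sq (len e) (\<lambda>t. defect n (e, t)) \<le> ennreal K" by (simp add: ennreal_leI)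
    show "edge_sq (len e) (\<lambda>t. defect n (e, t)) \<le> ennreal (K * \<bar>jump n e\<bar>)"
    proof (cases "jump n e = 0")
      case True
      then show ?thesis by (simp add: defect_def dcut_def ddcut_def z)
    next
      case False
      then have "\<bar>jump n e\<bar> = 1"
        using ind01[of n "edge_source e"] ind01[of n "edge_target e"] by (auto simp: jump_def)
      with 2 show ?thesis by simp
    qed
  qed
qed

lemma finite_box: "finite (box n)"
  by (simp add: box_def)

lemma nn_integral_ennreal_indicator:
  "finite S \<Longrightarrow> (\<integral>\<^sup>+ e. ennreal (indicator S e) \<partial>count_space UNIV) = ennreal (card S)"
  by (simp add: ennreal_indicator emeasure_count_space_finite ennreal_of_nat_eq_real_of_nat)

lemma nn_integral_ind_source:
  "(\<integral>\<^sup>+ e. ennreal (ind n (edge_source e)) \<partial>count_space UNIV) < \<infinity>"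
  unfolding ind_def nn_integral_edges by (simp add: nn_integral_ennreal_indicator finite_box)

lemma nn_integral_ind_target:
  "(\<integral>\<^sup>+ e. ennreal (ind n (edge_target e)) \<partial>count_space UNIV) < \<infinity>"
  unfolding ind_def nn_integral_edges edge_target_plus
  by (simp add: nn_integral_ennreal_indicator finite_box nn_integral_count_space_shift[of "\<lambda>v. ennreal (indicator (box n) v)"])

text \<open>Perimeter count: the box has four sides, each crossed by n + 1 edges.\<close>

lemma nn_integral_jump: "(\<integral>\<^sup>+ e. ennreal \<bar>jump n e\<bar> \<partial>count_space UNIV) \<le> ennreal (4 * (n + 1))"
proof -
  \<comment> \<open>Edges are named by their sources, so an edge entering the box from the left or
    from below has coordinate -1, and one leaving it on the opposite side has coordinate n.\<close>
  define S where "S = Hor ` ({-1, int n} \<times> {0..int n}) \<union> Ver ` ({0..int n} \<times> {-1, int n})"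
  have "\<bar>jump n e\<bar> \<le> indicator S e" for e
  proof (cases e)
    case (Hor v)
    then show ?thesis by (cases v) (auto simp: jump_def ind_def box_def S_def indicator_def)
  next
    case (Ver v)
    then show ?thesis by (cases v) (auto simp: jump_def ind_def box_def S_def indicator_def)
  qed
  then have "(\<integral>\<^sup>+ e. ennreal \<bar>jump n e\<bar> \<partial>count_space UNIV) \<le> (\<integral>\<^sup>+ e. ennreal (indicator S e) \<partial>count_space UNIV)"
    by (intro nn_integral_mono ennreal_leI)
  also have "\<dots> = ennreal (card S)"
    by (rule nn_integral_ennreal_indicator) (simp add: S_def)
  also have "\<dots> \<le> ennreal (4 * (n + 1))"
  proof -
    have "card S \<le> card ({-1, int n} \<times> {0..int n}) + card ({0..int n} \<times> {-1, int n})"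
      unfolding S_def by (intro order_trans[OF card_Un_le] add_mono card_image_le) auto
    also have "\<dots> \<le> 2 * (n + 1) + (n + 1) * 2" by (simp add: card_cartesian_product card_insert_if)
    finally show ?thesis by (intro ennreal_leI) (simp add: of_nat_le_iff[of "card S", where 'a = real, symmetric] del: of_nat_le_iff)
  qed
  finally show ?thesis .
qed

lemma graph_sq_trial_ge:
  "ennreal ((real n)\<^sup>2) * (edge_sq a (wave (Hor v)) + edge_sq b (wave (Ver v))) \<le> graph_sq a b (trial n)"
proof -
  \<comment> \<open>Smaller than the box by one row and one column, so that edges starting in
    \<open>S\<close> also end in the box and carry the untruncated wave.\<close>
  define S :: "vertex set" where "S = {0..<int n} \<times> {0..<int n}"
  have S: "finite S" "card S = n\<^sup>2" by (auto simp: S_def card_cartesian_product power2_eq_square)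
  have *: "edge_sq (len e) (wave e) * indicator S (edge_source e) \<le> edge_sq (len e) (\<lambda>t. trial n (e, t))" for e
  proof (cases "edge_source e \<in> S")
    case True
    have ind: "ind n (edge_source e) = 1" "ind n (edge_target e) = 1"
      using True by (cases e; cases "edge_source e"; auto simp: ind_def box_def S_def indicator_def)+
    have "edge_sq (len e) (\<lambda>t. trial n (e, t)) = edge_sq (len e) (wave e)"
      by (simp add: edge_sq_def trial_def cut_def jump_def ind norm_mult)
    then show ?thesis using True by simp
  qed simp
  define X Y where "X = edge_sq a (wave (Hor v))" and "Y = edge_sq b (wave (Ver v))"
  have w: "edge_sq a (wave (Hor v')) = X" "edge_sq b (wave (Ver v')) = Y" for v'
    by (simp_all add: wave_def[abs_def] X_def Y_def)
  have "(\<integral>\<^sup>+ e. edge_sq (len e) (wave e) * indicator S (edge_source e) \<partial>count_space UNIV) \<le> graph_sq a b (trial n)"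
    unfolding graph_sq_def by (intro nn_integral_mono *)
  moreover have "(\<integral>\<^sup>+ e. edge_sq (len e) (wave e) * indicator S (edge_source e) \<partial>count_space UNIV)
    = ennreal ((real n)\<^sup>2) * (edge_sq a (wave (Hor v)) + edge_sq b (wave (Ver v)))"
  proof -
    have "(\<integral>\<^sup>+ v. X * indicator S v \<partial>count_space UNIV) = ennreal ((real n)\<^sup>2) * X" for X
      using S by (subst nn_integral_cmult_indicator)
        (simp_all add: emeasure_count_space_finite ennreal_of_nat_eq_real_of_nat mult.commute)
    then show ?thesis unfolding nn_integral_edges edge_length.simps edge_source.simps w distrib_left by simp
  qed
  ultimately show ?thesis by simp
qed

text \<open>The derivative of \<open>cut\<close> vanishes at the vertices, so all four edges at
  \<open>v\<close> carry the common factor \<open>phase v * ind n v\<close>. An arriving edge has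
  the phase of its source, which is that of \<open>v\<close> divided by its multiplier; what remains
  is \<open>kirchhoff\<close>.\<close>

lemma trial_vertex_condition:
  "(\<Sum>e | edge_source e = v. dtrial n e 0) + (\<Sum>e | edge_target e = v. - dtrial n e (len e))
     = u * (phase v * ind n v * A)"
proof -
  have "w1 \<noteq> 0" "w2 \<noteq> 0" using w1 w2 by auto
  have d0: "dtrial n e 0 = phase (edge_source e) * ind n (edge_source e) * slope e" for e
    by (simp add: dtrial_def cut_ends scaleR_conv_of_real)
  have dl: "dtrial n e (len e) = phase (edge_target e) * ind n (edge_target e) * (dwave e (len e) / mult e)" for e
    using mult_nz[of e] by (simp add: dtrial_def cut_ends scaleR_conv_of_real phase_target)
  have t: "edge_target (Hor (v - (1,0))) = v" "edge_target (Ver (v - (0,1))) = v"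
    by (simp_all add: edge_target_plus)
  have "(\<Sum>e | edge_source e = v. dtrial n e 0) + (\<Sum>e | edge_target e = v. - dtrial n e (len e))
    = phase v * ind n v * (B1 + B2 - dwave (Hor (v - (1,0))) a / w1 - dwave (Ver (v - (0,1))) b / w2)"
    unfolding edge_source_eq edge_target_eq d0 dl by (simp add: t) (simp add: algebra_simps)
  also have "\<dots> = phase v * ind n v * (u * A)" unfolding kirchhoff[symmetric] by (simp add: dwave_def)
  finally show ?thesis by (simp add: ac_simps)
qed

text \<open>Area against perimeter: the squared norm of \<open>trial n\<close> is at least n^2 times
  that of a cell, whereas that of \<open>defect n\<close> grows only linearly in n. A resolvent
  bound with constant \<open>C\<close> would make n bounded.\<close>

lemma not_in_resolvent_set:
  "complex_of_real \<mu> \<notin> resolvent_set (lattice_graph a b) (delta_hamiltonian a b u)"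
proof
  let ?M = "lattice_graph a b" and ?T = "delta_hamiltonian a b u"
  assume "complex_of_real \<mu> \<in> resolvent_set ?M ?T"
  then obtain C where C: "\<And>f h. (f, h) \<in> ?T \<Longrightarrow> L2_norm ?M f \<le> C * L2_norm ?M (\<lambda>x. h x - complex_of_real \<mu> * f x)"
    unfolding resolvent_set_def by blast
  obtain K where K: "0 \<le> K"
    "\<And>n e. edge_sq (len e) (\<lambda>t. trial n (e, t)) \<le> ennreal (K * (ind n (edge_source e) + ind n (edge_target e)))"
    "\<And>n e. edge_sq (len e) (\<lambda>t. defect n (e, t)) \<le> ennreal (K * \<bar>jump n e\<bar>)"
    using edge_bounds by metis
  define h where "h n x = defect n x + \<mu> * trial n x" for n x
  have i0: "0 \<le> ind n v" for n v by (simp add: ind_def)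
  have tf: "graph_sq a b (trial n) < \<infinity>" for n
  proof -
    have "graph_sq a b (trial n) \<le> (\<integral>\<^sup>+ e. ennreal K * (ennreal (ind n (edge_source e)) + ennreal (ind n (edge_target e))) \<partial>count_space UNIV)"
      unfolding graph_sq_def using K(1,2) i0
      by (intro nn_integral_mono) (simp add: ennreal_mult[symmetric] ennreal_plus[symmetric] del: ennreal_plus)
    also have "\<dots> < \<infinity>"
      using nn_integral_ind_source[of n] nn_integral_ind_target[of n]
      by (simp add: nn_integral_cmult nn_integral_add ennreal_mult_less_top)
    finally show ?thesis .
  qed
  have df: "graph_sq a b (defect n) \<le> ennreal (K * (4 * (n + 1)))" for n
  proof -
    have "graph_sq a b (defect n) \<le> (\<integral>\<^sup>+ e. ennreal K * ennreal \<bar>jump n e\<bar> \<partial>count_space UNIV)"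
      unfolding graph_sq_def using K(1,3) by (intro nn_integral_mono) (simp add: ennreal_mult[symmetric])
    also have "\<dots> \<le> ennreal K * ennreal (4 * (n + 1))"
      by (simp only: nn_integral_cmult borel_measurable_count_space) (intro mult_left_mono nn_integral_jump; simp)
    finally show ?thesis using K(1) by (simp add: ennreal_mult)
  qed
  have dfin: "graph_sq a b (defect n) < \<infinity>" for n using df[of n] order.strict_trans1 by fastforce
  note L = continuous_edge_L2[OF continuous_trial(1)] continuous_edge_L2[OF continuous_trial(2)]
  have tL: "trial n \<in> L2 ?M" for n
    using L(1) tf[of n] by (auto simp: graph_L2_iff edge_L2_def)
  have dL: "defect n \<in> L2 ?M" for n
    using L(2) dfin[of n] by (auto simp: graph_L2_iff edge_L2_def)
  have hL: "h n \<in> L2 ?M" for n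
  proof -
    have eL: "edge_L2 (len e) (\<lambda>t. h n (e, t))" for e
      unfolding h_def by (rule edge_L2_add[OF L(2) L(1)])
    have "graph_sq a b (h n) \<le> (\<integral>\<^sup>+ e. ennreal 2 * edge_sq (len e) (\<lambda>t. defect n (e, t)) + ennreal (2 * \<mu>\<^sup>2) * edge_sq (len e) (\<lambda>t. trial n (e, t)) \<partial>count_space UNIV)"
      unfolding graph_sq_def
    proof (rule nn_integral_mono)
      fix e
      show "edge_sq (len e) (\<lambda>t. h n (e, t)) \<le> ennreal 2 * edge_sq (len e) (\<lambda>t. defect n (e, t)) + ennreal (2 * \<mu>\<^sup>2) * edge_sq (len e) (\<lambda>t. trial n (e, t))"
        using edge_L2_lincomb(2)[OF L(2)[of "len e" n e] L(1)[of "len e" n e], of 1 "of_real \<mu>"] by (simp add: h_def)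
    qed
    also have "\<dots> = ennreal 2 * graph_sq a b (defect n) + ennreal (2 * \<mu>\<^sup>2) * graph_sq a b (trial n)"
      by (simp add: nn_integral_add nn_integral_cmult graph_sq_def)
    also have "\<dots> < \<infinity>" using tf[of n] dfin[of n] by (auto simp: ennreal_mult_less_top)
    finally show ?thesis using eL by (auto simp: graph_L2_iff edge_L2_def)
  qed
  have T: "(trial n, h n) \<in> ?T" for n
    unfolding delta_hamiltonian_def
  proof (clarsimp, intro conjI tL hL exI[of _ "dtrial n"] exI[of _ "\<lambda>v. phase v * ind n v * A"] allI)
    fix e
    show "sobolev_H2 (len e) (\<lambda>t. trial n (e, t)) (dtrial n e) (\<lambda>t. - h n (e, t))"
      unfolding h_def by (rule trial_sobolev)
    show "trial n (e, 0) = phase (edge_source e) * ind n (edge_source e) * A"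
      by (simp add: trial_def cut_ends scaleR_conv_of_real)
    show "trial n (e, len e) = phase (edge_target e) * ind n (edge_target e) * A"
      by (simp add: trial_def cut_ends scaleR_conv_of_real wave_len phase_target)
  next
    fix v
    show "(\<Sum>e | edge_source e = v. dtrial n e 0) + (\<Sum>e | edge_target e = v. - dtrial n e (len e))
      = complex_of_real u * (phase v * ind n v * A)"
      by (rule trial_vertex_condition)
  qed
  define \<kappa> where "\<kappa> = enn2real (edge_sq a (wave (Hor 0)) + edge_sq b (wave (Ver 0)))"
  have fin: "edge_sq a (wave (Hor 0)) + edge_sq b (wave (Ver 0)) < \<infinity>"
    using continuous_edge_L2[OF continuous_wave] by (simp add: edge_L2_def)
  have \<kappa>: "0 < \<kappa>" unfolding \<kappa>_def using wave_positive[of 0] fin by (simp add: enn2real_positive_iff)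
  have \<kappa>e: "edge_sq a (wave (Hor 0)) + edge_sq b (wave (Ver 0)) = ennreal \<kappa>"
    unfolding \<kappa>_def using fin by simp
  have main: "real n * \<kappa> \<le> C\<^sup>2 * (K * 8)" if "0 < n" for n
  proof -
    have "L2_norm ?M (trial n) \<le> C * L2_norm ?M (\<lambda>x. h n x - \<mu> * trial n x)" by (rule C[OF T])
    also have "(\<lambda>x. h n x - \<mu> * trial n x) = defect n" by (auto simp: h_def)
    finally have "sqrt (enn2real (graph_sq a b (trial n))) \<le> C * sqrt (enn2real (graph_sq a b (defect n)))"
      using tL[of n] dL[of n] by (simp add: L2_norm_graph L2_def)
    then have "(sqrt (enn2real (graph_sq a b (trial n))))\<^sup>2 \<le> (C * sqrt (enn2real (graph_sq a b (defect n))))\<^sup>2"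
      by (intro power_mono) auto
    then have 1: "enn2real (graph_sq a b (trial n)) \<le> C\<^sup>2 * enn2real (graph_sq a b (defect n))"
      by (simp add: power_mult_distrib)
    have "ennreal ((real n)\<^sup>2 * \<kappa>) \<le> graph_sq a b (trial n)"
      using graph_sq_trial_ge[of n 0] unfolding \<kappa>e using \<kappa> by (simp add: ennreal_mult)
    also have "\<dots> = ennreal (enn2real (graph_sq a b (trial n)))" using tf[of n] by simp
    finally have 2: "(real n)\<^sup>2 * \<kappa> \<le> enn2real (graph_sq a b (trial n))" by (simp add: ennreal_le_iff)
    have 3: "enn2real (graph_sq a b (defect n)) \<le> K * (4 * (n + 1))"
      using df[of n] K(1) by (intro enn2real_leI) auto
    have "(real n)\<^sup>2 * \<kappa> \<le> C\<^sup>2 * (K * (4 * (n + 1)))"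
      using 1 2 mult_left_mono[OF 3, of "C\<^sup>2"] by (smt (verit) zero_le_power2)
    also have "\<dots> \<le> C\<^sup>2 * (K * (8 * n))"
      using that K(1) by (intro mult_left_mono) auto
    finally have "real n * (real n * \<kappa>) \<le> real n * (C\<^sup>2 * (K * 8))" by (simp add: power2_eq_square ac_simps)
    then show ?thesis using that by simp
  qed
  obtain N :: nat where "C\<^sup>2 * (K * 8) / \<kappa> < real N" using reals_Archimedean2 by blast
  then have "C\<^sup>2 * (K * 8) < real N * \<kappa>" using \<kappa> by (simp add: field_simps)
  moreover have "0 \<le> C\<^sup>2 * (K * 8) / \<kappa>" using K(1) \<kappa> by simp
  ultimately show False using main[of N] \<open>C\<^sup>2 * (K * 8) / \<kappa> < real N\<close> by (cases N) auto
qed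

end

section \<open>Bloch waves where the gap condition fails\<close>

lemma bloch_wave_coefficients:
  fixes c s \<mu> :: real and w :: complex
  assumes s: "s \<noteq> 0" and w: "w \<noteq> 0" and e: "c\<^sup>2 + \<mu> * s\<^sup>2 = 1"
  defines "B \<equiv> (w - c) / s"
  shows "c *\<^sub>R 1 + s *\<^sub>R B = w * 1"
    and "B - (c *\<^sub>R B - (\<mu> * s) *\<^sub>R 1) / w = (w + 1 / w) / s - 2 * c / s"
proof -
  show "c *\<^sub>R 1 + s *\<^sub>R B = w * 1" using s by (simp add: B_def scaleR_conv_of_real)
  have "complex_of_real (c\<^sup>2 + \<mu> * s\<^sup>2) = 1" by (simp only: e of_real_1)
  then have *: "complex_of_real c * c + \<mu> * (s * s) = 1" by (simp add: power2_eq_square)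
  \<comment> \<open>Divided by \<open>w\<close>, the outward derivative at the far end becomes
    \<open>(1 / w - c) / s\<close>, the near slope with \<open>1 / w\<close> in place of
    \<open>w\<close>.\<close>
  have "c *\<^sub>R B - (\<mu> * s) *\<^sub>R 1 = (c * w - (complex_of_real c * c + \<mu> * (s * s))) / s"
    using s by (simp add: B_def scaleR_conv_of_real field_simps)
  then have "B - (c *\<^sub>R B - (\<mu> * s) *\<^sub>R 1) / w = (w - c) / s - (c * w - 1) / s / w"
    unfolding * by (simp only: B_def)
  then show "B - (c *\<^sub>R B - (\<mu> * s) *\<^sub>R 1) / w = (w + 1 / w) / s - 2 * c / s"
    using s w by (simp add: field_simps)
qed

lemma sn_cs_nonpos:
  assumes "\<mu> \<le> 0" "0 < l"
  shows "0 < sn \<mu> l" "1 \<le> cs \<mu> l"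
  using assms by (auto simp: sn_def cs_def cosh_real_ge_1)

text \<open>Here \<open>cs \<ge> 1\<close> and \<open>sn > 0\<close>, so each cotangent term already
  matches the corresponding reciprocal; the positive \<open>u\<close> makes the inequality
  strict.\<close>

lemma gapcond_nonpos:
  assumes "0 < a" "0 < b" "0 < u" "\<mu> \<le> 0"
  shows "gapcond a b u \<mu>"
proof -
  have *: "2 / \<bar>sn \<mu> l\<bar> \<le> 2 * cs \<mu> l / sn \<mu> l" "sn \<mu> l \<noteq> 0" if "0 < l" for l
    using sn_cs_nonpos[OF assms(4) that] by (auto simp: divide_right_mono)
  show ?thesis unfolding gapcond_def using *[of a] *[of b] assms by (intro conjI) (auto; linarith)+
qed

text \<open>If both \<open>sn\<close> are nonzero, a wave with value 1 at the origin satisfies the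
  vertex condition exactly when the terms \<open>(w + 1 / w) / sn\<close> of the two directions add
  up to \<open>D\<close>. With unimodular multipliers this sum attains every value between
  \<open>- L\<close> and \<open>L\<close>.\<close>

lemma spectrum_if_not_gapcond:
  assumes a: "0 < a" and b: "0 < b" and u: "0 < u" and ng: "\<not> gapcond a b u \<mu>"
  shows "complex_of_real \<mu> \<notin> resolvent_set (lattice_graph a b) (delta_hamiltonian a b u)"
proof -
  have \<mu>: "0 < \<mu>" using gapcond_nonpos[OF a b u] ng not_le by blast
  have cs1: "cs \<mu> l = 1 \<or> cs \<mu> l = -1" if "sn \<mu> l = 0" for l
    using cs_sn_sq[of \<mu> l] that by (simp add: power2_eq_1_iff)
  consider "sn \<mu> a = 0" | "sn \<mu> b = 0" | "sn \<mu> a \<noteq> 0" "sn \<mu> b \<noteq> 0" by blast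
  then show ?thesis
  proof cases
    \<comment> \<open>A Dirichlet eigenfunction along a single direction, vanishing at all vertices.\<close>
    case 1
    have "bloch_wave a b u \<mu> (cs \<mu> a) 1 0 1 0"
      using a b cs1[OF 1] 1 by unfold_locales (auto simp: scaleR_conv_of_real)
    then show ?thesis by (rule bloch_wave.not_in_resolvent_set)
  next
    case 2
    have "bloch_wave a b u \<mu> 1 (cs \<mu> b) 0 0 1"
      using a b cs1[OF 2] 2 by unfold_locales (auto simp: scaleR_conv_of_real)
    then show ?thesis by (rule bloch_wave.not_in_resolvent_set)
  next
    case 3
    define D where "D = u + 2 * cs \<mu> a / sn \<mu> a + 2 * cs \<mu> b / sn \<mu> b"
    define L where "L = 2 / \<bar>sn \<mu> a\<bar> + 2 / \<bar>sn \<mu> b\<bar>"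
    \<comment> \<open>The Bloch phases are \<open>\<plusminus>\<omega>\<close> with \<open>Re \<omega> = D / L\<close>.\<close>
    have L: "0 < L" unfolding L_def using 3 by (intro add_pos_pos) auto
    have "D \<le> L" using ng 3 by (simp add: gapcond_def D_def L_def)
    have cs_ge: "- (2 / \<bar>sn \<mu> l\<bar>) \<le> 2 * cs \<mu> l / sn \<mu> l" for l
    proof -
      have "(cs \<mu> l)\<^sup>2 \<le> 1" using cs_sn_sq[of \<mu> l] \<mu> by (smt (verit) mult_nonneg_nonneg zero_le_power2)
      then have "\<bar>cs \<mu> l\<bar> \<le> 1" by (simp add: abs_square_le_1)
      then have "\<bar>2 * cs \<mu> l / sn \<mu> l\<bar> \<le> 2 / \<bar>sn \<mu> l\<bar>"
        by (simp add: abs_mult divide_right_mono)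
      then show ?thesis by linarith
    qed
    \<comment> \<open>The lower bound uses that the potential is repulsive; the upper one is the
      failure of the gap condition.\<close>
    have "- L \<le> D" unfolding L_def D_def using cs_ge[of a] cs_ge[of b] u by linarith
    define t where "t = D / L"
    have t: "\<bar>t\<bar> \<le> 1" using \<open>D \<le> L\<close> \<open>- L \<le> D\<close> L by (simp add: t_def abs_le_iff field_simps)
    then have t2: "t\<^sup>2 \<le> 1" by (simp add: abs_square_le_1)
    define \<omega> where "\<omega> = Complex t (sqrt (1 - t\<^sup>2))"
    have \<omega>: "cmod \<omega> = 1" using t2 by (simp add: \<omega>_def cmod_def)
    then have \<omega>0: "\<omega> \<noteq> 0" by auto
    have "1 / \<omega> = cnj \<omega>" using complex_norm_square[of \<omega>] \<omega> \<omega>0 by (simp add: field_simps)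
    then have sum: "\<omega> + 1 / \<omega> = 2 * t" by (simp add: complex_eq_iff \<omega>_def)
    \<comment> \<open>The sign replaces \<open>sn\<close> by its absolute value in the vertex
      condition, so the two directions together contribute \<open>t * L\<close>.\<close>
    define w where "w l = sgn (sn \<mu> l) * \<omega>" for l
    have sg: "sgn (sn \<mu> l) = 1 \<or> sgn (sn \<mu> l) = -1" if "sn \<mu> l \<noteq> 0" for l using that by (auto simp: sgn_real_def)
    have w: "cmod (w l) = 1" "w l \<noteq> 0" "(w l + 1 / w l) / sn \<mu> l = 2 * t / \<bar>sn \<mu> l\<bar>" if "sn \<mu> l \<noteq> 0" for l
    proof -
      show 1: "cmod (w l) = 1" using sg[OF that] \<omega> by (auto simp: w_def norm_mult)
      then show "w l \<noteq> 0" by auto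
      have "w l + 1 / w l = sgn (sn \<mu> l) * (\<omega> + 1 / \<omega>)"
        using sg[OF that] by (auto simp: w_def)
      then show "(w l + 1 / w l) / sn \<mu> l = 2 * t / \<bar>sn \<mu> l\<bar>"
        using that unfolding sum by (auto simp: sgn_real_def abs_if)
    qed
    define B where "B l = (w l - cs \<mu> l) / sn \<mu> l" for l
    have co: "cs \<mu> l *\<^sub>R 1 + sn \<mu> l *\<^sub>R B l = w l * 1"
      "B l - (cs \<mu> l *\<^sub>R B l - (\<mu> * sn \<mu> l) *\<^sub>R 1) / w l = (w l + 1 / w l) / sn \<mu> l - 2 * cs \<mu> l / sn \<mu> l"
      if "sn \<mu> l \<noteq> 0" for l
      using bloch_wave_coefficients[OF that w(2)[OF that] cs_sn_sq] by (simp_all only: B_def)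
    have kir: "B a + B b - (cs \<mu> a *\<^sub>R B a - (\<mu> * sn \<mu> a) *\<^sub>R 1) / w a - (cs \<mu> b *\<^sub>R B b - (\<mu> * sn \<mu> b) *\<^sub>R 1) / w b = u * 1"
    proof -
      have "B a + B b - (cs \<mu> a *\<^sub>R B a - (\<mu> * sn \<mu> a) *\<^sub>R 1) / w a - (cs \<mu> b *\<^sub>R B b - (\<mu> * sn \<mu> b) *\<^sub>R 1) / w b
        = ((w a + 1 / w a) / sn \<mu> a - 2 * cs \<mu> a / sn \<mu> a) + ((w b + 1 / w b) / sn \<mu> b - 2 * cs \<mu> b / sn \<mu> b)"
        unfolding co(2)[OF 3(1), symmetric] co(2)[OF 3(2), symmetric] by simp
      also have "\<dots> = complex_of_real (t * L - (D - u))"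
        unfolding w(3)[OF 3(1)] w(3)[OF 3(2)] by (simp add: L_def D_def algebra_simps)
      also have "t * L - (D - u) = u" using L by (simp add: t_def)
      finally show ?thesis by simp
    qed
    have "bloch_wave a b u \<mu> (w a) (w b) 1 (B a) (B b)"
      using a b w(1)[OF 3(1)] w(1)[OF 3(2)] co(1)[OF 3(1)] co(1)[OF 3(2)] kir
      by unfold_locales auto
    then show ?thesis by (rule bloch_wave.not_in_resolvent_set)
  qed
qed

lemma not_spectrum_iff_gapcond:
  assumes "0 < a" "0 < b" "0 < u"
  shows "complex_of_real \<mu> \<notin> spectrum (lattice_graph a b) (delta_hamiltonian a b u) \<longleftrightarrow> gapcond a b u \<mu>"
  using spectrum_if_not_gapcond[OF assms] spectral_gap_point.in_resolvent_set[of a b u \<mu>] assms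
  by (auto simp: spectrum_def spectral_gap_point_def)

section \<open>Best approximations and gaps\<close>

text \<open>Up to the factor \<open>2 * k\<close>, what one direction contributes to the difference
  of the two sides of \<open>gapcond\<close>. It has period pi and equals tan(x/2) on (0,
  pi).\<close>

definition cot_gap :: "real \<Rightarrow> real" where "cot_gap x = 1 / \<bar>sin x\<bar> - cos x / sin x"

lemma gapcond_square_iff:
  assumes "0 < k"
  shows "gapcond a b u (k\<^sup>2) \<longleftrightarrow>
    sin (k * a) \<noteq> 0 \<and> sin (k * b) \<noteq> 0 \<and> 2 * k * (cot_gap (k * a) + cot_gap (k * b)) < u"
proof -
  have sn: "sn (k\<^sup>2) l = sin (k * l) / k" and cs: "cs (k\<^sup>2) l = cos (k * l)" for l
    using assms by (auto simp: sn_def cs_def)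
  have "2 / \<bar>sn (k\<^sup>2) l\<bar> - 2 * cs (k\<^sup>2) l / sn (k\<^sup>2) l = 2 * k * cot_gap (k * l)" for l
    using assms by (simp add: sn cs cot_gap_def right_diff_distrib)
  from this[of a] this[of b] show ?thesis
    unfolding gapcond_def using assms by (auto simp: sn distrib_left)
qed

lemma gapcond_commute: "gapcond a b u \<mu> \<longleftrightarrow> gapcond b a u \<mu>"
  by (auto simp: gapcond_def algebra_simps)

lemma cot_gap_plus_pi: "cot_gap (x + pi) = cot_gap x" by (simp add: cot_gap_def)

lemma cot_gap_plus_nat_pi: "cot_gap (x + real n * pi) = cot_gap x"
proof (induction n)
  case (Suc n)
  have "cot_gap (x + real (Suc n) * pi) = cot_gap ((x + real n * pi) + pi)" by (simp add: algebra_simps)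
  then show ?case using Suc by (simp only: cot_gap_plus_pi)
qed simp

lemma cot_gap_plus_int_pi: "cot_gap (x + of_int m * pi) = cot_gap x"
proof (cases "0 \<le> m")
  case True
  then show ?thesis using cot_gap_plus_nat_pi[of x "nat m"] by simp
next
  case False
  then show ?thesis using cot_gap_plus_nat_pi[of "x + of_int m * pi" "nat (- m)"] by simp
qed

lemma cot_gap_eq_tan:
  assumes "0 < x" "x < pi"
  shows "cot_gap x = tan (x / 2)"
proof -
  have s: "0 < sin (x / 2)" "0 < cos (x / 2)" using assms by (auto intro!: sin_gt_zero cos_gt_zero)
  have "sin x = 2 * sin (x / 2) * cos (x / 2)" "cos x = 1 - 2 * (sin (x / 2))\<^sup>2"
    using sin_double[of "x / 2"] cos_double_sin[of "x / 2"] by auto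
  moreover have "0 < sin x" using assms by (rule sin_gt_zero)
  then have "cot_gap x = (1 - cos x) / sin x" by (simp add: cot_gap_def diff_divide_distrib)
  ultimately show ?thesis using s by (simp add: tan_def power2_eq_square)
qed

lemma le_tan:
  fixes x :: real
  assumes "0 \<le> x" "x < pi / 2"
  shows "x \<le> tan x"
proof -
  \<comment> \<open>The function sin x - x cos x has derivative x sin x, which is nonnegative
    here.\<close>
  have "sin 0 - 0 * cos 0 \<le> sin x - x * cos x"
  proof (rule DERIV_nonneg_imp_nondecreasing[OF assms(1)])
    fix y assume y: "0 \<le> y" "y \<le> x"
    have "((\<lambda>x. sin x - x * cos x) has_real_derivative y * sin y) (at y)"
      by (auto intro!: derivative_eq_intros)
    moreover have "0 \<le> y * sin y" using y assms by (intro mult_nonneg_nonneg sin_ge_zero) auto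
    ultimately show "\<exists>d. ((\<lambda>x. sin x - x * cos x) has_real_derivative d) (at y) \<and> 0 \<le> d" by blast
  qed
  moreover have "0 < cos x" using assms by (intro cos_gt_zero_pi) auto
  ultimately show ?thesis by (simp add: tan_def field_simps)
qed

lemma sin_nonzero_interval:
  assumes "sin x \<noteq> 0"
  defines "n \<equiv> \<lfloor>x / pi\<rfloor>"
  shows "0 < x - of_int n * pi" "x - of_int n * pi < pi"
proof -
  have "of_int n \<le> x / pi" "x / pi < of_int n + 1" unfolding n_def by linarith+
  then have *: "of_int n * pi \<le> x" "x < (of_int n + 1) * pi" by (auto simp: field_simps)
  moreover have "x \<noteq> of_int n * pi" using assms(1) by (auto simp: sin_zero_iff_int2)
  ultimately show "0 < x - of_int n * pi" "x - of_int n * pi < pi" by (auto simp: algebra_simps)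
qed

lemma best_lower_third_denominator:
  assumes "best_lower_third \<theta> p q"
  shows "p = \<lfloor>\<theta> * real q\<rfloor> \<or> real_of_int p / real q = \<lfloor>\<theta>\<rfloor>"
proof (rule disjCI)
  assume ne: "real_of_int p / real q \<noteq> \<lfloor>\<theta>\<rfloor>"
  have q: "0 < q" and ge: "0 \<le> (real q)\<^sup>2 * (\<theta> - real_of_int p / real q)"
    and best: "\<And>(p'::int) (q'::nat). 0 < q' \<and> q' \<le> q \<and> real_of_int p' / real q' \<le> \<theta> \<and> real_of_int p' / real q' \<noteq> real_of_int p / real q
        \<Longrightarrow> (real q)\<^sup>2 * (\<theta> - real_of_int p / real q) < (real q')\<^sup>2 * (\<theta> - real_of_int p' / real q')"
    using assms unfolding best_lower_third_def by blast+
  have e: "(real q)\<^sup>2 * (\<theta> - real_of_int p / real q) = real q * (\<theta> * real q - p)"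
    using q by (simp add: power2_eq_square field_simps)
  have "real q * (\<theta> * real q - p) < \<theta> - \<lfloor>\<theta>\<rfloor>"
    using best[of 1 "\<lfloor>\<theta>\<rfloor>"] ne q unfolding e by (simp add: of_int_floor_le)
  also have "\<dots> < 1" by linarith
  also have "1 \<le> real q" using q by simp
  finally have "real q * (\<theta> * real q - p) < real q * 1" by simp
  then have "\<theta> * real q - p < 1" using q by simp
  moreover have "0 \<le> \<theta> * real q - p" using ge q unfolding e by (simp add: zero_le_mult_iff)
  ultimately show "p = \<lfloor>\<theta> * real q\<rfloor>" by linarith
qed

text \<open>Since denominators determine numerators up to one exceptional value, only finitely many
  of the fractions have a denominator below \<open>max N n\<close>. The bound
  \<open>n \<le> q\<close> makes \<open>m / n\<close> an admissible competitor, and excluding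
  \<open>m / n\<close> itself makes the comparison strict.\<close>

lemma best_lower_third_large:
  assumes inf: "infinite (best_lower_thirds \<theta>)" and n: "0 < n" and le: "real_of_int m / real n \<le> \<theta>"
  obtains p q where "N \<le> q" "0 < q" "0 \<le> real q * (\<theta> * real q - of_int p)"
    "real q * (\<theta> * real q - of_int p) < real n * (\<theta> * real n - of_int m)"
proof -
  let ?F = "insert (real_of_int \<lfloor>\<theta>\<rfloor>) (insert (real_of_int m / real n) ((\<lambda>q. real_of_int \<lfloor>\<theta> * real q\<rfloor> / real q) ` {..<max N n}))"
  have "\<not> best_lower_thirds \<theta> \<subseteq> ?F" using inf finite_subset by blast
  then obtain p q where b: "best_lower_third \<theta> p q" and x: "real_of_int p / real q \<notin> ?F"
    unfolding best_lower_thirds_def by blast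
  have "p = \<lfloor>\<theta> * real q\<rfloor>" using best_lower_third_denominator[OF b] x by auto
  then have q: "max N n \<le> q" using x by (meson imageI insertCI lessThan_iff not_le)
  have q0: "0 < q" and ge: "0 \<le> (real q)\<^sup>2 * (\<theta> - real_of_int p / real q)"
    using b unfolding best_lower_third_def by blast+
  have lt: "(real q)\<^sup>2 * (\<theta> - real_of_int p / real q) < (real n)\<^sup>2 * (\<theta> - real_of_int m / real n)"
    using b x n le q unfolding best_lower_third_def by auto
  have e: "(real q)\<^sup>2 * (\<theta> - real_of_int p / real q) = real q * (\<theta> * real q - p)" if "0 < q" for p q
    using that by (simp add: power2_eq_square field_simps)
  show thesis
    by (rule that[of q p]) (use q q0 ge lt e[OF q0] e[OF n] in auto)
qed

text \<open>The offset 1/q^2 moves k off the Dirichlet point q pi/a and is of smaller order than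
  1/q, so its contribution to k (x + y) tends to 0, where x and y are the residues of ka and kb.
  What survives is at most pi^2 \<delta> / a. The estimate uses only the upper bound for y and is
  therefore uniform in p.\<close>

lemma gapcond_near_fraction:
  assumes a: "0 < a" and b: "0 < b" and \<delta>: "0 < \<delta>" "pi\<^sup>2 * \<delta> < u * a"
  shows "\<forall>\<^sub>F q in sequentially. \<forall>p. 0 \<le> real q * (b / a * real q - of_int p) \<longrightarrow>
      real q * (b / a * real q - of_int p) < \<delta> \<longrightarrow> gapcond a b u ((real q * pi / a + 1 / (real q)\<^sup>2)\<^sup>2)"
proof -
  have "((\<lambda>q::real. 2 * (q * pi / a + 1 / q\<^sup>2) * (tan (a / q\<^sup>2 / 2) + tan ((pi * \<delta> / q + b / q\<^sup>2) / 2))) \<longlongrightarrow> pi * (inverse a * (pi * \<delta>))) at_top"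
    using a b \<delta>(1) by real_asymp
  moreover have "pi * (inverse a * (pi * \<delta>)) < u" using \<delta>(2) a by (simp add: power2_eq_square field_simps)
  ultimately have 1: "\<forall>\<^sub>F q::real in at_top. 2 * (q * pi / a + 1 / q\<^sup>2) * (tan (a / q\<^sup>2 / 2) + tan ((pi * \<delta> / q + b / q\<^sup>2) / 2)) < u"
    by (rule order_tendstoD)
  have 2: "\<forall>\<^sub>F q::real in at_top. pi * \<delta> / q + b / q\<^sup>2 < pi" "\<forall>\<^sub>F q::real in at_top. a / q\<^sup>2 < pi"
    using a b \<delta>(1) by real_asymp+
  have "\<forall>\<^sub>F q::nat in sequentially. 0 < q \<and> 2 * (real q * pi / a + 1 / (real q)\<^sup>2) * (tan (a / (real q)\<^sup>2 / 2) + tan ((pi * \<delta> / real q + b / (real q)\<^sup>2) / 2)) < u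
     \<and> pi * \<delta> / real q + b / (real q)\<^sup>2 < pi \<and> a / (real q)\<^sup>2 < pi"
    using filterlim_real_sequentially[unfolded filterlim_iff, rule_format, OF eventually_conj[OF 1 eventually_conj[OF 2]]]
      eventually_gt_at_top[of 0]
    by eventually_elim auto
  then show ?thesis
  proof eventually_elim
    case (elim q)
    show ?case
    proof (intro allI impI)
      fix p assume p: "0 \<le> real q * (b / a * real q - of_int p)" "real q * (b / a * real q - of_int p) < \<delta>"
      define r where "r = real q"
      have r: "0 < r" using elim by (simp add: r_def)
      define k where "k = r * pi / a + 1 / r\<^sup>2"
      have k: "0 < k" using r a by (simp add: k_def add_pos_pos)
      define x where "x = a / r\<^sup>2"
      define y where "y = pi * (b / a * r - of_int p) + b / r\<^sup>2"
      have ka: "k * a = x + of_int (int q) * pi" using a by (simp add: k_def x_def r_def field_simps)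
      have kb: "k * b = y + of_int p * pi" using a by (simp add: k_def y_def algebra_simps)
      have x: "0 < x" "x < pi" using elim a r by (auto simp: x_def r_def)
      have d: "0 \<le> b / a * r - of_int p" "b / a * r - of_int p \<le> \<delta> / r"
        using p r by (auto simp: r_def[symmetric] zero_le_mult_iff pos_le_divide_eq mult.commute)
      have y0: "0 < y" unfolding y_def using d(1) b r by (intro add_nonneg_pos) auto
      have "pi * (b / a * r - of_int p) \<le> pi * (\<delta> / r)" using d(2) by (intro mult_left_mono) auto
      then have yle: "y \<le> pi * \<delta> / r + b / r\<^sup>2" by (simp add: y_def)
      also have "\<dots> < pi" using elim by (simp add: r_def)
      finally have ypi: "y < pi" .
      have z: "pi * \<delta> / r + b / r\<^sup>2 < pi" using elim by (simp add: r_def)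
      have tan: "tan (y / 2) \<le> tan ((pi * \<delta> / r + b / r\<^sup>2) / 2)"
      proof -
        have "tan (y / 2) \<le> tan (X / 2)" if "0 < y" "y \<le> X" "X < pi" for X
          by (intro tan_mono_le; use that pi_gt_zero in linarith)
        from this[OF y0 yle z] show ?thesis .
      qed
      have sx: "sin (k * a) \<noteq> 0"
      proof -
        have "sin (k * a) = 0 \<longleftrightarrow> sin x = 0" unfolding ka by (simp add: sin_add)
        then show ?thesis using sin_gt_zero[OF x] by simp
      qed
      have sy: "sin (k * b) \<noteq> 0"
      proof -
        have "sin (k * b) = 0 \<longleftrightarrow> sin y = 0" unfolding kb by (simp add: sin_add mult.commute[of _ pi])
        then show ?thesis using sin_gt_zero[OF y0 ypi] by simp
      qed
      have "2 * k * (cot_gap (k * a) + cot_gap (k * b)) = 2 * k * (tan (x / 2) + tan (y / 2))"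
        unfolding ka kb cot_gap_plus_int_pi using x y0 ypi by (simp add: cot_gap_eq_tan)
      also have "\<dots> \<le> 2 * k * (tan (x / 2) + tan ((pi * \<delta> / r + b / r\<^sup>2) / 2))"
        using k tan by (intro mult_left_mono add_left_mono) auto
      also have "\<dots> < u" using elim by (simp add: k_def x_def r_def)
      finally have "gapcond a b u (k\<^sup>2)" using sx sy gapcond_square_iff[OF k] by blast
      then show "gapcond a b u ((real q * pi / a + 1 / (real q)\<^sup>2)\<^sup>2)" by (simp add: k_def r_def)
    qed
  qed
qed

text \<open>Since x and y are positive residues, tan(y/2) \<ge> y/2 and tan(x/2) > 0 reduce the gap
  condition to k y < u. Lowering k to n pi/a turns this into a bound on n^2 (b/a - m/n), which best
  approximations with larger denominators improve strictly.\<close>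

lemma gapcond_unbounded_if_beyond_first_band:
  assumes a: "0 < a" and b: "0 < b" and inf: "infinite (best_lower_thirds (b / a))"
    and k: "0 < k" and gap: "gapcond a b u (k\<^sup>2)"
    and n: "n = \<lfloor>k * a / pi\<rfloor>" "m = \<lfloor>k * b / pi\<rfloor>" "0 < n" "of_int m / b \<le> of_int n / a"
  shows "\<exists>x>R. gapcond a b u x"
proof -
  have g: "sin (k * a) \<noteq> 0" "sin (k * b) \<noteq> 0" "2 * k * (cot_gap (k * a) + cot_gap (k * b)) < u"
    using gap gapcond_square_iff[OF k] by auto
  define x y where "x = k * a - of_int n * pi" and "y = k * b - of_int m * pi"
  have x: "0 < x" "x < pi" and y: "0 < y" "y < pi"
    using sin_nonzero_interval[OF g(1)] sin_nonzero_interval[OF g(2)] n by (auto simp: x_def y_def)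
  have "cot_gap (k * a) = tan (x / 2)" "cot_gap (k * b) = tan (y / 2)"
    using cot_gap_plus_int_pi[of x n] cot_gap_plus_int_pi[of y m] cot_gap_eq_tan[OF x] cot_gap_eq_tan[OF y]
    by (simp_all add: x_def y_def)
  moreover have "0 < tan (x / 2)" using x by (intro tan_gt_zero) auto
  moreover have "y / 2 \<le> tan (y / 2)" using y by (intro le_tan) auto
  ultimately have "y / 2 < cot_gap (k * a) + cot_gap (k * b)" by linarith
  then have "2 * k * (y / 2) < 2 * k * (cot_gap (k * a) + cot_gap (k * b))" using k by (intro mult_strict_left_mono) auto
  with g(3) have ky: "k * y < u" by simp
  define N where "N = nat n"
  have N: "real N = of_int n" "0 < N" using n(3) by (auto simp: N_def)
  \<comment> \<open>The largest point below \<open>k\<close> where ka is a multiple of pi; there kb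
    - m pi equals \<open>pi * d\<close>.\<close>
  define k0 where "k0 = of_int n * pi / a"
  have k0: "0 < k0" "k0 \<le> k" using x(1) a n(3) by (auto simp: k0_def x_def field_simps)
  define d where "d = b / a * real N - of_int m"
  have d0: "0 \<le> d" using n(4) a b unfolding d_def N by (simp add: field_simps)
  have yd: "pi * d \<le> y"
  proof -
    have "k0 * b \<le> k * b" using k0 b by simp
    then show ?thesis using a by (simp add: y_def d_def k0_def N algebra_simps)
  qed
  have "k0 * (pi * d) \<le> k * y" using k0 d0 yd k by (intro mult_mono) auto
  with ky have "k0 * (pi * d) < u" by simp
  then have \<delta>u: "pi\<^sup>2 * (real N * d) < u * a"
    using a by (simp add: k0_def N power2_eq_square field_simps)
  have le: "real_of_int m / real N \<le> b / a" using d0 N(2) a by (simp add: d_def field_simps)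
  \<comment> \<open>Denominators from \<open>Q\<close> on give a wave number of at least
    \<bar>R\<bar> + 1, whose square exceeds \<open>R\<close>.\<close>
  define Q where "Q = nat \<lceil>(\<bar>R\<bar> + 1) * a\<rceil>"
  have Q: "\<And>q. Q \<le> q \<Longrightarrow> (\<bar>R\<bar> + 1) * a \<le> real q" unfolding Q_def by linarith
  \<comment> \<open>Positivity is inherited from the existence of a nonnegative value strictly below
    \<open>real N * d\<close>; in particular \<open>m / N\<close> is not equal to
    \<open>b / a\<close>.\<close>
  have \<delta>0: "0 < real N * d"
    using best_lower_third_large[OF inf N(2) le, of 0] unfolding d_def[symmetric] by (metis order.strict_trans1)
  obtain M where M: "\<And>q p. M \<le> q \<Longrightarrow> 0 \<le> real q * (b / a * real q - of_int p) \<Longrightarrow>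
      real q * (b / a * real q - of_int p) < real N * d \<Longrightarrow> gapcond a b u ((real q * pi / a + 1 / (real q)\<^sup>2)\<^sup>2)"
    using gapcond_near_fraction[OF a b \<delta>0 \<delta>u] unfolding eventually_sequentially by blast
  obtain p q where pq: "max M Q \<le> q" "0 < q" "0 \<le> real q * (b / a * real q - of_int p)"
    "real q * (b / a * real q - of_int p) < real N * d"
    using best_lower_third_large[OF inf N(2) le, of "max M Q"] unfolding d_def by metis
  have "R < (real q * pi / a + 1 / (real q)\<^sup>2)\<^sup>2"
  proof -
    let ?k = "real q * pi / a + 1 / (real q)\<^sup>2"
    have "(\<bar>R\<bar> + 1) * a \<le> real q * 1" using Q pq(1) by simp
    also have "real q * 1 \<le> real q * pi" using pi_gt3 by (intro mult_left_mono) auto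
    finally have "\<bar>R\<bar> + 1 \<le> real q * pi / a" using a by (simp add: field_simps)
    then have k1: "\<bar>R\<bar> + 1 \<le> ?k" by (simp add: add_increasing2)
    then have "?k * 1 \<le> ?k * ?k" by (intro mult_left_mono) auto
    then show ?thesis using k1 by (simp add: power2_eq_square)
  qed
  moreover have "gapcond a b u ((real q * pi / a + 1 / (real q)\<^sup>2)\<^sup>2)" using M pq by simp
  ultimately show ?thesis by blast
qed

text \<open>Below pi there is no reduction modulo pi, and k (tan(ka/2) + tan(kb/2)) increases with
  k, so the condition passes to all smaller energies.\<close>

lemma gapcond_below_first_band:
  assumes a: "0 < a" and b: "0 < b" and u: "0 < u" and k: "0 < k" and gap: "gapcond a b u (k\<^sup>2)"
    and small: "k * a < pi" "k * b < pi" and y: "y \<le> k\<^sup>2"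
  shows "gapcond a b u y"
proof (cases "y \<le> 0")
  case True
  then show ?thesis by (rule gapcond_nonpos[OF a b u])
next
  case False
  define j where "j = sqrt y"
  have j: "0 < j" "j \<le> k" "y = j\<^sup>2" using False y k by (auto simp: j_def real_le_lsqrt)
  have jl: "0 < j * l" "j * l \<le> k * l" if "0 < l" for l using j that by auto
  have t: "tan (j * l / 2) \<le> tan (k * l / 2)" "0 \<le> tan (j * l / 2)" "sin (j * l) \<noteq> 0"
     "cot_gap (j * l) = tan (j * l / 2)" "cot_gap (k * l) = tan (k * l / 2)"
    if l: "0 < l" "k * l < pi" for l
  proof -
    show "tan (j * l / 2) \<le> tan (k * l / 2)" by (intro tan_mono_le; use jl[OF l(1)] l pi_gt_zero in linarith)
    show "0 \<le> tan (j * l / 2)" by (intro tan_pos_pi2_le; use jl[OF l(1)] l in linarith)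
    have "0 < sin (j * l)" by (intro sin_gt_zero; use jl[OF l(1)] l in linarith)
    then show "sin (j * l) \<noteq> 0" by simp
    show "cot_gap (j * l) = tan (j * l / 2)" "cot_gap (k * l) = tan (k * l / 2)"
      by (intro cot_gap_eq_tan; use jl[OF l(1)] l in linarith)+
  qed
  note ta = t[OF a small(1)] and tb = t[OF b small(2)]
  have "2 * j * (cot_gap (j * a) + cot_gap (j * b)) \<le> 2 * k * (cot_gap (k * a) + cot_gap (k * b))"
    unfolding ta(4,5) tb(4,5) using ta(1,2) tb(1,2) j k by (intro mult_mono add_mono) auto
  also have "\<dots> < u" using gap gapcond_square_iff[OF k] by blast
  finally show ?thesis using gapcond_square_iff[OF j(1)] ta(3) tb(3) j(3) by blast
qed

text \<open>The larger of n/a and m/b locates the last Dirichlet point below k and so decides which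
  ratio is approximated. That larger one has a positive numerator because n and m are not both
  0.\<close>

lemma gapcond_unbounded:
  assumes a: "0 < a" and b: "0 < b" and u: "0 < u"
    and inf: "infinite (best_lower_thirds (a / b))" "infinite (best_lower_thirds (b / a))"
    and gap: "gapcond a b u x" and ny: "\<not> {..x} \<subseteq> {y. gapcond a b u y}"
  shows "\<exists>y>R. gapcond a b u y"
proof -
  have x: "0 < x" using ny gapcond_nonpos[OF a b u] by force
  define k where "k = sqrt x"
  have k: "0 < k" "x = k\<^sup>2" using x by (auto simp: k_def)
  have gk: "gapcond a b u (k\<^sup>2)" using gap k by simp
  have gk': "gapcond b a u (k\<^sup>2)" using gk gapcond_commute by simp
  define n m where "n = \<lfloor>k * a / pi\<rfloor>" and "m = \<lfloor>k * b / pi\<rfloor>"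
  have nm0: "0 \<le> n" "0 \<le> m" using k a b by (auto simp: n_def m_def)
  have "\<not> (k * a < pi \<and> k * b < pi)"
    using gapcond_below_first_band[OF a b u k(1) gk] ny k(2) by blast
  then have nm: "0 < n \<or> 0 < m" by (auto simp: n_def m_def le_divide_eq not_less)
  show ?thesis
  proof (cases "of_int m / b \<le> of_int n / a")
    case True
    have "0 < n"
    proof (rule ccontr)
      assume "\<not> 0 < n"
      then have "n = 0" "0 < m" using nm nm0 by auto
      then show False using True b by (simp add: divide_le_0_iff)
    qed
    then show ?thesis using gapcond_unbounded_if_beyond_first_band[OF a b inf(2) k(1) gk n_def m_def _ True] by blast
  next
    case False
    have "0 < m"
    proof (rule ccontr)
      assume "\<not> 0 < m"
      then have "m = 0" "0 < n" using nm nm0 by auto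
      then show False using False a by simp
    qed
    then show ?thesis using gapcond_unbounded_if_beyond_first_band[OF b a inf(1) k(1) gk' m_def n_def, of R] False gapcond_commute by force
  qed
qed

theorem theorem6:
  fixes a b u :: real
  assumes "a > 0" and "b > 0" and "u > 0"
    and "infinite (best_lower_thirds (a / b))"
    and "infinite (best_lower_thirds (b / a))"
  shows "infinite (spectral_gaps (lattice_graph a b) (delta_hamiltonian a b u)) \<or>
         spectral_gaps (lattice_graph a b) (delta_hamiltonian a b u) = {}"
proof (rule ccontr)
  define \<R> where "\<R> = {x. gapcond a b u x}"
  define \<G> where "\<G> = spectral_gaps (lattice_graph a b) (delta_hamiltonian a b u)"
  have \<G>: "\<G> = {G \<in> components \<R>. bounded G}"
    by (simp add: \<G>_def \<R>_def spectral_gaps_def not_spectrum_iff_gapcond[OF assms(1-3)])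
  assume "\<not> ?thesis"
  then have fin: "finite \<G>" and "\<G> \<noteq> {}" by (auto simp: \<G>_def)
  then obtain G where G: "G \<in> components \<R>" "bounded G" by (auto simp: \<G>)
  obtain x where x: "x \<in> G" using G(1) in_components_nonempty by blast
  have xR: "x \<in> \<R>" using G(1) x in_components_subset by blast
  \<comment> \<open>A component containing the whole ray below \<open>x\<close> would be
    unbounded.\<close>
  have ny: "\<not> {..x} \<subseteq> \<R>"
  proof
    assume "{..x} \<subseteq> \<R>"
    then have "{..x} \<subseteq> G" using G(1) x by (intro components_maximal[OF G(1)]) auto
    then have "bounded {..x}" using G(2) bounded_subset by blast
    then obtain B where "\<And>y. y \<le> x \<Longrightarrow> \<bar>y\<bar> \<le> B" unfolding bounded_iff by auto
    from this[of "min x (- \<bar>B\<bar> - 1)"] show False by linarith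
  qed
  have "bounded (\<Union>\<G>)" using fin by (intro bounded_Union) (auto simp: \<G>)
  then obtain B where B: "\<And>y. y \<in> \<Union>\<G> \<Longrightarrow> \<bar>y\<bar> \<le> B" unfolding bounded_iff by auto
  \<comment> \<open>Dirichlet energies of the horizontal edges: points of the spectrum at arbitrary
    height, serving as fences for the components of \<open>\<R>\<close>.\<close>
  define s where "s j = (real j * pi / a)\<^sup>2" for j :: nat
  have s: "s j \<notin> \<R>" if "0 < j" for j
  proof -
    have k: "0 < real j * pi / a" using that assms(1) by simp
    show ?thesis using gapcond_square_iff[OF k, of a b u] assms(1) by (simp add: \<R>_def s_def)
  qed
  \<comment> \<open>\<open>y\<close> lies above all gaps by the choice of \<open>B\<close>, and
    above \<open>s 1\<close> so that its component is fenced off from the ray.\<close>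
  obtain y where y: "max B (s 1) < y" "y \<in> \<R>"
    using gapcond_unbounded[OF assms _ ny[unfolded \<R>_def], of "max B (s 1)"] xR by (auto simp: \<R>_def)
  obtain j :: nat where j: "max 1 (max 1 y * a) < real j" using reals_Archimedean2 by blast
  have ys: "y < s j"
  proof -
    have "max 1 y * a < real j" using j by linarith
    then have "max 1 y < real j / a" by (simp only: pos_less_divide_eq[OF assms(1)])
    also have "\<dots> \<le> real j * pi / a"
      using pi_gt3 assms(1) mult_left_mono[of 1 pi "real j"] by (intro divide_right_mono) auto
    finally have 1: "max 1 y < real j * pi / a" .
    then have "(real j * pi / a) * 1 \<le> (real j * pi / a) * (real j * pi / a)" by (intro mult_left_mono) auto
    with 1 show ?thesis by (simp add: s_def power2_eq_square)
  qed
  define C where "C = connected_component_set \<R> y"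
  have C: "C \<in> components \<R>" "y \<in> C" "connected C" "C \<subseteq> \<R>"
    using y(2) by (auto simp: C_def componentsI connected_component_subset intro: connected_component_refl)
  \<comment> \<open>A connected set containing \<open>y\<close> and avoiding both fences stays
    between them; hence \<open>C\<close> is a gap above all gaps, a contradiction.\<close>
  have "C \<subseteq> {s 1..s j}"
  proof
    fix z assume z: "z \<in> C"
    have iv: "{min y z..max y z} \<subseteq> C"
      using connected_contains_Icc[OF C(3)] C(2) z by (cases "y \<le> z") (auto simp: min_def max_def)
    have "s 1 \<notin> C" "s j \<notin> C" using s C(4) j by auto
    then have "s 1 \<notin> {min y z..max y z}" "s j \<notin> {min y z..max y z}" using iv by blast+
    then show "z \<in> {s 1..s j}" using y(1) ys by auto
  qed
  then have "bounded C" using bounded_subset bounded_closed_interval by blast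
  then have "C \<in> \<G>" using C(1) by (simp add: \<G>)
  then have "\<bar>y\<bar> \<le> B" using B C(2) by blast
  then show False using y(1) by linarith
qed

end
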